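(* Let $d\geqslant 1$ and let $(\mathbf{X}_k)_{k\geqslant 0}$ be a $d$-type Galton-Watson process satisfying assumption $(A_1)$ (stated in the context), with Perron root $\rho$ and extinction probability vector $\mathbf{q}$. Let $S$ be a subset of $\mathbb{N}^d\setminus\{\mathbf{0}\}$ and put $S^c=\mathbb{N}^d\setminus(\{\mathbf{0}\}\cup S)$. If $\rho\leqslant 1$, assume in addition one of the following assumptions: $(a_1)$ $S$ is finite and accessible, i.e. for every $\mathbf{x}\in\mathbb{N}^d\setminus\{\mathbf{0}\}$ there exists $n\in\mathbb{N}$ such that $\mathbb{P}_{\mathbf{x}}(\mathbf{X}_n\in S)>0$; $(a_2)$ $S^c$ is finite; $(a_3)$ $(\mathbf{X}_k)_{k\geqslant 0}$ is subcritical (that is, $\rho<1$) and $\mathbb{E}_{\mathbf{e}_i}(X_{1,j}\ln X_{1,j})<+\infty$ for all $i,j=1,\ldots,d$. Then for all $\mathbf{x}_0\in\mathbb{N}^d\setminus\{\mathbf{0}\}$, all positive integers $k_1\leqslant\ldots\leqslant k_j$ and all $\mathbf{x}_1,\ldots,\mathbf{x}_j\in\mathbb{N}^d$, $$\lim_{n\to+\infty}\mathbb{P}_{\mathbf{x}_0}\left(\mathbf{X}_{k_1}=\mathbf{x}_1,\ldots,\mathbf{X}_{k_j}=\mathbf{x}_j\mid \mathbf{X}_{k_j+n}\in S,\ T<+\infty\right)=\frac{1}{\overline{\rho}^{\,k_j}}\,\frac{\mathbf{x}_j\cdot\overline{\mathbf{u}}}{\mathbf{x}_0\cdot\overline{\mathbf{u}}}\,\mathbb{P}_{\mathbf{x}_0}\left(\overline{\mathbf{X}}_{k_1}=\mathbf{x}_1,\ldots,\overline{\mathbf{X}}_{k_j}=\mathbf{x}_j\right),$$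 where $(\overline{\mathbf{X}}_k)_{k\geqslant 0}$ is the associated process with respect to $\mathbf{q}$, and $\overline{\rho}$, $\overline{\mathbf{u}}$ are the Perron root and the normalized right Perron eigenvector of its mean matrix.
   Context: Notation. $\mathbb{N}=\{0,1,2,\ldots\}$; vectors $\mathbf{x}=(x_1,\ldots,x_d)$; $\mathbf{e}_i$ is the $i$-th unit vector; $\mathbf{0}=(0,\ldots,0)$, $\mathbf{1}=(1,\ldots,1)$; $\mathbf{x}\mathbf{y}$ is the vector with coordinates $x_iy_i$; $\mathbf{x}^{\mathbf{y}}=\prod_{i}x_i^{y_i}$; $\mathbf{x}\cdot\mathbf{y}$ is the scalar product; $\mathbf{x}<\mathbf{y}$ means $x_i<y_i$ for every $i$. A $d$-type Galton-Watson process $(\mathbf{X}_k)_{k\geqslant 0}$ is the Markov chain on $\mathbb{N}^d$ in which, at each generation, every individual of type $i$ independently produces a random offspring vector with law $p_i$ on $\mathbb{N}^d$, and $\mathbf{X}_{k+1}$ is the sum of the offspring vectors of the individuals counted by $\mathbf{X}_k$. The subscript in $\mathbb{P}_{\mathbf{x}},\mathbb{E}_{\mathbf{x}}$ denotes the initial state $\mathbf{X}_0=\mathbf{x}$; $X_{k,j}$ is the $j$-th coordinate of $\mathbf{X}_k$. The offspring generating function is $\mathbf{f}=(f_1,\ldots,f_d)$, $f_i(\mathbf{r})=\sum_{\mathbf{k}\in\mathbb{N}^d}p_i(\mathbf{k})\mathbf{r}^{\mathbf{k}}$. The mean matrix is $\mathbf{M}=(m_{ij})_{1\leqslant i,j\leqslant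 d}$ with $m_{ij}=\mathbb{E}_{\mathbf{e}_i}(X_{1,j})$. $\rho$ denotes the Perron root of $\mathbf{M}$, and $\mathbf{u},\mathbf{v}$ the associated right and left eigenvectors, $\mathbf{M}\mathbf{u}^T=\rho\mathbf{u}^T$, $\mathbf{v}\mathbf{M}=\rho\mathbf{v}$, normalized by $\mathbf{u}\cdot\mathbf{1}=\mathbf{u}\cdot\mathbf{v}=1$. The process is critical, subcritical, supercritical if $\rho=1$, $\rho<1$, $\rho>1$ respectively. The extinction time is $T=\inf\{k\in\mathbb{N}:\mathbf{X}_k=\mathbf{0}\}$, and the extinction probability vector is $\mathbf{q}=(q_1,\ldots,q_d)$, $q_i=\mathbb{P}_{\mathbf{e}_i}(T<+\infty)$. Assumption $(A_1)$: $\mathbf{M}$ has finite entries; the process is nonsingular ($\mathbf{f}(\mathbf{r})\neq\mathbf{M}\mathbf{r}$, i.e. $\mathbf{f}$ is not the linear map $\mathbf{r}\mapsto\mathbf{M}\mathbf{r}$) and positive regular (there is $n\geqslant 1$ such that every entry of $\mathbf{M}^n$ is positive); and $\mathbf{q}>\mathbf{0}$. Associated process. For a vector $\mathbf{a}>\mathbf{0}$ with $f_i(\mathbf{a})<+\infty$ for every $i$, the associated process with respect to $\mathbf{a}$, denoted $(\overline{\mathbf{X}}_k)_{k\geqslant 0}$, is the $d$-type Galton-Watson process with offspring generating function $\overline{f}_i(\mathbf{r})=f_i(\mathbf{a}\mathbf{r})/f_i(\mathbf{a})$, $\mathbf{r}\in[0,1]^d$, $i=1,\ldots,d$. Quantities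 relative to it carry an overline (mean matrix, Perron root $\overline{\rho}$, eigenvectors $\overline{\mathbf{u}},\overline{\mathbf{v}}$ with the same normalization).
   Formalization: S is assumed accessible in all cases, not only in (a1); without this the conditioning can be undefined (S empty) or the limit false (d=1, p(0)=1-m, p(1)=m, S={2,3,...}, x_0=3). *)

theory Defs
  imports "HOL-Probability.Probability"
begin

definition real_vec :: "nat ^ 'd \<Rightarrow> real ^ 'd" where
  "real_vec x = (\<chi> i. real (x $ i))"

section \<open>Perron root and right Perron eigenvector\<close>

text \<open>The instance of \<open>^\<close> on type \<open>vec\<close> is the componentwise power, hence a separate matrix power.\<close>

definition matrix_pow :: "real ^ 'd ^ 'd \<Rightarrow> nat \<Rightarrow> real ^ 'd ^ 'd" where
  "matrix_pow A n = ((\<lambda>B. A ** B) ^^ n) (mat 1)"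

definition complex_eigenvalues :: "real ^ 'd ^ 'd \<Rightarrow> complex set" where
  "complex_eigenvalues A =
     {z. \<exists>w :: complex ^ 'd. w \<noteq> 0 \<and> (\<chi> i j. complex_of_real (A $ i $ j)) *v w = z *s w}"

text \<open>The Perron root is the spectral radius: for a nonnegative matrix with a positive power it is
  a simple eigenvalue, by the Perron--Frobenius theorem.\<close>

definition perron_root :: "real ^ 'd ^ 'd \<Rightarrow> real" where
  "perron_root A = (SUP z \<in> complex_eigenvalues A. cmod z)"

definition perron_right :: "real ^ 'd ^ 'd \<Rightarrow> real ^ 'd" where
  "perron_right A = (THE u. A *v u = perron_root A *s u \<and> u \<bullet> 1 = 1)"

section \<open>Multitype Galton--Watson processes\<close>

text \<open>The types are the elements of the finite type \<open>'d\<close>; \<open>p i\<close> is the offspring law of type \<open>i\<close>.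
  In \<open>gw_step p x\<close> the individuals of a generation \<open>x\<close> are the pairs \<open>(i, m)\<close> with \<open>m < x $ i\<close>;
  their offspring vectors are independent and are summed up.\<close>

definition gw_step :: "('d \<Rightarrow> (nat ^ 'd) pmf) \<Rightarrow> nat ^ 'd \<Rightarrow> (nat ^ 'd) pmf" where
  "gw_step p x =
     (let I = {(i, m). m < x $ i}
      in map_pmf (\<lambda>\<xi>. \<Sum>a\<in>I. \<xi> a) (Pi_pmf I 0 (\<lambda>(i, m). p i)))"

text \<open>\<open>P x\<close> is the probability measure under which the chain \<open>X\<close> starts in \<open>x\<close>.\<close>

definition gw_process ::
    "('d \<Rightarrow> (nat ^ 'd) pmf) \<Rightarrow> (nat ^ 'd \<Rightarrow> 'w measure) \<Rightarrow> (nat \<Rightarrow> 'w \<Rightarrow> nat ^ 'd) \<Rightarrow> bool" where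
  "gw_process p P X \<longleftrightarrow>
     (\<forall>x. prob_space (P x) \<and>
          (\<forall>k. X k \<in> measurable (P x) (count_space UNIV)) \<and>
          (\<forall>n y. \<P>(\<omega> in P x. \<forall>k\<le>n. X k \<omega> = y k) =
             (if y 0 = x then \<Prod>k<n. pmf (gw_step p (y k)) (y (Suc k)) else 0)))"

definition offspring_gf :: "('d \<Rightarrow> (nat ^ 'd) pmf) \<Rightarrow> 'd \<Rightarrow> real ^ 'd \<Rightarrow> real" where
  "offspring_gf p i r = (\<Sum>\<^sub>\<infinity>k. pmf (p i) k * (\<Prod>j\<in>UNIV. r $ j ^ (k $ j)))"

definition mean_matrix ::
    "(nat ^ 'd \<Rightarrow> 'w measure) \<Rightarrow> (nat \<Rightarrow> 'w \<Rightarrow> nat ^ 'd) \<Rightarrow> real ^ 'd ^ 'd" where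
  "mean_matrix P X = (\<chi> i j. \<integral>\<omega>. real (X 1 \<omega> $ j) \<partial>P (axis i 1))"

definition extinction_time :: "(nat \<Rightarrow> 'w \<Rightarrow> nat ^ 'd) \<Rightarrow> 'w \<Rightarrow> enat" where
  "extinction_time X \<omega> = (INF k \<in> {k. X k \<omega> = 0}. enat k)"

definition extinction_prob ::
    "(nat ^ 'd \<Rightarrow> 'w measure) \<Rightarrow> (nat \<Rightarrow> 'w \<Rightarrow> nat ^ 'd) \<Rightarrow> real ^ 'd" where
  "extinction_prob P X = (\<chi> i. \<P>(\<omega> in P (axis i 1). extinction_time X \<omega> < \<infinity>))"

definition finite_means :: "(nat ^ 'd \<Rightarrow> 'w measure) \<Rightarrow> (nat \<Rightarrow> 'w \<Rightarrow> nat ^ 'd) \<Rightarrow> bool" where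
  "finite_means P X \<longleftrightarrow> (\<forall>i j. integrable (P (axis i 1)) (\<lambda>\<omega>. real (X 1 \<omega> $ j)))"

definition nonsingular ::
    "('d \<Rightarrow> (nat ^ 'd) pmf) \<Rightarrow> (nat ^ 'd \<Rightarrow> 'w measure) \<Rightarrow> (nat \<Rightarrow> 'w \<Rightarrow> nat ^ 'd) \<Rightarrow> bool" where
  "nonsingular p P X \<longleftrightarrow>
     \<not> (\<forall>r. (\<forall>i. r $ i \<in> {0..1}) \<longrightarrow> (\<forall>i. offspring_gf p i r = (mean_matrix P X *v r) $ i))"

definition positive_regular :: "(nat ^ 'd \<Rightarrow> 'w measure) \<Rightarrow> (nat \<Rightarrow> 'w \<Rightarrow> nat ^ 'd) \<Rightarrow> bool" where
  "positive_regular P X \<longleftrightarrow> (\<exists>n\<ge>1. \<forall>i j. matrix_pow (mean_matrix P X) n $ i $ j > 0)"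

text \<open>The order \<open><\<close> on type \<open>vec\<close> is not the componentwise strict order, hence the explicit
  quantifier in the last conjunct.\<close>

definition assumption_A1 ::
    "('d \<Rightarrow> (nat ^ 'd) pmf) \<Rightarrow> (nat ^ 'd \<Rightarrow> 'w measure) \<Rightarrow> (nat \<Rightarrow> 'w \<Rightarrow> nat ^ 'd) \<Rightarrow> bool" where
  "assumption_A1 p P X \<longleftrightarrow>
     finite_means P X \<and> nonsingular p P X \<and> positive_regular P X \<and>
     (\<forall>i. extinction_prob P X $ i > 0)"

definition accessible ::
    "(nat ^ 'd \<Rightarrow> 'w measure) \<Rightarrow> (nat \<Rightarrow> 'w \<Rightarrow> nat ^ 'd) \<Rightarrow> (nat ^ 'd) set \<Rightarrow> bool" where
  "accessible P X S \<longleftrightarrow> (\<forall>x. x \<noteq> 0 \<longrightarrow> (\<exists>n. \<P>(\<omega> in P x. X n \<omega> \<in> S) > 0))"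

text \<open>Since \<open>ln 0 = 0\<close>, the convention \<open>0 ln 0 = 0\<close> is built in. The integrand is nonnegative, so
  integrability means finite expectation.\<close>

definition finite_X_ln_X :: "(nat ^ 'd \<Rightarrow> 'w measure) \<Rightarrow> (nat \<Rightarrow> 'w \<Rightarrow> nat ^ 'd) \<Rightarrow> bool" where
  "finite_X_ln_X P X \<longleftrightarrow>
     (\<forall>i j. integrable (P (axis i 1)) (\<lambda>\<omega>. real (X 1 \<omega> $ j) * ln (real (X 1 \<omega> $ j))))"

text \<open>\<open>p'\<close> is the family of offspring laws of the associated process with respect to \<open>a\<close>;
  the product \<open>a * r\<close> of vectors is componentwise.\<close>

definition associated_offspring ::
    "('d \<Rightarrow> (nat ^ 'd) pmf) \<Rightarrow> real ^ 'd \<Rightarrow> ('d \<Rightarrow> (nat ^ 'd) pmf) \<Rightarrow> bool" where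
  "associated_offspring p a p' \<longleftrightarrow>
     (\<forall>i r. (\<forall>j. r $ j \<in> {0..1}) \<longrightarrow>
        offspring_gf p' i r = offspring_gf p i (a * r) / offspring_gf p i a)"

end

theory Submission
  imports Defs
begin

text \<open>
  The extinction probabilities \<open>q\<close> define a multiplicative function \<open>q\<^sup>x\<close> on states which is harmonic for
  the transition kernel. Reweighting by it turns the process restricted to extinction into the
  associated process, which dies out almost surely. The conditional probability becomes the path
  probability of the associated process times the ratio \<open>P\<^sub>y(X\<^sub>n \<in> S) / P\<^sub>x(X\<^bsub>k+n\<^esub> \<in> S)\<close> for that
  process, so the theorem reduces to a ratio limit theorem under almost sure extinction.

  Let \<open>a\<^sub>n\<close> be the vector of hitting probabilities of \<open>S\<close> at time \<open>n\<close> from single individuals. From a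
  fixed population, with high probability at most one ancestor has living descendants at a late
  time \<open>n\<close>, so \<open>P\<^sub>x(X\<^sub>n \<in> S) \<approx> x \<cdot> a\<^sub>n\<close>; averaging over the first generation gives
  \<open>a\<^bsub>n+1\<^esub> \<approx> M a\<^sub>n\<close>. The errors are negligible as soon as \<open>a\<^sub>n\<close> is comparable, uniformly in the
  type, with the probability of hitting a set \<open>F \<supseteq> S\<close> closed under passing to subpopulations. For
  such almost-solutions of a primitive linear recursion the direction converges to the Perron
  eigenvector and the growth factor to the Perron root. Comparability holds with \<open>F\<close> the finite set of
  subpopulations of members of \<open>S\<close> if \<open>S\<close> is finite; with all nonzero states if \<open>S\<^sup>c\<close> is finite, because
  large populations do not become small in bounded time; and with all nonzero states in the
  subcritical case, because the population conditioned on survival is tight. A supercritical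
  process has a subcritical associated process, by convexity of the generating function.
\<close>

text \<open>The obstacle is that \<open>S\<close> is arbitrary: two populations outside
  \<open>S\<close> may have their sum in \<open>S\<close>, so hitting probabilities of
  \<open>S\<close> are not subadditive in the initial population, and the error of linearising them
  cannot be bounded in terms of themselves. The closed set \<open>F\<close> is introduced for this.
  Hits of \<open>F\<close> obey a union bound over ancestors, and the linearisation error at time
  \<open>n\<close> is at most a constant, depending on the initial population, times the probability
  of hitting \<open>F\<close> times the probability of survival. After division by the hitting
  probability of \<open>F\<close>, the survival factor tends to 0, and the same union bound makes
  the size of the first generation an integrable envelope. Dominated convergence therefore works
  with finite means, although the pointwise error is quadratic in the population. What remains is to
  bound hits of \<open>S\<close> from below by hits of \<open>F\<close>, where a constant factor and
  a fixed time shift \<open>L\<close> may be lost; a Harnack inequality between types absorbs the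
  shift and the dependence on the type.\<close>

text \<open>Keeps the unit vectors in the form \<open>axis i 1\<close>.\<close>

declare One_nat_def [simp del]

section \<open>Primitive matrices\<close>

lemma matrix_pow_0 [simp]: "matrix_pow A 0 = mat 1"
  by (simp add: matrix_pow_def)

lemma matrix_pow_Suc [simp]: "matrix_pow A (Suc n) = A ** matrix_pow A n"
  by (simp add: matrix_pow_def)

lemma matrix_pow_add: "matrix_pow A (m + n) = matrix_pow A m ** matrix_pow A n"
  by (induction m) (simp_all add: matrix_mul_assoc)

lemma matrix_pow_nonneg:
  assumes "\<And>i j. 0 \<le> A $ i $ j"
  shows "0 \<le> matrix_pow A n $ i $ j"
proof (induction n arbitrary: i j)
  case 0
  then show ?case by (simp add: mat_def)
next
  case (Suc n)
  then show ?case
    by (auto simp: matrix_matrix_mult_def intro!: sum_nonneg mult_nonneg_nonneg assms)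
qed

lemma matrix_pow_eigenvector:
  fixes A :: "real ^ 'd ^ 'd"
  assumes "A *v u = c *s u"
  shows "matrix_pow A n *v u = c ^ n *s u"
proof (induction n)
  case (Suc n)
  have "matrix_pow A (Suc n) *v u = A *v (matrix_pow A n *v u)"
    by (simp add: matrix_vector_mul_assoc)
  also have "\<dots> = c ^ Suc n *s u"
    by (simp add: Suc matrix_vector_mult_scaleR flip: scalar_mult_eq_scaleR)
       (simp add: scalar_mult_eq_scaleR matrix_vector_mult_scaleR assms mult.commute)
  finally show ?case .
qed simp

definition primitive_matrix :: "real ^ 'd ^ 'd \<Rightarrow> bool" where
  "primitive_matrix A \<longleftrightarrow>
     (\<forall>i j. 0 \<le> A $ i $ j) \<and> (\<exists>n\<ge>1. \<forall>i j. 0 < matrix_pow A n $ i $ j)"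

lemma primitive_matrix_nonneg: "primitive_matrix A \<Longrightarrow> 0 \<le> A $ i $ j"
  by (auto simp: primitive_matrix_def)

text \<open>A zero row of \<open>A\<close> would be a zero row of its positive power, and left
  multiplication by a nonnegative matrix without zero rows preserves positivity. Having all late
  powers positive lets such indices be enlarged to meet further requirements.\<close>

lemma primitive_matrix_pow_pos:
  assumes "primitive_matrix A"
  obtains N where "N \<ge> 1" "\<And>n i j. n \<ge> N \<Longrightarrow> 0 < matrix_pow A n $ i $ j"
proof -
  obtain N where N: "N \<ge> 1" "\<And>i j. 0 < matrix_pow A N $ i $ j"
    using assms by (auto simp: primitive_matrix_def)
  note nn = primitive_matrix_nonneg[OF assms]
  have row: "\<exists>k. A $ i $ k > 0" for i
  proof (rule ccontr)
    assume "\<nexists>k. A $ i $ k > 0"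
    then have 0: "A $ i $ k = 0" for k using nn[of i k] by (metis less_eq_real_def)
    obtain m where "N = Suc m" using N(1) by (cases N) auto
    then have "matrix_pow A N $ i $ i = 0" by (simp add: matrix_matrix_mult_def 0)
    then show False using N(2)[of i i] by simp
  qed
  have "0 < matrix_pow A (N + n) $ i $ j" for n i j
  proof (induction n arbitrary: i j)
    case 0
    then show ?case using N by simp
  next
    case (Suc n)
    obtain k where k: "A $ i $ k > 0" using row by blast
    have "0 < A $ i $ k * matrix_pow A (N + n) $ k $ j" using k Suc by simp
    also have "\<dots> \<le> (\<Sum>k\<in>UNIV. A $ i $ k * matrix_pow A (N + n) $ k $ j)"
      by (rule member_le_sum) (auto intro: mult_nonneg_nonneg nn less_imp_le[OF Suc])
    finally show ?case by (simp add: matrix_matrix_mult_def)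
  qed
  then have "0 < matrix_pow A n $ i $ j" if "n \<ge> N" for n i j
    using that by (metis le_add_diff_inverse)
  with that N(1) show ?thesis by blast
qed

lemma positive_matrix_mult_vec_pos:
  fixes B :: "real ^ 'd ^ 'd"
  assumes B: "\<And>i j. 0 < B $ i $ j" and x: "\<And>j. 0 \<le> x $ j" "x \<noteq> 0"
  shows "0 < (B *v x) $ i"
proof -
  obtain j where "x $ j \<noteq> 0" using x(2) by (auto simp: vec_eq_iff)
  then have j: "x $ j > 0" using x(1)[of j] by simp
  have "0 < B $ i $ j * x $ j" using B j by simp
  also have "\<dots> \<le> (\<Sum>j\<in>UNIV. B $ i $ j * x $ j)"
    by (rule member_le_sum) (auto intro: mult_nonneg_nonneg less_imp_le[OF B] x)
  finally show ?thesis by (simp add: matrix_vector_mult_def)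
qed

lemma inner_one_eq_sum: "x \<bullet> (1 :: real ^ 'd) = (\<Sum>i\<in>UNIV. x $ i)"
  by (simp add: inner_vec_def)

text \<open>Brouwer's theorem on the probability simplex \<open>K\<close>, applied to
  \<open>x \<mapsto> A x\<close> renormalised to total 1.\<close>

lemma primitive_matrix_eigenvector_exists:
  fixes A :: "real ^ 'd ^ 'd"
  assumes "primitive_matrix A"
  obtains u c where "\<And>i. 0 < u $ i" "u \<bullet> 1 = 1" "0 < c" "A *v u = c *s u"
proof -
  note nn = primitive_matrix_nonneg[OF assms]
  obtain N where N: "N \<ge> 1" "\<And>n i j. n \<ge> N \<Longrightarrow> 0 < matrix_pow A n $ i $ j"
    using primitive_matrix_pow_pos[OF assms] by blast
  define K where "K = {x :: real ^ 'd. (\<forall>i. 0 \<le> x $ i) \<and> x \<bullet> 1 = 1}"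
  have Ann: "0 \<le> (A *v x) $ i" if "x \<in> K" for x i
    using that by (auto simp: K_def matrix_vector_mult_def intro!: sum_nonneg mult_nonneg_nonneg nn)
  \<comment> \<open>The renormalisation never divides by zero: \<open>A x = 0\<close> would give
    \<open>A^N x = 0\<close>, whereas \<open>A^N\<close> is positive and \<open>x\<close> is
    nonzero.\<close>
  have Apos: "0 < (A *v x) \<bullet> 1" if x: "x \<in> K" for x
  proof (rule ccontr)
    assume "\<not> 0 < (A *v x) \<bullet> 1"
    then have "(A *v x) \<bullet> 1 = 0"
      using sum_nonneg[of UNIV "\<lambda>i. (A *v x) $ i"] Ann[OF x] by (auto simp: inner_one_eq_sum)
    then have "A *v x = 0"
      using Ann[OF x] by (simp add: inner_one_eq_sum sum_nonneg_eq_0_iff vec_eq_iff)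
    moreover obtain m where "N = m + 1" using N(1) by (metis add.commute le_iff_add)
    ultimately have "matrix_pow A N *v x = 0"
      by (simp add: matrix_pow_add matrix_vector_mul_assoc[symmetric] One_nat_def del: add_Suc_right)
    moreover have "x \<noteq> 0" using x by (auto simp: K_def)
    ultimately show False
      using positive_matrix_mult_vec_pos[of "matrix_pow A N" x] N(2) x by (auto simp: K_def)
  qed
  have "bounded K"
    unfolding bounded_iff
  proof (intro exI ballI)
    fix x assume x: "x \<in> K"
    then have "norm x \<le> (\<Sum>i\<in>UNIV. \<bar>x $ i\<bar>)" by (intro norm_le_l1_cart)
    also have "\<dots> = 1" using x by (simp add: K_def inner_one_eq_sum)
    finally show "norm x \<le> 1" .
  qed
  moreover have "closed K"
    unfolding K_def by (intro closed_Collect_conj closed_Collect_all closed_Collect_le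
        closed_Collect_eq continuous_intros)
  ultimately have "compact K" by (simp add: compact_eq_bounded_closed)
  moreover have "convex K"
    unfolding convex_def K_def by (auto simp: inner_add_left)
  moreover have "axis undefined 1 \<in> K"
    by (auto simp: K_def axis_def inner_one_eq_sum)
  then have "K \<noteq> {}" by blast
  moreover have "continuous_on K (\<lambda>x. (1 / ((A *v x) \<bullet> 1)) *\<^sub>R (A *v x))"
    using Apos
    by (intro continuous_intros linear_continuous_on[OF matrix_vector_mul_bounded_linear])
      (metis less_irrefl)
  moreover have "(\<lambda>x. (1 / ((A *v x) \<bullet> 1)) *\<^sub>R (A *v x)) \<in> K \<rightarrow> K"
  proof
    fix x assume x: "x \<in> K"
    show "(1 / ((A *v x) \<bullet> 1)) *\<^sub>R (A *v x) \<in> K"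
      using Apos[OF x] Ann[OF x] unfolding K_def by simp
  qed
  ultimately obtain u where u: "u \<in> K" "(1 / ((A *v u) \<bullet> 1)) *\<^sub>R (A *v u) = u"
    using brouwer[of K "\<lambda>x. (1 / ((A *v x) \<bullet> 1)) *\<^sub>R (A *v x)"] by blast
  define c where "c = (A *v u) \<bullet> 1"
  have c: "c > 0" using Apos[OF u(1)] by (simp add: c_def)
  have eig: "A *v u = c *s u"
  proof -
    have "c *s u = c *\<^sub>R ((1 / c) *\<^sub>R (A *v u))"
      using u(2) by (simp add: scalar_mult_eq_scaleR c_def)
    then show ?thesis using c by simp
  qed
  \<comment> \<open>The fixed point is only known to be nonnegative; strict positivity is read off
    from \<open>c ^ N * u = A^N u\<close>.\<close>
  have "0 < u $ i" for i
  proof -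
    have "0 < (matrix_pow A N *v u) $ i"
      using u(1) by (intro positive_matrix_mult_vec_pos N) (auto simp: K_def)
    then show ?thesis using c by (simp add: matrix_pow_eigenvector[OF eig] zero_less_mult_iff)
  qed
  with that c eig u(1) show ?thesis by (auto simp: K_def)
qed

text \<open>\<open>perron_root\<close> is a supremum over complex eigenvalues and
  \<open>perron_right\<close> a definite description, so two facts are needed about the pair
  \<open>u\<close>, \<open>c\<close>: no eigenvalue exceeds \<open>c\<close> in modulus, and
  \<open>u\<close> is the only normalised eigenvector for \<open>c\<close>, also among vectors of
  mixed sign.\<close>

theorem perron_frobenius:
  fixes A :: "real ^ 'd ^ 'd"
  assumes "primitive_matrix A"
  shows "0 < perron_root A" "A *v perron_right A = perron_root A *s perron_right A"
    "\<And>i. 0 < perron_right A $ i"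
proof -
  note nn = primitive_matrix_nonneg[OF assms]
  obtain u c where u: "\<And>i. 0 < u $ i" "u \<bullet> 1 = 1" "0 < c" "A *v u = c *s u"
    using primitive_matrix_eigenvector_exists[OF assms] by blast
  have le: "cmod z \<le> c" if z: "z \<in> complex_eigenvalues A" for z
  proof -
    obtain w :: "complex ^ 'd" where w: "w \<noteq> 0"
        "(\<chi> i j. complex_of_real (A $ i $ j)) *v w = z *s w"
      using z unfolding complex_eigenvalues_def by blast
    \<comment> \<open>The eigenvalue equation is read at a component where \<open>b *s u\<close>
      touches the moduli of \<open>w\<close>; there the triangle inequality yields
      \<open>cmod z \<le> c\<close>.\<close>
    define b where "b = Max (range (\<lambda>i. cmod (w $ i) / u $ i))"
    have "b \<in> range (\<lambda>i. cmod (w $ i) / u $ i)" unfolding b_def by (rule Max_in) auto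
    then obtain i where i: "b = cmod (w $ i) / u $ i" by auto
    have b: "cmod (w $ j) \<le> b * u $ j" for j
    proof -
      have "cmod (w $ j) / u $ j \<le> b" unfolding b_def by (rule Max_ge) auto
      then show ?thesis using u(1)[of j] by (simp add: field_simps)
    qed
    obtain j where "w $ j \<noteq> 0" using w(1) by (auto simp: vec_eq_iff)
    then have "0 < b * u $ j" using b[of j] by (meson less_le_trans zero_less_norm_iff)
    then have bpos: "b > 0" using u(1)[of j] by (simp add: zero_less_mult_iff)
    have "cmod z * cmod (w $ i) = cmod (\<Sum>j\<in>UNIV. complex_of_real (A $ i $ j) * w $ j)"
      using arg_cong[OF w(2), of "\<lambda>v. cmod (v $ i)"]
      by (simp add: matrix_vector_mult_def norm_mult)
    also have "\<dots> \<le> (\<Sum>j\<in>UNIV. A $ i $ j * (b * u $ j))"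
      using nn b by (intro order_trans[OF norm_sum] sum_mono) (auto simp: norm_mult intro!: mult_mono)
    also have "\<dots> = b * (A *v u) $ i"
      by (simp add: matrix_vector_mult_def sum_distrib_left mult_ac)
    also have "\<dots> = c * cmod (w $ i)" using u(1)[of i] by (simp add: u(4) i)
    finally show ?thesis using bpos u(1)[of i] by (auto simp: i zero_less_divide_iff)
  qed
  have "complex_of_real c \<in> complex_eigenvalues A"
  proof -
    have "(\<chi> i. complex_of_real (u $ i)) \<noteq> 0"
      using u(1)[of undefined] by (simp add: vec_eq_iff) (intro exI[of _ undefined], simp)
    moreover have "(\<chi> i j. complex_of_real (A $ i $ j)) *v (\<chi> i. complex_of_real (u $ i))
        = complex_of_real c *s (\<chi> i. complex_of_real (u $ i))"
      using u(4) by (simp add: vec_eq_iff matrix_vector_mult_def flip: of_real_mult of_real_sum)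
    ultimately show ?thesis unfolding complex_eigenvalues_def by blast
  qed
  then have root: "perron_root A = c"
    unfolding perron_root_def using le u(3)
    by (intro cSup_eq_maximum) (auto intro!: image_eqI[of _ _ "complex_of_real c"])
  have uniq: "v = u" if v: "A *v v = c *s v" "v \<bullet> 1 = 1" for v
  proof -
    \<comment> \<open>Subtracting the largest multiple of \<open>u\<close> that stays below
      \<open>v\<close> leaves a nonnegative eigenvector with a vanishing component; positivity of
      \<open>A^N\<close> forces it to be 0.\<close>
    define b where "b = Min (range (\<lambda>i. v $ i / u $ i))"
    have "b \<in> range (\<lambda>i. v $ i / u $ i)" unfolding b_def by (rule Min_in) auto
    then obtain i where i: "b = v $ i / u $ i" by auto
    have b: "b * u $ j \<le> v $ j" for j
    proof -
      have "b \<le> v $ j / u $ j" unfolding b_def by (rule Min_le) auto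
      then show ?thesis using u(1)[of j] by (simp add: field_simps)
    qed
    define w where "w = v - b *s u"
    have wnn: "0 \<le> w $ j" for j using b[of j] by (simp add: w_def)
    have wi: "w $ i = 0" using u(1)[of i] by (simp add: w_def i)
    have weig: "A *v w = c *s w"
      by (simp add: w_def scalar_mult_eq_scaleR matrix_vector_mult_diff_distrib
          matrix_vector_mult_scaleR v[unfolded scalar_mult_eq_scaleR] u(4)[unfolded scalar_mult_eq_scaleR]
          scaleR_diff_right)
    obtain N where N: "N \<ge> 1" "\<And>n i j. n \<ge> N \<Longrightarrow> 0 < matrix_pow A n $ i $ j"
      using primitive_matrix_pow_pos[OF assms] by blast
    have "w = 0"
    proof (rule ccontr)
      assume "w \<noteq> 0"
      then have "0 < (matrix_pow A N *v w) $ i"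
        by (intro positive_matrix_mult_vec_pos N wnn) auto
      then show False by (simp add: matrix_pow_eigenvector[OF weig] wi)
    qed
    then have v_eq: "v = b *\<^sub>R u" by (simp add: w_def scalar_mult_eq_scaleR)
    then have "b = 1" using v(2) u(2) by simp
    then show ?thesis using v_eq by simp
  qed
  have right: "perron_right A = u"
    unfolding perron_right_def root
    by (rule the_equality) (use u(2,4) uniq in blast)+
  show "0 < perron_root A" "A *v perron_right A = perron_root A *s perron_right A"
    "\<And>i. 0 < perron_right A $ i"
    using u by (auto simp: root right)
qed

text \<open>The least multiple of \<open>w\<close> above the Perron vector touches it somewhere. At
  the touching component, bounds on \<open>A *v w\<close> become bounds on the Perron root.\<close>

lemma perron_right_dominated:
  fixes A :: "real ^ 'd ^ 'd"
  assumes "primitive_matrix A" "\<And>i. 0 < w $ i"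
  obtains c i where "0 < c" "\<And>j. perron_right A $ j \<le> c * w $ j" "perron_right A $ i = c * w $ i"
proof -
  let ?u = "perron_right A"
  have u: "0 < ?u $ i" for i using perron_frobenius(3)[OF assms(1)] .
  define c where "c = Max (range (\<lambda>i. ?u $ i / w $ i))"
  have "c \<in> range (\<lambda>i. ?u $ i / w $ i)" unfolding c_def by (rule Max_in) auto
  then obtain i where i: "c = ?u $ i / w $ i" by auto
  have max: "?u $ j / w $ j \<le> c" for j unfolding c_def by (rule Max_ge) auto
  have "?u $ j \<le> c * w $ j" for j using max[of j] assms(2)[of j] by (simp add: pos_divide_le_eq)
  moreover have "0 < c" "?u $ i = c * w $ i" using u[of i] assms(2)[of i] by (simp_all add: i)
  ultimately show ?thesis using that by blast
qed

section \<open>Subinvariant vectors and the size of the Perron root\<close>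

lemma matrix_vector_mono:
  fixes A :: "real ^ 'd ^ 'd"
  assumes "\<And>i j. 0 \<le> A $ i $ j" "\<And>j. x $ j \<le> y $ j"
  shows "(A *v x) $ i \<le> (A *v y) $ i"
  using assms by (auto simp: matrix_vector_mult_def intro!: sum_mono mult_left_mono)

lemma perron_root_le_1_of_subinvariant:
  fixes A :: "real ^ 'd ^ 'd"
  assumes A: "primitive_matrix A" and w: "\<And>i. 0 < w $ i" and le: "\<And>i. (A *v w) $ i \<le> w $ i"
  shows "perron_root A \<le> 1"
proof -
  let ?u = "perron_right A"
  obtain c i where c: "0 < c" "\<And>j. ?u $ j \<le> c * w $ j" "?u $ i = c * w $ i"
    using perron_right_dominated[OF A w] by blast
  have "perron_root A * ?u $ i = (A *v ?u) $ i" by (simp add: perron_frobenius(2)[OF A])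
  also have "\<dots> \<le> (A *v (c *\<^sub>R w)) $ i"
    by (intro matrix_vector_mono primitive_matrix_nonneg[OF A]) (simp add: c(2))
  also have "\<dots> = c * (A *v w) $ i" by (simp add: matrix_vector_mult_scaleR)
  also have "\<dots> \<le> 1 * ?u $ i" using c(1) le[of i] by (simp add: c(3))
  finally show ?thesis using perron_frobenius(3)[OF A, of i] by (simp only: mult_le_cancel_right)
qed

lemma perron_root_less_1_of_subinvariant:
  fixes A :: "real ^ 'd ^ 'd"
  assumes A: "primitive_matrix A" and w: "\<And>i. 0 < w $ i"
    and le: "\<And>i. (A *v w) $ i \<le> w $ i" and ne: "A *v w \<noteq> w"
  shows "perron_root A < 1"
proof -
  let ?u = "perron_right A" and ?\<rho> = "perron_root A"
  obtain N where "N \<ge> 1" and N: "\<And>n i j. n \<ge> N \<Longrightarrow> 0 < matrix_pow A n $ i $ j"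
    using primitive_matrix_pow_pos[OF A] by blast
  note nn = matrix_pow_nonneg[OF primitive_matrix_nonneg[OF A]]
  have pow_le: "(matrix_pow A n *v w) $ i \<le> w $ i" for n i
  proof (induction n arbitrary: i)
    case (Suc n)
    have "(matrix_pow A (Suc n) *v w) $ i = (A *v (matrix_pow A n *v w)) $ i"
      by (simp add: matrix_vector_mul_assoc)
    also have "\<dots> \<le> (A *v w) $ i" by (intro matrix_vector_mono primitive_matrix_nonneg[OF A] Suc)
    finally show ?case using le[of i] by simp
  qed simp
  \<comment> \<open>The inequality may be strict in a single component of \<open>w\<close> only;
    \<open>A^N\<close> spreads it to all of them, and so \<open>A^(N+1) w < A^N w \<le> w\<close>
    everywhere.\<close>
  have "0 < (matrix_pow A N *v (w - A *v w)) $ i" for i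
    using le ne by (intro positive_matrix_mult_vec_pos N) auto
  then have lt: "(matrix_pow A (N + 1) *v w) $ i < w $ i" for i
    using pow_le[of N i]
    by (simp add: matrix_vector_mult_diff_distrib matrix_pow_add matrix_vector_mul_assoc[symmetric] One_nat_def
        del: add_Suc_right) (meson less_le_trans)
  obtain c i where c: "0 < c" "\<And>j. ?u $ j \<le> c * w $ j" "?u $ i = c * w $ i"
    using perron_right_dominated[OF A w] by blast
  have "?\<rho> ^ (N + 1) * ?u $ i = (matrix_pow A (N + 1) *v ?u) $ i"
    by (simp only: matrix_pow_eigenvector[OF perron_frobenius(2)[OF A]] vector_smult_component)
  also have "\<dots> \<le> (matrix_pow A (N + 1) *v (c *\<^sub>R w)) $ i"
    by (intro matrix_vector_mono nn) (simp add: c(2))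
  also have "\<dots> = c * (matrix_pow A (N + 1) *v w) $ i"
    by (simp add: matrix_vector_mult_scaleR del: matrix_pow_Suc)
  also have "\<dots> < c * w $ i" using c(1) lt by (intro mult_strict_left_mono)
  finally have "?\<rho> ^ (N + 1) * ?u $ i < 1 * ?u $ i" by (simp add: c(3))
  then have "?\<rho> ^ (N + 1) < 1"
    using perron_frobenius(3)[OF A, of i] by (simp only: mult_less_cancel_right)
  then show ?thesis by (meson one_le_power not_less)
qed

section \<open>Almost-solutions of a primitive linear recursion\<close>

lemma perturbed_iteration_pow:
  fixes M :: "real ^ 'd ^ 'd" and a :: "nat \<Rightarrow> real ^ 'd" and t :: "nat \<Rightarrow> real"
  assumes nn: "\<And>i j. 0 \<le> M $ i $ j" and c: "0 < c"
    and bounds: "\<forall>\<^sub>F n in sequentially. 0 < t n \<and> (\<forall>i. c * t n \<le> a n $ i \<and> a n $ i \<le> t n)"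
    and step: "\<And>i. (\<lambda>n. (a (Suc n) $ i - (M *v a n) $ i) / t n) \<longlonglongrightarrow> 0"
  shows "(\<lambda>n. (a (n + N) $ i - (matrix_pow M N *v a n) $ i) / t n) \<longlonglongrightarrow> 0"
proof (induction N arbitrary: i)
  case 0
  then show ?case by simp
next
  case (Suc N)
  define i0 :: 'd where "i0 = undefined"
  \<comment> \<open>The new one-step error is small relative to \<open>t (n + N)\<close>, so
    \<open>t (n + N) / t n\<close> must stay bounded. The row sum bounds the growth of
    \<open>M^N a\<close>, the added 1 absorbs the error of the induction hypothesis, and
    \<open>1 / c\<close> passes from \<open>a\<close> to \<open>t\<close>.\<close>
  define K where "K = ((\<Sum>j\<in>UNIV. matrix_pow M N $ i0 $ j) + 1) / c"
  have "\<forall>\<^sub>F n in sequentially. (a (n + N) $ i0 - (matrix_pow M N *v a n) $ i0) / t n < 1"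
    using Suc[of i0] by (rule order_tendstoD) simp
  moreover have "\<forall>\<^sub>F n in sequentially. 0 < t (n + N) \<and> (\<forall>i. c * t (n + N) \<le> a (n + N) $ i)"
    using eventually_sequentially_seg[THEN iffD2, OF bounds, of N] by (rule eventually_mono) auto
  ultimately have "\<forall>\<^sub>F n in sequentially. norm (t (n + N) / t n) \<le> K"
    using bounds
  proof eventually_elim
    case (elim n)
    have "(matrix_pow M N *v a n) $ i0 \<le> (\<Sum>j\<in>UNIV. matrix_pow M N $ i0 $ j) * t n"
      using elim(3) unfolding matrix_vector_mult_def sum_distrib_right
      by (auto intro!: sum_mono mult_left_mono matrix_pow_nonneg nn)
    then have "a (n + N) $ i0 \<le> ((\<Sum>j\<in>UNIV. matrix_pow M N $ i0 $ j) + 1) * t n"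
      using elim(1,3) by (simp add: field_simps)
    then have "c * t (n + N) \<le> ((\<Sum>j\<in>UNIV. matrix_pow M N $ i0 $ j) + 1) * t n"
      using elim(2) order_trans by blast
    then show ?case using elim c by (simp add: K_def field_simps)
  qed
  moreover have "(\<lambda>n. (a (Suc (n + N)) $ i - (M *v a (n + N)) $ i) / t (n + N)) \<longlonglongrightarrow> 0"
    using LIMSEQ_ignore_initial_segment[OF step[of i], of N] by simp
  ultimately have "(\<lambda>n. (a (Suc (n + N)) $ i - (M *v a (n + N)) $ i) / t (n + N) * (t (n + N) / t n)) \<longlonglongrightarrow> 0"
    by (rule lim_null_mult_right_bounded[rotated])
  moreover have "(\<lambda>n. \<Sum>j\<in>UNIV. M $ i $ j * ((a (n + N) $ j - (matrix_pow M N *v a n) $ j) / t n)) \<longlonglongrightarrow> 0"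
    by (intro tendsto_null_sum tendsto_mult_right_zero Suc)
  ultimately have "(\<lambda>n. (a (Suc (n + N)) $ i - (M *v a (n + N)) $ i) / t (n + N) * (t (n + N) / t n)
      + (\<Sum>j\<in>UNIV. M $ i $ j * ((a (n + N) $ j - (matrix_pow M N *v a n) $ j) / t n))) \<longlonglongrightarrow> 0"
    by (rule tendsto_add_zero)
  moreover have "\<forall>\<^sub>F n in sequentially. 0 < t (n + N)"
    using eventually_sequentially_seg[THEN iffD2, OF bounds, of N] by (rule eventually_mono) auto
  then have "\<forall>\<^sub>F n in sequentially. (a (Suc (n + N)) $ i - (M *v a (n + N)) $ i) / t (n + N) * (t (n + N) / t n)
      + (\<Sum>j\<in>UNIV. M $ i $ j * ((a (n + N) $ j - (matrix_pow M N *v a n) $ j) / t n))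
      = (a (n + Suc N) $ i - (matrix_pow M (Suc N) *v a n) $ i) / t n"
  proof eventually_elim
    case (elim n)
    have "(\<Sum>j\<in>UNIV. M $ i $ j * ((a (n + N) $ j - (matrix_pow M N *v a n) $ j) / t n)) =
      ((M *v a (n + N)) $ i - (M *v (matrix_pow M N *v a n)) $ i) / t n"
      unfolding matrix_vector_mult_def[of M]
      by (simp add: right_diff_distrib diff_divide_distrib sum_subtractf sum_divide_distrib)
    moreover have "(a (Suc (n + N)) $ i - (M *v a (n + N)) $ i) / t (n + N) * (t (n + N) / t n) =
        (a (Suc (n + N)) $ i - (M *v a (n + N)) $ i) / t n"
      using elim by simp
    ultimately show ?case
      by (simp add: matrix_vector_mul_assoc diff_divide_distrib)
  qed
  ultimately show ?case by (rule Lim_transform_eventually)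
qed

text \<open>The oscillation of \<open>a n $ i / u $ i\<close> shrinks by the factor \<open>1 - \<kappa>\<close> after finitely many steps, up to
  arbitrarily small errors; hence the infimum of its eventual bounds is \<open>0\<close>.\<close>

lemma perturbed_primitive_oscillation:
  fixes M :: "real ^ 'd ^ 'd" and a :: "nat \<Rightarrow> real ^ 'd" and t :: "nat \<Rightarrow> real"
  assumes M: "primitive_matrix M" and u_def: "u = perron_right M" and c: "0 < c"
    and bounds: "\<forall>\<^sub>F n in sequentially. 0 < t n \<and> (\<forall>i. c * t n \<le> a n $ i \<and> a n $ i \<le> t n)"
    and step: "\<And>i. (\<lambda>n. (a (Suc n) $ i - (M *v a n) $ i) / t n) \<longlonglongrightarrow> 0"
    and \<delta>: "0 < \<delta>"
  shows "\<forall>\<^sub>F n in sequentially. \<forall>i j. a n $ i / u $ i \<le> (1 + \<delta>) * (a n $ j / u $ j)"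
proof -
  define \<rho> where "\<rho> = perron_root M"
  have \<rho>: "0 < \<rho>" and eig: "M *v u = \<rho> *s u" and u: "\<And>i. 0 < u $ i"
    using perron_frobenius[OF M] by (simp_all add: \<rho>_def u_def)
  note nn = primitive_matrix_nonneg[OF M]
  obtain N where "N \<ge> 1" and N': "\<And>n i j. n \<ge> N \<Longrightarrow> 0 < matrix_pow M n $ i $ j"
    using primitive_matrix_pow_pos[OF M] by blast
  note N = N'[OF order_refl]
  \<comment> \<open>The Doob transform of \<open>M^N\<close> by \<open>u\<close>: a stochastic
    matrix, so that over \<open>N\<close> steps the ratios \<open>a n $ i / u $ i\<close> are
    averaged, up to the factor \<open>\<rho> ^ N\<close> and a small error. Its least entry \<kappa>
    is the contraction gain.\<close>
  define W where "W i j = matrix_pow M N $ i $ j * u $ j / (\<rho> ^ N * u $ i)" for i j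
  have Wpos: "0 < W i j" for i j using N u \<rho> by (simp add: W_def)
  have Wsum: "(\<Sum>j\<in>UNIV. W i j) = 1" for i
  proof -
    have "(\<Sum>j\<in>UNIV. W i j) = (matrix_pow M N *v u) $ i / (\<rho> ^ N * u $ i)"
      by (simp add: W_def matrix_vector_mult_def sum_divide_distrib)
    then show ?thesis using \<rho> u[of i] by (simp add: matrix_pow_eigenvector[OF eig])
  qed
  define \<kappa> where "\<kappa> = Min (range (\<lambda>(i, j). W i j))"
  have "\<kappa> \<in> range (\<lambda>(i, j). W i j)" unfolding \<kappa>_def by (rule Min_in) auto
  then have \<kappa>pos: "0 < \<kappa>" using Wpos by auto
  have \<kappa>le: "\<kappa> \<le> W i j" for i j
    unfolding \<kappa>_def by (rule Min_le) (auto intro!: image_eqI[of _ _ "(i, j)"])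
  have \<kappa>1: "\<kappa> \<le> 1"
    using \<kappa>le[of undefined undefined] Wsum[of undefined]
      member_le_sum[of undefined UNIV "W undefined"] less_imp_le[OF Wpos] by (auto intro: order_trans)
  define P where "P \<delta> \<longleftrightarrow> (\<forall>\<^sub>F n in sequentially. \<forall>i j. a n $ i / u $ i \<le> (1 + \<delta>) * (a n $ j / u $ j))"
    for \<delta>
  have improve: "P ((1 - \<kappa>) * \<delta> + \<eta>)" if P: "P \<delta>" and \<delta>: "0 \<le> \<delta>" and \<eta>: "0 < \<eta>" for \<delta> \<eta>
  proof -
    define \<delta>' where "\<delta>' = (1 - \<kappa>) * \<delta> + \<eta>"
    have \<delta>': "0 < \<delta>'" using \<kappa>1 \<delta> \<eta> by (auto simp: \<delta>'_def intro!: add_nonneg_pos)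
    define e where "e n i = (a (n + N) $ i - (matrix_pow M N *v a n) $ i) / t n / (\<rho> ^ N * u $ i)" for n i
    have e0: "(\<lambda>n. \<Sum>i\<in>UNIV. \<bar>e n i\<bar>) \<longlonglongrightarrow> 0"
      unfolding e_def
      by (intro tendsto_null_sum tendsto_rabs_zero tendsto_divide_zero perturbed_iteration_pow[OF nn c bounds step])
    define l where "l = c / (\<Sum>i\<in>UNIV. u $ i)"
    have usum: "0 < (\<Sum>i\<in>UNIV. u $ i)" by (rule sum_pos) (auto simp: u)
    have l: "0 < l" using c usum by (simp add: l_def)
    \<comment> \<open>With \<open>l\<close> a lower bound for the rescaled ratios
      \<open>x i\<close>, this threshold is what \<open>(1 + (1 - \<kappa>) * \<delta>) * lo + E
      \<le> (1 + \<delta>') * (lo - E)\<close> requires, namely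
      \<open>E * (2 + \<delta>') \<le> \<eta> * lo\<close>.\<close>
    have "\<forall>\<^sub>F n in sequentially. (\<Sum>i\<in>UNIV. \<bar>e n i\<bar>) < \<eta> * l / (2 + \<delta>')"
      using e0 \<eta> l \<delta>' by (intro order_tendstoD) auto
    then have "\<forall>\<^sub>F n in sequentially. \<forall>i j. a (n + N) $ i / u $ i \<le> (1 + \<delta>') * (a (n + N) $ j / u $ j)"
      using bounds P[unfolded P_def]
    proof eventually_elim
      case (elim n)
      define x where "x i = a n $ i / u $ i / t n" for i
      define y where "y i = a (n + N) $ i / u $ i / (\<rho> ^ N * t n)" for i
      have t: "0 < t n" using elim(2) by simp
      have y: "y i = (\<Sum>k\<in>UNIV. W i k * x k) + e n i" for i
      proof -
        have "(\<Sum>k\<in>UNIV. W i k * x k) = (\<Sum>k\<in>UNIV. matrix_pow M N $ i $ k * a n $ k / (\<rho> ^ N * u $ i * t n))"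
          using u by (intro sum.cong) (auto simp: W_def x_def less_imp_neq[THEN not_sym])
        also have "\<dots> = (matrix_pow M N *v a n) $ i / (\<rho> ^ N * u $ i * t n)"
          by (simp add: matrix_vector_mult_def sum_divide_distrib)
        finally show ?thesis by (simp add: y_def e_def diff_divide_distrib mult_ac)
      qed
      have xb: "x i \<le> (1 + \<delta>) * x j" for i j
        using divide_right_mono[OF elim(3)[rule_format, of i j] less_imp_le[OF t]] by (simp add: x_def)
      define lo where "lo = Min (range x)"
      have "lo \<in> range x" unfolding lo_def by (rule Min_in) auto
      then obtain m where m: "lo = x m" by auto
      have lo: "lo \<le> x k" for k unfolding lo_def by (rule Min_le) auto
      have "l \<le> x i" for i
      proof -
        have "c / u $ i \<le> x i"
          using elim(2) t u[of i] by (simp add: x_def field_simps)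
        moreover have "u $ i \<le> (\<Sum>i\<in>UNIV. u $ i)"
          by (rule member_le_sum) (auto intro: less_imp_le u)
        then have "l \<le> c / u $ i" using c u[of i] by (simp add: l_def frac_le)
        ultimately show ?thesis by simp
      qed
      then have l_lo: "l \<le> lo" using m by simp
      then have lopos: "0 < lo" using l by simp
      have upper: "(\<Sum>k\<in>UNIV. W i k * x k) \<le> (1 + (1 - \<kappa>) * \<delta>) * lo" for i
      proof -
        \<comment> \<open>At the minimising index \<open>m\<close> the crude bound
          \<open>(1 + \<delta>) * lo\<close> is replaced by the exact value \<open>lo\<close>; its
          weight is at least \<kappa>.\<close>
        have "(\<Sum>k\<in>UNIV. W i k * x k) \<le> (\<Sum>k\<in>UNIV. W i k * ((1 + \<delta>) * lo) - (if k = m then W i k * (\<delta> * lo) else 0))"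
        proof (rule sum_mono)
          fix k show "W i k * x k \<le> W i k * ((1 + \<delta>) * lo) - (if k = m then W i k * (\<delta> * lo) else 0)"
            using mult_left_mono[OF xb[of k m] less_imp_le[OF Wpos[of i k]]]
            by (auto simp: m algebra_simps)
        qed
        also have "\<dots> = (1 + \<delta>) * lo - W i m * (\<delta> * lo)"
          by (simp add: sum_subtractf sum_distrib_right[symmetric] Wsum)
        also have "\<dots> \<le> (1 + \<delta>) * lo - \<kappa> * (\<delta> * lo)"
          using \<kappa>le[of i m] \<delta> lopos by (intro diff_left_mono mult_right_mono) auto
        finally show ?thesis by (simp add: algebra_simps)
      qed
      have lower: "lo \<le> (\<Sum>k\<in>UNIV. W j k * x k)" for j
      proof -
        have "lo = (\<Sum>k\<in>UNIV. W j k * lo)" by (simp add: sum_distrib_right[symmetric] Wsum)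
        also have "\<dots> \<le> (\<Sum>k\<in>UNIV. W j k * x k)"
          by (intro sum_mono mult_left_mono lo less_imp_le[OF Wpos])
        finally show ?thesis .
      qed
      define E where "E = (\<Sum>i\<in>UNIV. \<bar>e n i\<bar>)"
      have eE: "\<bar>e n i\<bar> \<le> E" for i unfolding E_def by (rule member_le_sum) auto
      have E: "E * (2 + \<delta>') \<le> \<eta> * l" using elim(1) \<delta>' by (simp add: E_def field_simps)
      show ?case
      proof (intro allI)
        fix i j
        have "y i \<le> (1 + (1 - \<kappa>) * \<delta>) * lo + E" using y[of i] upper[of i] eE[of i] by linarith
        also have "\<dots> \<le> (1 + \<delta>') * (lo - E)"
        proof -
          have "E * (2 + \<delta>') \<le> \<eta> * lo" using E l_lo \<eta> by (meson mult_left_mono less_imp_le order_trans)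
          then show ?thesis by (simp add: \<delta>'_def algebra_simps)
        qed
        also have "\<dots> \<le> (1 + \<delta>') * y j"
          using y[of j] lower[of j] eE[of j] \<delta>' by (intro mult_left_mono) linarith+
        finally have "y i \<le> (1 + \<delta>') * y j" .
        then have "y i * (\<rho> ^ N * t n) \<le> (1 + \<delta>') * y j * (\<rho> ^ N * t n)"
          using t \<rho> by (intro mult_right_mono) auto
        moreover have "y k * (\<rho> ^ N * t n) = a (n + N) $ k / u $ k" for k
          using t \<rho> by (simp add: y_def)
        ultimately show "a (n + N) $ i / u $ i \<le> (1 + \<delta>') * (a (n + N) $ j / u $ j)"
          by (simp only: mult.assoc)
      qed
    qed
    then show ?thesis unfolding P_def \<delta>'_def[symmetric] 
      by (rule eventually_sequentially_seg[THEN iffD1])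
  qed
  define D where "D = {\<delta>. 0 \<le> \<delta> \<and> P \<delta>}"
  have "D \<noteq> {}"
  proof -
    \<comment> \<open>A first, crude bound on the oscillation: all components lie between
      \<open>c * t n\<close> and \<open>t n\<close>.\<close>
    define K where "K = (\<Sum>j\<in>UNIV. \<Sum>i\<in>UNIV. u $ j / (c * u $ i))"
    have "P K"
      unfolding P_def using bounds
    proof eventually_elim
      case (elim n)
      show ?case
      proof (intro allI)
        fix i j
        have "u $ j / (c * u $ i) \<le> (\<Sum>i\<in>UNIV. u $ j / (c * u $ i))"
          by (rule member_le_sum) (use c u in \<open>auto simp: less_imp_le\<close>)
        also have "\<dots> \<le> K" unfolding K_def
          by (rule member_le_sum) (use c u in \<open>auto simp: less_imp_le intro!: sum_nonneg\<close>)
        finally have K: "u $ j / (c * u $ i) \<le> 1 + K" by simp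
        have pos: "0 < a n $ j" using elim c by (meson less_le_trans mult_pos_pos)
        have "a n $ i \<le> a n $ j / c"
          using elim c by (simp add: field_simps) (meson order_trans mult_left_mono less_imp_le mult.commute)
        then have "a n $ i / u $ i \<le> a n $ j / c / u $ i"
          by (rule divide_right_mono) (simp add: less_imp_le u)
        also have "\<dots> = u $ j / (c * u $ i) * (a n $ j / u $ j)"
          using u[of j] by simp
        also have "\<dots> \<le> (1 + K) * (a n $ j / u $ j)"
          using K pos u[of j] by (intro mult_right_mono) auto
        finally show "a n $ i / u $ i \<le> (1 + K) * (a n $ j / u $ j)" .
      qed
    qed
    moreover have "0 \<le> K" unfolding K_def using c u by (auto simp: less_imp_le intro!: sum_nonneg)
    ultimately show ?thesis by (auto simp: D_def)
  qed
  have bdd: "bdd_below D" by (auto simp: D_def intro!: bdd_belowI[of _ 0])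
  define s where "s = Inf D"
  have s0: "0 \<le> s" unfolding s_def using \<open>D \<noteq> {}\<close> by (intro cInf_greatest) (auto simp: D_def)
  have "s = 0"
  proof (rule ccontr)
    assume "s \<noteq> 0"
    with s0 have s: "0 < s" by simp
    then have "Inf D < s + \<kappa> * s / 4" using \<kappa>pos by (simp add: s_def)
    then obtain d where d: "d \<in> D" "d < s + \<kappa> * s / 4"
      using cInf_lessD[OF \<open>D \<noteq> {}\<close>] by blast
    \<comment> \<open>The slack \<open>\<kappa> * s / 4\<close> in \<open>d\<close> and the error
      \<open>\<kappa> * s / 2\<close> together stay below the gain, which is about
      \<open>\<kappa> * s\<close>; the result lies below the infimum \<open>s\<close>.\<close>
    have "(1 - \<kappa>) * d + \<kappa> * s / 2 \<in> D"
      using d(1) improve[of d "\<kappa> * s / 2"] \<kappa>pos \<kappa>1 s by (auto simp: D_def)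
    then have "s \<le> (1 - \<kappa>) * d + \<kappa> * s / 2" unfolding s_def by (intro cInf_lower bdd)
    also have "\<dots> \<le> (1 - \<kappa>) * (s + \<kappa> * s / 4) + \<kappa> * s / 2"
      using d(2) \<kappa>1 by (intro add_right_mono mult_left_mono) auto
    also have "\<dots> = s - \<kappa> * s / 4 - \<kappa> * \<kappa> * s / 4" by (simp add: field_simps)
    also have "\<dots> < s"
    proof -
      have "0 < \<kappa> * s / 4" "0 < \<kappa> * \<kappa> * s / 4" using \<kappa>pos s by simp_all
      then show ?thesis by linarith
    qed
    finally show False by simp
  qed
  then have "Inf D < \<delta>" using \<delta> by (simp add: s_def)
  then obtain d where d: "d \<in> D" "d < \<delta>" using cInf_lessD[OF \<open>D \<noteq> {}\<close>] by blast
  then have "\<forall>\<^sub>F n in sequentially. \<forall>i j. a n $ i / u $ i \<le> (1 + d) * (a n $ j / u $ j)"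
    by (simp add: D_def P_def)
  then show ?thesis using bounds
  proof eventually_elim
    case (elim n)
    show ?case
    proof (intro allI)
      fix i j
      have "0 < a n $ j" using elim c by (meson less_le_trans mult_pos_pos)
      then have "(1 + d) * (a n $ j / u $ j) \<le> (1 + \<delta>) * (a n $ j / u $ j)"
        using d(2) u[of j] by (intro mult_right_mono) auto
      then show "a n $ i / u $ i \<le> (1 + \<delta>) * (a n $ j / u $ j)" using elim(1) order_trans by blast
    qed
  qed
qed

text \<open>Vanishing oscillation fixes the direction. For the growth, the recursion is divided by
  \<open>a n $ i\<close>, which is comparable with the scale \<open>t n\<close>; the error
  disappears and \<open>(M u) $ i / u $ i\<close> remains.\<close>

lemma perturbed_primitive_iteration:
  fixes M :: "real ^ 'd ^ 'd" and a :: "nat \<Rightarrow> real ^ 'd" and t :: "nat \<Rightarrow> real"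
  assumes M: "primitive_matrix M" and c: "0 < c"
    and bounds: "\<forall>\<^sub>F n in sequentially. 0 < t n \<and> (\<forall>i. c * t n \<le> a n $ i \<and> a n $ i \<le> t n)"
    and step: "\<And>i. (\<lambda>n. (a (Suc n) $ i - (M *v a n) $ i) / t n) \<longlonglongrightarrow> 0"
  shows "(\<lambda>n. a n $ i / a n $ j) \<longlonglongrightarrow> perron_right M $ i / perron_right M $ j" (is ?ratio)
    and "(\<lambda>n. a (Suc n) $ i / a n $ i) \<longlonglongrightarrow> perron_root M"
proof -
  define u where "u = perron_right M"
  have eig: "M *v u = perron_root M *s u" and u: "\<And>i. 0 < u $ i"
    using perron_frobenius(2,3)[OF M] by (simp_all add: u_def)
  have apos: "\<forall>\<^sub>F n in sequentially. \<forall>i. 0 < a n $ i"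
    using bounds by eventually_elim (use c in \<open>meson less_le_trans mult_pos_pos\<close>)
  have ratio: "(\<lambda>n. a n $ i / a n $ j) \<longlonglongrightarrow> u $ i / u $ j" for i j
  proof -
    have "(\<lambda>n. (a n $ i / u $ i) / (a n $ j / u $ j)) \<longlonglongrightarrow> 1"
    proof (rule LIMSEQ_I)
      fix r :: real assume r: "0 < r"
      have "\<forall>\<^sub>F n in sequentially. norm ((a n $ i / u $ i) / (a n $ j / u $ j) - 1) < r"
        using apos perturbed_primitive_oscillation[OF M refl c bounds step half_gt_zero[OF r]]
      proof eventually_elim
        case (elim n)
        define x y where "x = a n $ i / u $ i" and "y = a n $ j / u $ j"
        have pos: "0 < x" "0 < y" using elim(1) u by (simp_all add: x_def y_def)
        have xy: "x \<le> (1 + r / 2) * y" "y \<le> (1 + r / 2) * x"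
          using elim(2) by (simp_all add: x_def y_def u_def)
        have "x / y < 1 + r" using xy(1) pos r by (simp add: field_simps) (smt (verit) mult_pos_pos)
        moreover have "1 - r < x / y"
        proof (cases "r < 1")
          case True
          have "(1 - r) * y \<le> (1 - r) * ((1 + r / 2) * x)" using xy(2) True by (intro mult_left_mono) auto
          also have "\<dots> = (1 - r / 2 - r * r / 2) * x" by (simp add: field_simps)
          also have "\<dots> < 1 * x" using pos r by (intro mult_strict_right_mono) (auto simp: add_pos_pos intro: less_trans[of _ 0])
          finally show ?thesis using pos by (simp add: field_simps)
        next
          case False
          have "0 < x / y" using pos by simp
          then show ?thesis using False by linarith
        qed
        ultimately show ?case unfolding x_def[symmetric] y_def[symmetric] by (simp add: abs_less_iff)
      qed
      then show "\<exists>no. \<forall>n\<ge>no. norm ((a n $ i / u $ i) / (a n $ j / u $ j) - 1) < r"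
        by (simp add: eventually_sequentially)
    qed
    then have "(\<lambda>n. (a n $ i / u $ i) / (a n $ j / u $ j) * (u $ i / u $ j)) \<longlonglongrightarrow> 1 * (u $ i / u $ j)"
      by (intro tendsto_mult tendsto_const)
    moreover have "(a n $ i / u $ i) / (a n $ j / u $ j) * (u $ i / u $ j) = a n $ i / a n $ j" for n
      using u[of i] u[of j] by simp
    ultimately show ?thesis by simp
  qed
  then show ?ratio by (simp add: u_def)
  have "\<forall>\<^sub>F n in sequentially. norm (t n / a n $ i) \<le> 1 / c"
    using bounds apos by eventually_elim (use c in \<open>auto simp: field_simps abs_of_pos\<close>)
  with step[of i] have "(\<lambda>n. (a (Suc n) $ i - (M *v a n) $ i) / t n * (t n / a n $ i)) \<longlonglongrightarrow> 0"
    by (rule lim_null_mult_right_bounded)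
  moreover have "(\<lambda>n. \<Sum>j\<in>UNIV. M $ i $ j * (a n $ j / a n $ i)) \<longlonglongrightarrow> (\<Sum>j\<in>UNIV. M $ i $ j * (u $ j / u $ i))"
    by (intro tendsto_intros ratio)
  ultimately have "(\<lambda>n. (a (Suc n) $ i - (M *v a n) $ i) / t n * (t n / a n $ i)
      + (\<Sum>j\<in>UNIV. M $ i $ j * (a n $ j / a n $ i))) \<longlonglongrightarrow> 0 + (\<Sum>j\<in>UNIV. M $ i $ j * (u $ j / u $ i))"
    by (rule tendsto_add)
  moreover have "0 + (\<Sum>j\<in>UNIV. M $ i $ j * (u $ j / u $ i)) = perron_root M"
  proof -
    have "(\<Sum>j\<in>UNIV. M $ i $ j * (u $ j / u $ i)) = (M *v u) $ i / u $ i"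
      by (simp add: matrix_vector_mult_def sum_divide_distrib)
    then show ?thesis using u[of i] by (simp add: eig)
  qed
  moreover have "\<forall>\<^sub>F n in sequentially. (a (Suc n) $ i - (M *v a n) $ i) / t n * (t n / a n $ i)
      + (\<Sum>j\<in>UNIV. M $ i $ j * (a n $ j / a n $ i)) = a (Suc n) $ i / a n $ i"
    using bounds
  proof eventually_elim
    case (elim n)
    then have "(a (Suc n) $ i - (M *v a n) $ i) / t n * (t n / a n $ i) =
        (a (Suc n) $ i - (M *v a n) $ i) / a n $ i"
      by simp
    then show ?case
      by (simp add: matrix_vector_mult_def sum_divide_distrib diff_divide_distrib)
  qed
  ultimately show "(\<lambda>n. a (Suc n) $ i / a n $ i) \<longlonglongrightarrow> perron_root M"
    using Lim_transform_eventually by fastforce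
qed

section \<open>Integer vectors and monomials\<close>

definition mass :: "nat ^ 'd \<Rightarrow> nat" where
  "mass x = (\<Sum>i\<in>UNIV. x $ i)"

definition monomial :: "real ^ 'd \<Rightarrow> nat ^ 'd \<Rightarrow> real" where
  "monomial r z = (\<Prod>j\<in>UNIV. r $ j ^ (z $ j))"

lemma mass_0 [simp]: "mass 0 = 0"
  and mass_axis [simp]: "mass (axis i 1) = 1"
  and mass_add: "mass (x + y) = mass x + mass y"
  by (simp_all add: mass_def axis_def sum.distrib)

lemma mass_eq_0_iff: "mass x = 0 \<longleftrightarrow> x = 0"
  by (simp add: mass_def vec_eq_iff)

lemma component_le_mass: "x $ i \<le> mass x"
  unfolding mass_def by (rule member_le_sum) auto

lemma nat_vec_eq_axis_add:
  fixes x :: "nat ^ 'd"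
  assumes "x $ i > 0"
  obtains y where "x = axis i 1 + y"
proof
  show "x = axis i 1 + (x - axis i 1)"
    using assms by (auto simp: vec_eq_iff axis_def)
qed

text \<open>Adds one individual at a time, matching the way the branching property splits off a
  single ancestor.\<close>

lemma nat_vec_induct [case_names zero add]:
  fixes x :: "nat ^ 'd"
  assumes 0: "P 0" and add: "\<And>i x. P x \<Longrightarrow> P (axis i 1 + x)"
  shows "P x"
proof (induction "mass x" arbitrary: x)
  case 0
  then show ?case using assms(1) by (simp add: mass_eq_0_iff)
next
  case (Suc n)
  then have "x \<noteq> 0" by auto
  then obtain i where "x $ i > 0" by (auto simp: vec_eq_iff)
  then obtain y where y: "x = axis i 1 + y" by (rule nat_vec_eq_axis_add)
  with Suc have "P y" by (simp add: mass_add)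
  then show ?case by (simp add: y add)
qed

lemma finite_mass_le: "finite {x :: nat ^ 'd. mass x \<le> R}"
proof (rule finite_subset)
  show "{x :: nat ^ 'd. mass x \<le> R} \<subseteq> (\<lambda>f. \<chi> i. f i) ` (UNIV \<rightarrow>\<^sub>E {..R})"
  proof
    fix x :: "nat ^ 'd" assume "x \<in> {x. mass x \<le> R}"
    then have "x = (\<chi> i. (\<lambda>i. x $ i) i)" "(\<lambda>i. x $ i) \<in> UNIV \<rightarrow>\<^sub>E {..R}"
      using component_le_mass[of x] by (auto simp: PiE_def intro: order_trans)
    then show "x \<in> (\<lambda>f. \<chi> i. f i) ` (UNIV \<rightarrow>\<^sub>E {..R})" by blast
  qed
qed (intro finite_imageI finite_PiE, auto)

lemma monomial_add: "monomial r (x + y) = monomial r x * monomial r y"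
  by (simp add: monomial_def power_add prod.distrib)

lemma monomial_0_right [simp]: "monomial r 0 = 1"
  by (simp add: monomial_def)

lemma monomial_axis [simp]: "monomial r (axis i 1) = r $ i"
proof -
  have "monomial r (axis i 1) = (\<Prod>j\<in>UNIV. if j = i then r $ j else 1)"
    unfolding monomial_def by (rule prod.cong) (auto simp: axis_def)
  then show ?thesis by simp
qed

text \<open>Because \<open>0 ^ 0 = 1\<close>, generating functions at the origin become extinction
  probabilities.\<close>

lemma monomial_0_left: "monomial 0 z = indicator {0} z"
  by (auto simp: monomial_def indicator_def vec_eq_iff)

lemma monomial_nonneg: "(\<And>i. 0 \<le> r $ i) \<Longrightarrow> 0 \<le> monomial r z"
  and monomial_pos: "(\<And>i. 0 < r $ i) \<Longrightarrow> 0 < monomial r z"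
  and monomial_le_1: "(\<And>i. 0 \<le> r $ i) \<Longrightarrow> (\<And>i. r $ i \<le> 1) \<Longrightarrow> monomial r z \<le> 1"
  by (auto simp: monomial_def intro!: prod_nonneg prod_pos prod_le_1 power_le_one)

lemma monomial_mult_left: "monomial (a * r) z = monomial a z * monomial r z"
  by (simp add: monomial_def power_mult_distrib prod.distrib)

lemma monomial_1_left [simp]: "monomial 1 z = 1"
  by (simp add: monomial_def)

lemma real_vec_0 [simp]: "real_vec 0 = 0"
  and real_vec_axis [simp]: "real_vec (axis i 1) = axis i 1"
  and real_vec_add: "real_vec (x + y) = real_vec x + real_vec y"
  by (simp_all add: real_vec_def vec_eq_iff axis_def)

lemma real_vec_inner: "real_vec x \<bullet> u = (\<Sum>j\<in>UNIV. real (x $ j) * u $ j)"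
  by (simp add: real_vec_def inner_vec_def)

section \<open>Transition probabilities and the branching property\<close>

lemma map_pmf_plus_plus:
  fixes a b :: "'a :: semigroup_add"
  shows "map_pmf ((+) a) (map_pmf ((+) b) A) = map_pmf ((+) (a + b)) A"
  by (simp add: map_pmf_comp add.assoc[symmetric])

lemma gw_step_0 [simp]: "gw_step p 0 = return_pmf 0"
  by (simp add: gw_step_def Let_def)

lemma gw_step_axis_add:
  "gw_step p (axis i 1 + x) = bind_pmf (p i) (\<lambda>a. map_pmf ((+) a) (gw_step p x))"
proof -
  define I where "I = {(i, m). m < x $ i}"
  have "I = (\<Union>i. Pair i ` {..<x $ i})" by (auto simp: I_def)
  then have fin: "finite I" by simp
  \<comment> \<open>The added individual of type \<open>i\<close> receives the first free label
    \<open>(i, x $ i)\<close>, so the product law splits off one factor.\<close>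
  have ins: "{(j, m). m < (axis i 1 + x) $ j} = insert (i, x $ i) I"
    by (auto simp: I_def axis_def split: if_splits)
  have nin: "(i, x $ i) \<notin> I" by (simp add: I_def)
  have *: "(\<Sum>b\<in>insert (i, x $ i) I. (f((i, x $ i) := a)) b) = a + (\<Sum>b\<in>I. f b)"
    for f :: "'a \<times> nat \<Rightarrow> nat ^ 'a" and a
  proof -
    have "(\<Sum>b\<in>I. (f((i, x $ i) := a)) b) = (\<Sum>b\<in>I. f b)"
      using nin by (intro sum.cong) auto
    then show ?thesis using fin nin by simp
  qed
  show ?thesis
    unfolding gw_step_def Let_def ins I_def[symmetric] Pi_pmf_insert[OF fin nin]
    by (simp add: pair_pmf_def map_bind_pmf map_pmf_comp map_pmf_def[symmetric] * del: sum.insert fun_upd_apply)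
qed

lemma gw_step_axis: "gw_step p (axis i 1) = p i"
  using gw_step_axis_add[of p i 0] by simp (simp add: bind_return_pmf')

lemma gw_step_add:
  "gw_step p (x + y) = bind_pmf (gw_step p x) (\<lambda>a. map_pmf ((+) a) (gw_step p y))"
proof (induction x rule: nat_vec_induct)
  case zero
  then show ?case by (simp add: bind_return_pmf map_pmf_idI)
next
  case (add i x)
  then show ?case
    by (simp add: gw_step_axis_add add.assoc bind_assoc_pmf map_bind_pmf bind_map_pmf map_pmf_plus_plus)
qed

text \<open>The law of the \<open>n\<close>-th generation, as \<open>distr_X\<close> will show. The
  asymptotic analysis uses this kernel alone and needs no underlying probability space.\<close>

primrec gw_iter :: "('d \<Rightarrow> (nat ^ 'd) pmf) \<Rightarrow> nat \<Rightarrow> nat ^ 'd \<Rightarrow> (nat ^ 'd) pmf" where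
  "gw_iter p 0 x = return_pmf x"
| "gw_iter p (Suc n) x = bind_pmf (gw_step p x) (gw_iter p n)"

lemma gw_iter_plus: "gw_iter p (m + n) x = bind_pmf (gw_iter p m x) (gw_iter p n)"
  by (induction m arbitrary: x) (simp_all add: bind_return_pmf bind_assoc_pmf cong: bind_pmf_cong)

lemma gw_iter_0 [simp]: "gw_iter p n 0 = return_pmf 0"
  by (induction n) (simp_all add: bind_return_pmf)

lemma gw_iter_add:
  "gw_iter p n (x + y) = bind_pmf (gw_iter p n x) (\<lambda>a. map_pmf ((+) a) (gw_iter p n y))"
proof (induction n arbitrary: x y)
  case 0
  then show ?case by (simp add: bind_return_pmf)
next
  case (Suc n)
  have "gw_iter p (Suc n) (x + y) = bind_pmf (gw_step p x) (\<lambda>a. bind_pmf (gw_step p y)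
      (\<lambda>b. bind_pmf (gw_iter p n a) (\<lambda>c. map_pmf ((+) c) (gw_iter p n b))))"
    by (simp add: gw_step_add bind_assoc_pmf bind_map_pmf Suc)
  also have "\<dots> = bind_pmf (gw_step p x) (\<lambda>a. bind_pmf (gw_iter p n a)
      (\<lambda>c. bind_pmf (gw_step p y) (\<lambda>b. map_pmf ((+) c) (gw_iter p n b))))"
    by (subst bind_commute_pmf) simp
  also have "\<dots> = bind_pmf (gw_iter p (Suc n) x) (\<lambda>a. map_pmf ((+) a) (gw_iter p (Suc n) y))"
    by (simp add: bind_assoc_pmf map_bind_pmf)
  finally show ?case .
qed

lemma gw_iter_add_pair:
  "gw_iter p n (x + y) = map_pmf (\<lambda>(a, b). a + b) (pair_pmf (gw_iter p n x) (gw_iter p n y))"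
  by (simp add: gw_iter_add pair_pmf_def map_bind_pmf map_pmf_def bind_assoc_pmf bind_return_pmf)

abbreviation gw_prob :: "('d \<Rightarrow> (nat ^ 'd) pmf) \<Rightarrow> nat \<Rightarrow> nat ^ 'd \<Rightarrow> (nat ^ 'd) set \<Rightarrow> real" where
  "gw_prob p n x B \<equiv> measure_pmf.prob (gw_iter p n x) B"

lemma gw_prob_add:
  "gw_prob p n (x + y) B =
     measure_pmf.prob (pair_pmf (gw_iter p n x) (gw_iter p n y)) {(a, b). a + b \<in> B}"
  by (simp add: gw_iter_add_pair vimage_def case_prod_unfold)

lemma pair_pmf_prob_Times:
  fixes A :: "('a :: countable) pmf" and B :: "('b :: countable) pmf"
  shows "measure_pmf.prob (pair_pmf A B) (S \<times> T) = measure_pmf.prob A S * measure_pmf.prob B T"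
  by (rule measure_pmf_prob_product) auto

text \<open>One sufficient scenario: the descendants of \<open>y\<close> are extinct while those of
  \<open>x\<close> form a population in \<open>B\<close>.\<close>

lemma gw_prob_add_ge: "gw_prob p n (x + y) B \<ge> gw_prob p n x B * gw_prob p n y {0}"
  unfolding gw_prob_add pair_pmf_prob_Times[symmetric]
  by (rule measure_pmf.finite_measure_mono) auto

lemma gw_prob_plus: "gw_prob p (m + n) x B = (\<integral>y. gw_prob p n y B \<partial>gw_iter p m x)"
proof -
  have "ennreal (gw_prob p (m + n) x B) = (\<integral>\<^sup>+y. ennreal (gw_prob p n y B) \<partial>gw_iter p m x)"
    unfolding measure_pmf.emeasure_eq_measure[symmetric] by (simp add: gw_iter_plus)
  also have "\<dots> = ennreal (\<integral>y. gw_prob p n y B \<partial>gw_iter p m x)"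
    by (intro nn_integral_eq_integral measure_pmf.integrable_const_bound[where B=1]) auto
  finally show ?thesis by (simp add: integral_nonneg)
qed

lemma gw_iter_1_axis: "gw_iter p 1 (axis i 1) = p i"
proof -
  have "gw_iter p 1 (axis i 1) = bind_pmf (p i) return_pmf"
    unfolding One_nat_def gw_iter.simps by (simp add: gw_step_axis[unfolded One_nat_def] flip: gw_iter.simps(1))
  then show ?thesis by (simp add: bind_return_pmf')
qed

lemma gw_prob_Suc: "gw_prob p (Suc n) (axis i 1) B = (\<integral>y. gw_prob p n y B \<partial>p i)"
  using gw_prob_plus[of p 1 n "axis i 1" B] by (simp only: gw_iter_1_axis plus_1_eq_Suc)

lemma integrable_pmf_bounded:
  fixes f :: "'a \<Rightarrow> real"
  assumes "\<And>x. \<bar>f x\<bar> \<le> c"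
  shows "integrable (measure_pmf A) f"
  by (rule measure_pmf.integrable_const_bound[where B=c]) (use assms in auto)

lemma gw_prob_plus_ge:
  "gw_prob p (m + n) x B \<ge> pmf (gw_iter p m x) y * gw_prob p n y B"
proof -
  have "pmf (gw_iter p m x) y * gw_prob p n y B = (\<integral>z. indicator {y} z * gw_prob p n y B \<partial>gw_iter p m x)"
    by (simp add: pmf.rep_eq)
  also have "\<dots> \<le> (\<integral>y. gw_prob p n y B \<partial>gw_iter p m x)"
    by (intro integral_mono integrable_pmf_bounded[where c=1]) (auto simp: indicator_def)
  finally show ?thesis by (simp add: gw_prob_plus)
qed

lemma gw_prob_absorbed_mono: "gw_prob p (m + n) x {0} \<ge> gw_prob p m x {0}"
  using gw_prob_plus_ge[of p m x 0 n "{0}"] by (simp add: pmf.rep_eq)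

text \<open>For \<open>r = 0\<close> this is the factorisation of the extinction probabilities.\<close>

lemma expectation_monomial_gw_iter:
  assumes r: "\<And>i. 0 \<le> r $ i"
  shows "(\<integral>z. monomial r z \<partial>gw_iter p n x) =
    monomial (\<chi> j. \<integral>z. monomial r z \<partial>gw_iter p n (axis j 1)) x"
proof -
  have eq: "(\<integral>z. monomial r z \<partial>gw_iter p n x) = enn2real (\<integral>\<^sup>+z. monomial r z \<partial>gw_iter p n x)" for x
    using monomial_nonneg[OF r] by (intro integral_eq_nn_integral) auto
  show ?thesis
  proof (induction x rule: nat_vec_induct)
    case zero
    then show ?case by simp
  next
    case (add i x)
    have "(\<integral>\<^sup>+z. monomial r z \<partial>gw_iter p n (axis i 1 + x)) =
        (\<integral>\<^sup>+a. ennreal (monomial r a) * (\<integral>\<^sup>+b. monomial r b \<partial>gw_iter p n x) \<partial>gw_iter p n (axis i 1))"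
      using monomial_nonneg[OF r]
      by (simp add: gw_iter_add monomial_add ennreal_mult nn_integral_cmult)
    also have "\<dots> = (\<integral>\<^sup>+a. monomial r a \<partial>gw_iter p n (axis i 1)) * (\<integral>\<^sup>+b. monomial r b \<partial>gw_iter p n x)"
      by (simp add: nn_integral_multc)
    finally show ?case using add by (simp add: eq enn2real_mult monomial_add)
  qed
qed

lemma gw_prob_0_eq: "gw_prob p n x {0} = monomial (\<chi> j. gw_prob p n (axis j 1) {0}) x"
proof -
  have "gw_prob p n x {0} = (\<integral>z. monomial 0 z \<partial>gw_iter p n x)" for x
    by (simp add: monomial_0_left)
  then show ?thesis using expectation_monomial_gw_iter[of 0 p n x] by simp
qed

lemma gw_prob_compl: "gw_prob p n x (- B) = 1 - gw_prob p n x B"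
  using measure_pmf.prob_compl[of B "gw_iter p n x"] by (simp add: Compl_eq_Diff_UNIV)

text \<open>Exponential change of measure: \<open>p'\<close> is \<open>p\<close> reweighted by the multiplicative function
  \<open>monomial q\<close>, so the branching property transports the reweighting to all generations.\<close>

definition tilted :: "('d \<Rightarrow> (nat ^ 'd) pmf) \<Rightarrow> real ^ 'd \<Rightarrow> ('d \<Rightarrow> (nat ^ 'd) pmf) \<Rightarrow> bool" where
  "tilted p q p' \<longleftrightarrow> (\<forall>i. 0 < q $ i) \<and> (\<forall>i z. q $ i * pmf (p' i) z = monomial q z * pmf (p i) z)"

lemma nn_integral_tilted:
  assumes "tilted p q p'"
  shows "ennreal (q $ i) * (\<integral>\<^sup>+z. g z \<partial>p' i) = (\<integral>\<^sup>+z. ennreal (monomial q z) * g z \<partial>p i)"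
proof -
  have q: "0 < q $ i" for i using assms by (simp add: tilted_def)
  have "ennreal (q $ i) * (\<integral>\<^sup>+z. g z \<partial>p' i) =
      (\<integral>\<^sup>+z. ennreal (q $ i) * (ennreal (pmf (p' i) z) * g z) \<partial>count_space UNIV)"
    by (simp add: nn_integral_measure_pmf nn_integral_cmult)
  also have "\<dots> = (\<integral>\<^sup>+z. ennreal (pmf (p i) z) * (ennreal (monomial q z) * g z) \<partial>count_space UNIV)"
  proof (intro nn_integral_cong)
    fix z
    have "ennreal (q $ i) * ennreal (pmf (p' i) z) = ennreal (pmf (p i) z) * ennreal (monomial q z)"
      using assms less_imp_le[OF q] monomial_nonneg[of q z]
      by (simp add: tilted_def ennreal_mult[symmetric] mult.commute)
    then show "ennreal (q $ i) * (ennreal (pmf (p' i) z) * g z) =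
        ennreal (pmf (p i) z) * (ennreal (monomial q z) * g z)"
      by (metis mult.assoc)
  qed
  finally show ?thesis by (simp add: nn_integral_measure_pmf)
qed

lemma nn_integral_tilted_step:
  assumes "tilted p q p'"
  shows "ennreal (monomial q x) * (\<integral>\<^sup>+z. g z \<partial>gw_step p' x) =
    (\<integral>\<^sup>+z. ennreal (monomial q z) * g z \<partial>gw_step p x)"
proof (induction x arbitrary: g rule: nat_vec_induct)
  case zero
  then show ?case by simp
next
  case (add i x)
  have q: "0 < q $ i" for i using assms by (simp add: tilted_def)
  note [simp] = monomial_nonneg[OF less_imp_le[OF q]]
  have "ennreal (monomial q (axis i 1 + x)) * (\<integral>\<^sup>+z. g z \<partial>gw_step p' (axis i 1 + x)) =
      ennreal (q $ i) * (\<integral>\<^sup>+a. ennreal (monomial q x) * (\<integral>\<^sup>+z. g (a + z) \<partial>gw_step p' x) \<partial>p' i)"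
    using less_imp_le[OF q]
    by (simp add: monomial_add gw_step_axis_add ennreal_mult nn_integral_cmult mult.assoc)
  \<comment> \<open>The induction hypothesis is applied, for each offspring vector \<open>a\<close>,
    to the shifted function \<open>g (a + z)\<close>; hence \<open>g\<close> is kept
    arbitrary.\<close>
  also have "\<dots> = (\<integral>\<^sup>+a. ennreal (monomial q a) *
      (\<integral>\<^sup>+z. ennreal (monomial q z) * g (a + z) \<partial>gw_step p x) \<partial>p i)"
    by (simp add: add nn_integral_tilted[OF assms])
  also have "\<dots> = (\<integral>\<^sup>+z. ennreal (monomial q z) * g z \<partial>gw_step p (axis i 1 + x))"
    by (simp add: monomial_add gw_step_axis_add ennreal_mult nn_integral_cmult[symmetric] mult.assoc)
  finally show ?case .
qed

lemma nn_integral_tilted_iter: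
  assumes "tilted p q p'"
  shows "ennreal (monomial q x) * (\<integral>\<^sup>+z. g z \<partial>gw_iter p' n x) =
    (\<integral>\<^sup>+z. ennreal (monomial q z) * g z \<partial>gw_iter p n x)"
proof (induction n arbitrary: x)
  case 0
  then show ?case by simp
next
  case (Suc n)
  then show ?case by (simp add: nn_integral_tilted_step[OF assms])
qed

lemma pmf_tilted_step:
  assumes "tilted p q p'"
  shows "monomial q x * pmf (gw_step p' x) z = monomial q z * pmf (gw_step p x) z"
proof -
  have q: "0 < q $ i" for i using assms by (simp add: tilted_def)
  note [simp] = monomial_nonneg[OF less_imp_le[OF q]]
  have "ennreal (monomial q x) * pmf (gw_step p' x) z = (\<integral>\<^sup>+y. ennreal (monomial q y) * indicator {z} y \<partial>gw_step p x)"
    using nn_integral_tilted_step[OF assms, where x=x and g="indicator {z}"] by (simp add: emeasure_pmf_single)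
  also have "\<dots> = ennreal (monomial q z) * pmf (gw_step p x) z"
    by (simp add: emeasure_pmf_single)
  finally show ?thesis by (simp add: ennreal_mult[symmetric])
qed

lemma gw_prob_tilted_0:
  assumes "tilted p q p'"
  shows "monomial q x * gw_prob p' n x {0} = gw_prob p n x {0}"
proof -
  have q: "0 < q $ i" for i using assms by (simp add: tilted_def)
  note [simp] = monomial_nonneg[OF less_imp_le[OF q]]
  have "ennreal (monomial q x) * gw_prob p' n x {0} = (\<integral>\<^sup>+y. ennreal (monomial q y) * indicator {0} y \<partial>gw_iter p n x)"
    using nn_integral_tilted_iter[OF assms, where x=x and n=n and g="indicator {0}"]
    by (simp add: measure_pmf.emeasure_eq_measure)
  also have "\<dots> = gw_prob p n x {0}"
    by (simp add: measure_pmf.emeasure_eq_measure)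
  finally show ?thesis by (simp add: ennreal_mult[symmetric])
qed

section \<open>Ratio limits under almost sure extinction\<close>

definition hit_vec :: "('d \<Rightarrow> (nat ^ 'd) pmf) \<Rightarrow> nat \<Rightarrow> (nat ^ 'd) set \<Rightarrow> real ^ 'd" where
  "hit_vec p n B = (\<chi> i. gw_prob p n (axis i 1) B)"

definition offspring_mean :: "('d \<Rightarrow> (nat ^ 'd) pmf) \<Rightarrow> real ^ 'd ^ 'd" where
  "offspring_mean p = (\<chi> i j. \<integral>z. real (z $ j) \<partial>p i)"

definition finite_offspring_mean :: "('d \<Rightarrow> (nat ^ 'd) pmf) \<Rightarrow> bool" where
  "finite_offspring_mean p \<longleftrightarrow> (\<forall>i j. integrable (p i) (\<lambda>z. real (z $ j)))"

text \<open>If a total population lies in \<open>F\<close>, so does each of its nonempty parts.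
  Excluding 0 ensures that a hit of \<open>F\<close> requires survival.\<close>

definition hereditary :: "(nat ^ 'd) set \<Rightarrow> bool" where
  "hereditary F \<longleftrightarrow> 0 \<notin> F \<and> (\<forall>a b. a + b \<in> F \<longrightarrow> a \<noteq> 0 \<longrightarrow> a \<in> F)"

lemma hereditary_nonzero: "hereditary (- {0})"
  by (simp add: hereditary_def)

lemma hereditaryD: "hereditary F \<Longrightarrow> a + b \<in> F \<Longrightarrow> a \<noteq> 0 \<Longrightarrow> a \<in> F"
  "hereditary F \<Longrightarrow> a + b \<in> F \<Longrightarrow> b \<noteq> 0 \<Longrightarrow> b \<in> F"
  unfolding hereditary_def by (blast, metis add.commute)

lemma hit_vec_nonneg [simp]: "0 \<le> hit_vec p n B $ i"
  by (simp add: hit_vec_def)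

lemma hit_vec_mono: "A \<subseteq> B \<Longrightarrow> hit_vec p n A $ i \<le> hit_vec p n B $ i"
  by (auto simp: hit_vec_def intro!: measure_pmf.finite_measure_mono)

lemma offspring_mean_nonneg: "0 \<le> offspring_mean p $ i $ j"
  by (simp add: offspring_mean_def integral_nonneg)

lemma integrable_mass:
  assumes "finite_offspring_mean p"
  shows "integrable (p i) (\<lambda>z. real (mass z))"
  using assms by (auto simp: finite_offspring_mean_def mass_def)

lemma integral_inner_offspring:
  assumes "finite_offspring_mean p"
  shows "integrable (p i) (\<lambda>z. real_vec z \<bullet> v)"
    "(\<integral>z. real_vec z \<bullet> v \<partial>p i) = (offspring_mean p *v v) $ i"
  using assms
  by (auto simp: finite_offspring_mean_def real_vec_inner offspring_mean_def matrix_vector_mult_def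
      intro!: Bochner_Integration.integral_sum[THEN trans] sum.cong)

text \<open>Union bound over ancestors: when the population lies in \<open>F\<close>, some ancestor
  has living descendants, and heredity puts these in \<open>F\<close>.\<close>

lemma gw_prob_le_inner:
  assumes F: "hereditary F"
  shows "gw_prob p n x F \<le> real_vec x \<bullet> hit_vec p n F"
proof (induction x rule: nat_vec_induct)
  case zero
  then show ?case using F by (simp add: hereditary_def)
next
  case (add i x)
  have "{(a, b). a + b \<in> F} \<subseteq> F \<times> UNIV \<union> UNIV \<times> F"
  proof (intro subsetI)
    fix ab assume "ab \<in> {(a, b). a + b \<in> F}"
    then have "fst ab + snd ab \<in> F" by auto
    then show "ab \<in> F \<times> UNIV \<union> UNIV \<times> F"
      using hereditaryD(1)[OF F, of "fst ab" "snd ab"]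
      by (cases "fst ab = 0") (auto simp: mem_Times_iff)
  qed
  then have "gw_prob p n (axis i 1 + x) F \<le> measure_pmf.prob (pair_pmf (gw_iter p n (axis i 1)) (gw_iter p n x)) (F \<times> UNIV \<union> UNIV \<times> F)"
    unfolding gw_prob_add by (intro measure_pmf.finite_measure_mono) auto
  also have "\<dots> \<le> gw_prob p n (axis i 1) F + gw_prob p n x F"
    by (rule order_trans[OF measure_Un_le]) (auto simp: pair_pmf_prob_Times)
  also have "\<dots> \<le> real_vec (axis i 1 + x) \<bullet> hit_vec p n F"
    using add by (simp add: real_vec_add inner_add_left inner_axis' hit_vec_def)
  finally show ?case .
qed

lemma inner_le_mass:
  assumes "\<And>j. v $ j \<le> c"
  shows "real_vec x \<bullet> v \<le> real (mass x) * c"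
  unfolding real_vec_inner mass_def of_nat_sum sum_distrib_right
  by (intro sum_mono mult_left_mono assms) auto

text \<open>For hereditary sets the linear recursion is an upper bound without any error term,
  obtained by integrating the union bound over the first generation.\<close>

lemma hit_vec_Suc_le:
  assumes "finite_offspring_mean p" "hereditary F"
  shows "hit_vec p (Suc n) F $ i \<le> (offspring_mean p *v hit_vec p n F) $ i"
proof -
  have "hit_vec p (Suc n) F $ i = (\<integral>z. gw_prob p n z F \<partial>p i)"
    by (simp add: hit_vec_def gw_prob_Suc del: gw_iter.simps)
  also have "\<dots> \<le> (\<integral>z. real_vec z \<bullet> hit_vec p n F \<partial>p i)"
    by (intro integral_mono integrable_pmf_bounded[where c=1] integral_inner_offspring assms gw_prob_le_inner) auto
  finally show ?thesis by (simp add: integral_inner_offspring assms)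
qed

text \<open>A nonnegative matrix preserves domination by a multiple of its eigenvector. For
  \<open>F = - {0}\<close> this is the geometric decay of survival in the subcritical case.\<close>

lemma hit_vec_le_eigen:
  assumes p: "finite_offspring_mean p" "hereditary F" and u: "offspring_mean p *v u = \<rho> *s u"
    and le: "\<And>i. hit_vec p n F $ i \<le> c * u $ i"
  shows "hit_vec p (m + n) F $ i \<le> c * \<rho> ^ m * u $ i"
proof (induction m arbitrary: i)
  case 0
  then show ?case using le by simp
next
  case (Suc m)
  have "hit_vec p (Suc m + n) F $ i \<le> (offspring_mean p *v hit_vec p (m + n) F) $ i"
    using hit_vec_Suc_le[OF p, of "m + n"] by simp
  also have "\<dots> \<le> (\<Sum>j\<in>UNIV. offspring_mean p $ i $ j * (c * \<rho> ^ m * u $ j))"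
    unfolding matrix_vector_mult_def by (auto intro!: sum_mono mult_left_mono Suc offspring_mean_nonneg)
  also have "\<dots> = c * \<rho> ^ m * (offspring_mean p *v u) $ i"
    by (simp add: matrix_vector_mult_def sum_distrib_left mult_ac)
  finally show ?case by (simp add: u mult_ac)
qed

text \<open>With \<open>B = F\<close> this is the scale against which errors of the recursion are
  measured; with \<open>B = - {0}\<close> it controls survival of every type at once.\<close>

definition hit_sum :: "('d::finite \<Rightarrow> (nat ^ 'd) pmf) \<Rightarrow> nat \<Rightarrow> (nat ^ 'd) set \<Rightarrow> real" where
  "hit_sum p n B = (\<Sum>i\<in>UNIV. hit_vec p n B $ i)"

lemma hit_sum_nonneg: "0 \<le> hit_sum p n B"
  by (simp add: hit_sum_def sum_nonneg)

lemma hit_vec_le_sum: "hit_vec p n B $ i \<le> hit_sum p n B"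
  unfolding hit_sum_def by (rule member_le_sum) auto

lemma gw_prob_le_mass:
  assumes "hereditary F"
  shows "gw_prob p n x F \<le> real (mass x) * hit_sum p n F"
  using gw_prob_le_inner[OF assms] inner_le_mass[OF hit_vec_le_sum] by (rule order_trans)

lemma hit_sum_plus_le:
  assumes "finite_offspring_mean p" "hereditary F"
  shows "hit_sum p (m + n) F \<le> (\<Sum>i\<in>UNIV. \<Sum>j\<in>UNIV. offspring_mean p $ i $ j) ^ m * hit_sum p n F"
    (is "_ \<le> ?B ^ m * _")
proof (induction m)
  case (Suc m)
  have B: "0 \<le> ?B" by (intro sum_nonneg offspring_mean_nonneg)
  have "hit_sum p (Suc m + n) F \<le> (\<Sum>i\<in>UNIV. (offspring_mean p *v hit_vec p (m + n) F) $ i)"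
    unfolding hit_sum_def add_Suc by (intro sum_mono hit_vec_Suc_le assms)
  also have "\<dots> \<le> (\<Sum>i\<in>UNIV. \<Sum>j\<in>UNIV. offspring_mean p $ i $ j * hit_sum p (m + n) F)"
    unfolding matrix_vector_mult_def
    by (auto intro!: sum_mono mult_left_mono hit_vec_le_sum offspring_mean_nonneg)
  also have "\<dots> = ?B * hit_sum p (m + n) F" by (simp add: sum_distrib_right)
  also have "\<dots> \<le> ?B * (?B ^ m * hit_sum p n F)" by (intro mult_left_mono Suc B)
  finally show ?case by (simp add: mult.assoc)
qed simp

text \<open>A total in \<open>S\<close> arises either from one part in \<open>S\<close> with the
  other extinct, or with both parts alive, and then both lie in \<open>F\<close>.\<close>

lemma gw_prob_add_approx:
  assumes F: "hereditary F" and S: "S \<subseteq> F"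
  shows "\<bar>gw_prob p n (x + y) S - (gw_prob p n x S + gw_prob p n y S)\<bar>
    \<le> gw_prob p n x F * gw_prob p n y (- {0}) + gw_prob p n y F * gw_prob p n x (- {0})"
proof -
  let ?Q = "pair_pmf (gw_iter p n x) (gw_iter p n y)"
  let ?P = "\<lambda>x. gw_prob p n x"
  have S0: "0 \<notin> S" using F S by (auto simp: hereditary_def)
  have "{(a, b). a + b \<in> S} \<subseteq> S \<times> {0} \<union> {0} \<times> S \<union> F \<times> (- {0})"
  proof (intro subsetI)
    fix ab assume "ab \<in> {(a, b). a + b \<in> S}"
    then have "fst ab + snd ab \<in> S" by auto
    then show "ab \<in> S \<times> {0} \<union> {0} \<times> S \<union> F \<times> (- {0})"
      using hereditaryD(1)[OF F, of "fst ab" "snd ab"] S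
      by (cases "fst ab = 0"; cases "snd ab = 0") (auto simp: mem_Times_iff)
  qed
  then have "?P (x + y) S \<le> measure_pmf.prob ?Q (S \<times> {0} \<union> {0} \<times> S \<union> F \<times> (- {0}))"
    unfolding gw_prob_add by (intro measure_pmf.finite_measure_mono) auto
  also have "\<dots> \<le> measure_pmf.prob ?Q (S \<times> {0}) + measure_pmf.prob ?Q ({0} \<times> S) + measure_pmf.prob ?Q (F \<times> (- {0}))"
    by (intro order_trans[OF measure_Un_le] add_right_mono
        measure_Un_le) auto
  also have "\<dots> \<le> ?P x S + ?P y S + ?P x F * ?P y (- {0})"
    by (auto simp: pair_pmf_prob_Times intro!: add_mono mult_left_le mult_left_le_one_le)
  finally have upper: "?P (x + y) S \<le> ?P x S + ?P y S + ?P x F * ?P y (- {0})" .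
  \<comment> \<open>The two one-sided scenarios are disjoint because \<open>S\<close> does not
    contain 0, so their probabilities add up to a lower bound.\<close>
  have "?P x S * (1 - ?P y (- {0})) + (1 - ?P x (- {0})) * ?P y S =
      measure_pmf.prob ?Q (S \<times> {0}) + measure_pmf.prob ?Q ({0} \<times> S)"
    by (simp add: pair_pmf_prob_Times gw_prob_compl)
  also have "\<dots> = measure_pmf.prob ?Q (S \<times> {0} \<union> {0} \<times> S)"
    using S0 by (intro measure_pmf.finite_measure_Union[symmetric]) auto
  also have "\<dots> \<le> ?P (x + y) S"
    unfolding gw_prob_add by (intro measure_pmf.finite_measure_mono) auto
  finally have "?P x S + ?P y S - (?P x S * ?P y (- {0}) + ?P y S * ?P x (- {0})) \<le> ?P (x + y) S"
    by (simp add: algebra_simps)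
  moreover have "?P x S * ?P y (- {0}) + ?P y S * ?P x (- {0}) \<le> ?P x F * ?P y (- {0}) + ?P y F * ?P x (- {0})"
    using S by (intro add_mono mult_right_mono measure_pmf.finite_measure_mono) auto
  moreover have "0 \<le> ?P y F * ?P x (- {0})" by simp
  ultimately show ?thesis using upper by linarith
qed

lemma gw_prob_linear_approx:
  assumes F: "hereditary F" and S: "S \<subseteq> F"
  shows "\<bar>gw_prob p n x S - real_vec x \<bullet> hit_vec p n S\<bar>
    \<le> 2 * (real (mass x))\<^sup>2 * hit_sum p n F * hit_sum p n (- {0})"
proof (induction x rule: nat_vec_induct)
  case zero
  have "0 \<notin> S" using F S by (auto simp: hereditary_def)
  then show ?case by simp
next
  case (add i x)
  let ?E = "hit_sum p n F * hit_sum p n (- {0})" and ?P = "\<lambda>x. gw_prob p n x"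
  have E: "0 \<le> ?E" by (intro mult_nonneg_nonneg hit_sum_nonneg)
  have "\<bar>?P (axis i 1 + x) S - (?P (axis i 1) S + ?P x S)\<bar>
    \<le> ?P (axis i 1) F * ?P x (- {0}) + ?P x F * ?P (axis i 1) (- {0})"
    by (rule gw_prob_add_approx[OF F S])
  also have "\<dots> \<le> hit_sum p n F * (real (mass x) * hit_sum p n (- {0})) + (real (mass x) * hit_sum p n F) * hit_sum p n (- {0})"
    using hit_vec_le_sum[of p n F i] hit_vec_le_sum[of p n "- {0}" i]
    by (intro add_mono mult_mono gw_prob_le_mass F hereditary_nonzero hit_sum_nonneg mult_nonneg_nonneg)
      (auto simp: hit_vec_def)
  also have "\<dots> = 2 * real (mass x) * ?E" by simp
  finally have "\<bar>?P (axis i 1 + x) S - real_vec (axis i 1 + x) \<bullet> hit_vec p n S\<bar>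
      \<le> 2 * real (mass x) * ?E + 2 * (real (mass x))\<^sup>2 * ?E"
    using add by (simp add: real_vec_add inner_add_left inner_axis' hit_vec_def abs_le_iff mult.assoc)
  \<comment> \<open>With \<open>m = mass x\<close>, adding one ancestor costs \<open>2 * m\<close>,
    and \<open>2 * m + 2 * m^2 \<le> 2 * (m + 1)^2\<close>; this makes the error quadratic in the
    population.\<close>
  also have "\<dots> \<le> 2 * (real (mass (axis i 1 + x)))\<^sup>2 * ?E"
    unfolding distrib_right[symmetric]
    by (intro mult_right_mono E) (simp add: mass_add power2_eq_square algebra_simps)
  finally show ?case by (simp add: mult.assoc)
qed

section \<open>Lineages, positivity and comparison between types\<close>

lemma mean_pos_imp_offspring:
  assumes "0 < offspring_mean p $ i $ j"
  shows "\<exists>z. 0 < pmf (p i) z \<and> 0 < z $ j"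
proof (rule ccontr)
  assume "\<nexists>z. 0 < pmf (p i) z \<and> 0 < z $ j"
  then have "z $ j = 0" if "z \<in> set_pmf (p i)" for z
    using pmf_positive[OF that] by auto
  then have "(\<integral>z. real (z $ j) \<partial>p i) = (\<integral>z. 0 \<partial>p i)"
    by (intro integral_cong_AE) (auto simp: AE_measure_pmf_iff)
  then show False using assms by (simp add: offspring_mean_def)
qed

text \<open>A positive entry of the power contains a chain of positive means, hence a possible line
  of descent. The event only asks for one individual of type \<open>j\<close>, so collateral
  relatives do no harm.\<close>

lemma matrix_pow_pos_imp_reach:
  assumes "0 < matrix_pow (offspring_mean p) n $ i $ j"
  shows "0 < gw_prob p n (axis i 1) {z. 0 < z $ j}"
  using assms
proof (induction n arbitrary: i)
  case 0
  then have "i = j" by (auto simp: mat_def split: if_splits)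
  then show ?case by (simp add: indicator_def axis_def)
next
  case (Suc n)
  have "\<exists>k. 0 < offspring_mean p $ i $ k * matrix_pow (offspring_mean p) n $ k $ j"
  proof (rule ccontr)
    assume "\<nexists>k. 0 < offspring_mean p $ i $ k * matrix_pow (offspring_mean p) n $ k $ j"
    then have "matrix_pow (offspring_mean p) (Suc n) $ i $ j \<le> 0"
      by (auto simp: matrix_matrix_mult_def not_less intro!: sum_nonpos)
    with Suc.prems show False by simp
  qed
  then obtain k where k: "0 < offspring_mean p $ i $ k" "0 < matrix_pow (offspring_mean p) n $ k $ j"
    using offspring_mean_nonneg[of p i] by (auto simp: zero_less_mult_iff not_less dest: leD)
  obtain z where z: "0 < pmf (p i) z" "0 < z $ k" using mean_pos_imp_offspring[OF k(1)] by blast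
  obtain y where y: "z = axis k 1 + y" using nat_vec_eq_axis_add[OF z(2)] by blast
  have "0 < gw_prob p n (axis k 1) {z. 0 < z $ j}" using Suc.IH[OF k(2)] .
  also have "\<dots> = measure_pmf.prob (pair_pmf (gw_iter p n (axis k 1)) (gw_iter p n y)) ({z. 0 < z $ j} \<times> UNIV)"
    by (simp add: pair_pmf_prob_Times)
  also have "\<dots> \<le> gw_prob p n z {z. 0 < z $ j}"
    unfolding y gw_prob_add by (intro measure_pmf.finite_measure_mono) auto
  finally have "0 < pmf (gw_iter p 1 (axis i 1)) z * gw_prob p n z {z. 0 < z $ j}"
    unfolding gw_iter_1_axis using z(1) by simp
  also have "\<dots> \<le> gw_prob p (1 + n) (axis i 1) {z. 0 < z $ j}" by (rule gw_prob_plus_ge)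
  finally show ?case by (simp only: plus_1_eq_Suc)
qed

text \<open>To be instantiated with the associated process, which dies out almost surely even when
  the original one does not.\<close>

locale extinct_gw =
  fixes p :: "'d::finite \<Rightarrow> (nat ^ 'd) pmf"
  assumes fin: "finite_offspring_mean p"
    and prim: "primitive_matrix (offspring_mean p)"
    and extinct: "\<And>i. (\<lambda>n. gw_prob p n (axis i 1) {0}) \<longlonglongrightarrow> 1"
begin

lemma survival_tendsto_0: "(\<lambda>n. hit_sum p n (- {0})) \<longlonglongrightarrow> 0"
proof -
  have "(\<lambda>n. \<Sum>i\<in>UNIV. 1 - gw_prob p n (axis i 1) {0}) \<longlonglongrightarrow> (\<Sum>i\<in>(UNIV::'d set). 1 - 1)"
    by (intro tendsto_intros extinct)
  then show ?thesis by (simp add: hit_sum_def hit_vec_def gw_prob_compl)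
qed

text \<open>One \<open>N\<close> serves all initial states: extinction probabilities factorise over
  ancestors, so only the finitely many types matter.\<close>

lemma absorbed_pos: "\<exists>N. \<forall>n\<ge>N. \<forall>x. 0 < gw_prob p n x {0}"
proof -
  have "\<forall>\<^sub>F n in sequentially. \<forall>i. 0 < gw_prob p n (axis i 1) {0}"
    by (intro eventually_all_finite order_tendstoD(1)[OF extinct]) auto
  then obtain N where "\<And>n i. n \<ge> N \<Longrightarrow> 0 < gw_prob p n (axis i 1) {0}"
    by (auto simp: eventually_sequentially)
  then show ?thesis by (subst gw_prob_0_eq) (auto intro!: monomial_pos exI[of _ N])
qed

text \<open>A lineage from type \<open>i'\<close> to type \<open>i\<close> exists, and all its collateral relatives may die out.\<close>

lemma harnack:
  obtains N where "\<And>m. m \<ge> N \<Longrightarrow> \<exists>c>0. \<forall>n\<ge>N. \<forall>i i' B. c * gw_prob p n (axis i 1) B \<le> gw_prob p (m + n) (axis i' 1) B"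
proof -
  obtain N1 where "N1 \<ge> 1" and N1: "\<And>n i j. n \<ge> N1 \<Longrightarrow> 0 < matrix_pow (offspring_mean p) n $ i $ j"
    using primitive_matrix_pow_pos[OF prim] by blast
  obtain N2 where N2: "\<And>n x. n \<ge> N2 \<Longrightarrow> 0 < gw_prob p n x {0}" using absorbed_pos by blast
  define N where "N = max N1 N2"
  have "\<exists>c>0. \<forall>n\<ge>N. \<forall>i i' B. c * gw_prob p n (axis i 1) B \<le> gw_prob p (m + n) (axis i' 1) B"
    if m: "m \<ge> N" for m
  proof -
    have "\<exists>c>0. \<forall>n\<ge>N. \<forall>B. c * gw_prob p n (axis i 1) B \<le> gw_prob p (m + n) (axis i' 1) B" for i i'
    proof -
      have "0 < gw_prob p m (axis i' 1) {z. 0 < z $ i}"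
        using m by (intro matrix_pow_pos_imp_reach N1) (simp add: N_def)
      then have "set_pmf (gw_iter p m (axis i' 1)) \<inter> {z. 0 < z $ i} \<noteq> {}"
        by (auto simp: measure_pmf_zero_iff[symmetric])
      then obtain z where z: "z \<in> set_pmf (gw_iter p m (axis i' 1))" "0 < z $ i" by auto
      obtain w where w: "z = axis i 1 + w" using nat_vec_eq_axis_add[OF z(2)] by blast
      \<comment> \<open>The collateral relatives \<open>w\<close> are required to be extinct already
        at time \<open>N\<close>; absorption is monotone in time, so \<open>c\<close> does not
        depend on \<open>n\<close>.\<close>
      define c where "c = pmf (gw_iter p m (axis i' 1)) z * gw_prob p N w {0}"
      have "0 < c" using z N2[of N w] by (simp add: c_def pmf_positive N_def)
      moreover have "c * gw_prob p n (axis i 1) B \<le> gw_prob p (m + n) (axis i' 1) B" if n: "n \<ge> N" for n B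
      proof -
        have "gw_prob p N w {0} \<le> gw_prob p n w {0}"
          using gw_prob_absorbed_mono[of p N w "n - N"] n by simp
        then have "gw_prob p n (axis i 1) B * gw_prob p N w {0} \<le> gw_prob p n z B"
          unfolding w using gw_prob_add_ge[of p n "axis i 1" B w] by (meson mult_left_mono measure_nonneg order_trans)
        then have "c * gw_prob p n (axis i 1) B \<le> pmf (gw_iter p m (axis i' 1)) z * gw_prob p n z B"
          unfolding c_def by (simp add: mult.assoc mult.commute[of "gw_prob p N w {0}"] mult_left_mono)
        also have "\<dots> \<le> gw_prob p (m + n) (axis i' 1) B" by (rule gw_prob_plus_ge)
        finally show ?thesis .
      qed
      ultimately show ?thesis by blast
    qed
    then obtain c where c: "\<And>i i'. 0 < c i i'"
      "\<And>i i' n B. n \<ge> N \<Longrightarrow> c i i' * gw_prob p n (axis i 1) B \<le> gw_prob p (m + n) (axis i' 1) B"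
      by metis
    define c0 where "c0 = Min (range (\<lambda>(i, i'). c i i'))"
    have "c0 \<in> range (\<lambda>(i, i'). c i i')" unfolding c0_def by (rule Min_in) auto
    then have "0 < c0" using c(1) by auto
    moreover have "c0 \<le> c i i'" for i i'
      unfolding c0_def by (rule Min_le) (auto intro!: image_eqI[of _ _ "(i, i')"])
    then have "c0 * gw_prob p n (axis i 1) B \<le> gw_prob p (m + n) (axis i' 1) B" if "n \<ge> N" for n i i' B
      using c(2)[OF that, where B=B and i=i and i'=i'] by (meson mult_right_mono measure_nonneg order_trans)
    ultimately show ?thesis by blast
  qed
  then show ?thesis using that by blast
qed

text \<open>Accessibility supplies some time for each state. One fixed hitting time from a single
  individual is spread by the Harnack inequality to all late times and all types, while the other
  ancestors die out.\<close>

lemma eventually_hit_pos: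
  assumes acc: "\<And>x. x \<noteq> 0 \<Longrightarrow> \<exists>n. 0 < gw_prob p n x S"
  shows "\<exists>N. \<forall>n\<ge>N. \<forall>x. x \<noteq> 0 \<longrightarrow> 0 < gw_prob p n x S"
proof -
  obtain N1 where "N1 \<ge> 1" and N1: "\<And>n i j. n \<ge> N1 \<Longrightarrow> 0 < matrix_pow (offspring_mean p) n $ i $ j"
    using primitive_matrix_pow_pos[OF prim] by blast
  obtain N2 where N2: "\<And>n x. n \<ge> N2 \<Longrightarrow> 0 < gw_prob p n x {0}" using absorbed_pos by blast
  obtain N3 where N3: "\<And>m. m \<ge> N3 \<Longrightarrow> \<exists>c>0. \<forall>n\<ge>N3. \<forall>i i' B. c * gw_prob p n (axis i 1) B \<le> gw_prob p (m + n) (axis i' 1) B"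
    using harnack by blast
  define i :: 'd where "i = undefined"
  define N where "N = N1 + N2 + N3"
  \<comment> \<open>Passing through a state \<open>z\<close> at time \<open>N\<close> makes the
    hitting time \<open>N + n1\<close> at least \<open>N3\<close>, as the Harnack inequality
    demands.\<close>
  have "0 < gw_prob p N (axis i 1) {z. 0 < z $ i}"
    by (intro matrix_pow_pos_imp_reach N1) (simp add: N_def)
  then have "set_pmf (gw_iter p N (axis i 1)) \<inter> {z. 0 < z $ i} \<noteq> {}"
    by (auto simp: measure_pmf_zero_iff[symmetric])
  then obtain z where z: "z \<in> set_pmf (gw_iter p N (axis i 1))" "0 < z $ i" by auto
  then have "z \<noteq> 0" by auto
  then obtain n1 where n1: "0 < gw_prob p n1 z S" using acc by blast
  have "0 < pmf (gw_iter p N (axis i 1)) z * gw_prob p n1 z S" using z n1 by (simp add: pmf_positive)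
  also have "\<dots> \<le> gw_prob p (N + n1) (axis i 1) S" by (rule gw_prob_plus_ge)
  finally have pos: "0 < gw_prob p (N + n1) (axis i 1) S" .
  have "0 < gw_prob p n x S" if n: "n \<ge> N + (N + n1)" and x: "x \<noteq> 0" for n x
  proof -
    define m where "m = n - (N + n1)"
    have m: "m \<ge> N3" "n = m + (N + n1)" using n by (simp_all add: m_def N_def)
    obtain i' where "0 < x $ i'" using x by (auto simp: vec_eq_iff)
    then obtain y where y: "x = axis i' 1 + y" by (rule nat_vec_eq_axis_add)
    obtain c where c: "c > 0" "\<And>n i i' B. n \<ge> N3 \<Longrightarrow> c * gw_prob p n (axis i 1) B \<le> gw_prob p (m + n) (axis i' 1) B"
      using N3[OF m(1)] by blast
    have "0 < c * gw_prob p (N + n1) (axis i 1) S" using c(1) pos by simp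
    also have "\<dots> \<le> gw_prob p n (axis i' 1) S" unfolding m(2) by (rule c(2)) (simp add: N_def)
    finally have "0 < gw_prob p n (axis i' 1) S * gw_prob p n y {0}"
      using N2[of n y] n by (simp add: N_def)
    also have "\<dots> \<le> gw_prob p n x S" unfolding y by (rule gw_prob_add_ge)
    finally show ?thesis .
  qed
  then show ?thesis by blast
qed

text \<open>Removes the time shift and the type dependence: starting from
  \<open>k = n - (L + N)\<close>, tightness is used for \<open>L\<close> generations and the Harnack
  inequality for \<open>N\<close>.\<close>

lemma hit_comparable:
  assumes F: "hereditary F" and c: "0 < c"
    and tight: "\<And>n i. n \<ge> n0 \<Longrightarrow> c * hit_vec p n F $ i \<le> hit_vec p (n + L) S $ i"
  obtains C where "0 < C" "\<forall>\<^sub>F n in sequentially. \<forall>j. hit_sum p n F \<le> C * hit_vec p n S $ j"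
proof -
  obtain N where N: "\<And>m. m \<ge> N \<Longrightarrow> \<exists>c>0. \<forall>n\<ge>N. \<forall>i i' B. c * gw_prob p n (axis i 1) B \<le> gw_prob p (m + n) (axis i' 1) B"
    using harnack by blast
  obtain c1 where c1: "0 < c1" "\<And>n i i' B. n \<ge> N \<Longrightarrow> c1 * gw_prob p n (axis i 1) B \<le> gw_prob p (N + n) (axis i' 1) B"
    using N[OF order_refl] by blast
  define B where "B = (\<Sum>i\<in>UNIV. \<Sum>j\<in>UNIV. offspring_mean p $ i $ j)"
  have B: "0 \<le> B" unfolding B_def by (intro sum_nonneg offspring_mean_nonneg)
  \<comment> \<open>\<open>B ^ (L + N)\<close> bounds the growth of \<open>hit_sum\<close> from
    \<open>k\<close> to \<open>n\<close>, \<open>c\<close> comes from tightness, \<open>c1\<close>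
    from the Harnack inequality, \<open>CARD('d)\<close> from summing over types. The added 1
    secures \<open>0 < C\<close>, since only \<open>0 \<le> B\<close> is known.\<close>
  define C where "C = B ^ (L + N) * (real CARD('d) / (c1 * c)) + 1"
  have "0 < C" using B c c1 by (auto simp: C_def intro!: add_nonneg_pos mult_nonneg_nonneg)
  moreover have "hit_sum p n F \<le> C * hit_vec p n S $ j" if n: "n \<ge> n0 + N + L + N" for n j
  proof -
    define k where "k = n - (L + N)"
    have k: "k \<ge> n0" "k \<ge> N" "n = N + (k + L)" "n = (L + N) + k" using n by (auto simp: k_def)
    have "c1 * c * hit_vec p k F $ i \<le> hit_vec p n S $ j" for i
    proof -
      have "c1 * (c * hit_vec p k F $ i) \<le> c1 * hit_vec p (k + L) S $ i"
        using c1(1) by (intro mult_left_mono tight k) auto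
      also have "\<dots> \<le> hit_vec p n S $ j"
        unfolding hit_vec_def k(3) using c1(2)[of "k + L" i S j] k(2) by simp
      finally show ?thesis by (simp add: mult.assoc)
    qed
    then have "(\<Sum>i\<in>UNIV. c1 * c * hit_vec p k F $ i) \<le> of_nat (card (UNIV :: 'd set)) * hit_vec p n S $ j"
      by (intro sum_bounded_above)
    then have "c1 * c * hit_sum p k F \<le> real CARD('d) * hit_vec p n S $ j"
      by (simp add: hit_sum_def sum_distrib_left)
    then have *: "hit_sum p k F \<le> real CARD('d) / (c1 * c) * hit_vec p n S $ j"
      using c c1(1) by (simp add: field_simps)
    have "hit_sum p n F \<le> B ^ (L + N) * hit_sum p k F"
      unfolding k(4) B_def by (rule hit_sum_plus_le[OF fin F])
    also have "\<dots> \<le> B ^ (L + N) * (real CARD('d) / (c1 * c) * hit_vec p n S $ j)"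
      using B * by (intro mult_left_mono) auto
    also have "\<dots> \<le> C * hit_vec p n S $ j"
      unfolding mult.assoc[symmetric] by (intro mult_right_mono) (auto simp: C_def)
    finally show ?thesis .
  qed
  then have "\<forall>\<^sub>F n in sequentially. \<forall>j. hit_sum p n F \<le> C * hit_vec p n S $ j"
    by (auto simp: eventually_sequentially intro!: exI[of _ "n0 + N + L + N"])
  ultimately show ?thesis using that by blast
qed

text \<open>Dominated convergence under the offspring law. For fixed \<open>z\<close> the normalised
  error is at most \<open>2 * (mass z)^2\<close> times the survival probabilities, and for all
  \<open>n\<close> it is at most \<open>mass z\<close>, which is integrable.\<close>

lemma hit_vec_step_approx:
  assumes F: "hereditary F" and S: "S \<subseteq> F"
  shows "(\<lambda>n. (hit_vec p (Suc n) S $ i - (offspring_mean p *v hit_vec p n S) $ i) / hit_sum p n F) \<longlonglongrightarrow> 0"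
proof -
  \<comment> \<open>If \<open>hit_sum p n F\<close> is 0, division by zero makes
    \<open>g n z\<close> equal to 0, so the bounds hold for every \<open>n\<close>.\<close>
  define g where "g n z = (gw_prob p n z S - real_vec z \<bullet> hit_vec p n S) / hit_sum p n F" for n z
  have g_int: "(\<integral>z. g n z \<partial>p i) =
      (hit_vec p (Suc n) S $ i - (offspring_mean p *v hit_vec p n S) $ i) / hit_sum p n F" for n
  proof -
    have "(\<integral>z. gw_prob p n z S - real_vec z \<bullet> hit_vec p n S \<partial>p i) =
        hit_vec p (Suc n) S $ i - (offspring_mean p *v hit_vec p n S) $ i"
      by (subst Bochner_Integration.integral_diff)
        (auto intro!: integrable_pmf_bounded[where c=1] integral_inner_offspring fin
          simp: hit_vec_def gw_prob_Suc integral_inner_offspring[OF fin] simp del: gw_iter.simps)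
    then show ?thesis by (simp add: g_def)
  qed
  have "(\<lambda>n. \<integral>z. g n z \<partial>p i) \<longlonglongrightarrow> (\<integral>z. 0 \<partial>p i)"
  proof (rule integral_dominated_convergence[where w="\<lambda>z. real (mass z)"])
    show "AE z in p i. (\<lambda>n. g n z) \<longlonglongrightarrow> 0"
    proof (rule AE_I2, rule Lim_null_comparison)
      fix z
      show "\<forall>\<^sub>F n in sequentially. norm (g n z) \<le> 2 * (real (mass z))\<^sup>2 * hit_sum p n (- {0})"
      proof (intro always_eventually allI)
        fix n
        show "norm (g n z) \<le> 2 * (real (mass z))\<^sup>2 * hit_sum p n (- {0})"
          using gw_prob_linear_approx[OF F S, of p n z] hit_sum_nonneg[of p n F] hit_sum_nonneg[of p n "- {0}"]
          by (cases "hit_sum p n F = 0") (auto simp: g_def field_simps)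
      qed
      show "(\<lambda>n. 2 * (real (mass z))\<^sup>2 * hit_sum p n (- {0})) \<longlonglongrightarrow> 0"
        by (intro tendsto_mult_right_zero survival_tendsto_0)
    qed
    show "AE z in p i. norm (g n z) \<le> real (mass z)" for n
    proof (intro AE_I2)
      fix z
      have "gw_prob p n z S \<le> real (mass z) * hit_sum p n F"
        by (rule order_trans[OF measure_pmf.finite_measure_mono[OF S] gw_prob_le_mass[OF F]]) simp
      moreover have "real_vec z \<bullet> hit_vec p n S \<le> real (mass z) * hit_sum p n F"
        by (intro inner_le_mass order_trans[OF hit_vec_mono[OF S] hit_vec_le_sum])
      moreover have "0 \<le> real_vec z \<bullet> hit_vec p n S"
        by (auto simp: real_vec_inner intro!: sum_nonneg)
      moreover have "0 \<le> gw_prob p n z S" by simp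
      ultimately have "\<bar>gw_prob p n z S - real_vec z \<bullet> hit_vec p n S\<bar> \<le> real (mass z) * hit_sum p n F"
        by linarith
      then show "norm (g n z) \<le> real (mass z)"
        using hit_sum_nonneg[of p n F] by (cases "hit_sum p n F = 0") (auto simp: g_def field_simps)
    qed
  qed (auto intro: integrable_mass[OF fin])
  then show ?thesis by (simp add: g_int)
qed

theorem ratio_limit_of_tight:
  assumes F: "hereditary F" and S: "S \<subseteq> F" and c: "0 < c"
    and tight: "\<And>n i. n \<ge> n0 \<Longrightarrow> c * hit_vec p n F $ i \<le> hit_vec p (n + L) S $ i"
    and acc: "\<And>x. x \<noteq> 0 \<Longrightarrow> \<exists>n. 0 < gw_prob p n x S"
    and x: "x \<noteq> 0"
  shows "(\<lambda>n. gw_prob p n y S / gw_prob p (k + n) x S) \<longlonglongrightarrow>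
    1 / perron_root (offspring_mean p) ^ k *
      ((real_vec y \<bullet> perron_right (offspring_mean p)) / (real_vec x \<bullet> perron_right (offspring_mean p)))"
proof -
  define u \<rho> where "u = perron_right (offspring_mean p)" and "\<rho> = perron_root (offspring_mean p)"
  have \<rho>: "0 < \<rho>" and u: "\<And>i. 0 < u $ i"
    using perron_frobenius(1,3)[OF prim] by (simp_all add: u_def \<rho>_def)
  obtain C where C: "0 < C" "\<forall>\<^sub>F n in sequentially. \<forall>j. hit_sum p n F \<le> C * hit_vec p n S $ j"
    using hit_comparable[OF F c tight] by blast
  obtain N where N: "\<And>n x. n \<ge> N \<Longrightarrow> x \<noteq> 0 \<Longrightarrow> 0 < gw_prob p n x S"
    using eventually_hit_pos[OF acc] by blast
  have pos: "\<forall>\<^sub>F n in sequentially. \<forall>i. 0 < hit_vec p n S $ i"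
    using N by (auto simp: eventually_sequentially hit_vec_def axis_eq_0_iff intro!: exI[of _ N])
  have bounds: "\<forall>\<^sub>F n in sequentially. 0 < hit_sum p n F \<and>
      (\<forall>i. (1 / C) * hit_sum p n F \<le> hit_vec p n S $ i \<and> hit_vec p n S $ i \<le> hit_sum p n F)"
    using C(2) pos
  proof eventually_elim
    case (elim n)
    have le: "hit_vec p n S $ i \<le> hit_sum p n F" for i
      by (rule order_trans[OF hit_vec_mono[OF S] hit_vec_le_sum])
    have "0 < hit_sum p n F" using elim(2) le less_le_trans by blast
    then show ?case using elim C(1) le by (auto simp: field_simps)
  qed
  have C': "0 < 1 / C" using C(1) by simp
  note iter = perturbed_primitive_iteration[where a="\<lambda>n. hit_vec p n S", OF prim C' bounds hit_vec_step_approx[OF F S],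
      folded u_def \<rho>_def]
  \<comment> \<open>The component of \<open>hit_vec\<close> at an arbitrary type is the common
    yardstick for the numerator, the shift in time and the denominator.\<close>
  define i :: 'd where "i = undefined"
  have one: "(\<lambda>n. gw_prob p n y S / hit_vec p n S $ i) \<longlonglongrightarrow> (real_vec y \<bullet> u) / u $ i" for y
  proof -
    have "(\<lambda>n. \<Sum>j\<in>UNIV. real (y $ j) * (hit_vec p n S $ j / hit_vec p n S $ i))
        \<longlonglongrightarrow> (\<Sum>j\<in>UNIV. real (y $ j) * (u $ j / u $ i))"
      by (intro tendsto_intros iter)
    then have main: "(\<lambda>n. (real_vec y \<bullet> hit_vec p n S) / hit_vec p n S $ i) \<longlonglongrightarrow> (real_vec y \<bullet> u) / u $ i"
      by (simp add: real_vec_inner sum_divide_distrib)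
    have "(\<lambda>n. (gw_prob p n y S - real_vec y \<bullet> hit_vec p n S) / hit_vec p n S $ i) \<longlonglongrightarrow> 0"
    proof (rule Lim_null_comparison)
      show "\<forall>\<^sub>F n in sequentially. norm ((gw_prob p n y S - real_vec y \<bullet> hit_vec p n S) / hit_vec p n S $ i)
          \<le> 2 * (real (mass y))\<^sup>2 * C * hit_sum p n (- {0})"
        using C(2) pos
      proof eventually_elim
        case (elim n)
        have "\<bar>gw_prob p n y S - real_vec y \<bullet> hit_vec p n S\<bar>
            \<le> 2 * (real (mass y))\<^sup>2 * hit_sum p n F * hit_sum p n (- {0})"
          by (rule gw_prob_linear_approx[OF F S])
        also have "\<dots> \<le> 2 * (real (mass y))\<^sup>2 * (C * hit_vec p n S $ i) * hit_sum p n (- {0})"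
          using elim(1) by (intro mult_right_mono mult_left_mono hit_sum_nonneg) auto
        finally show ?case using elim(2)[rule_format, of i] by (simp add: field_simps)
      qed
      show "(\<lambda>n. 2 * (real (mass y))\<^sup>2 * C * hit_sum p n (- {0})) \<longlonglongrightarrow> 0"
        by (intro tendsto_mult_right_zero survival_tendsto_0)
    qed
    from tendsto_add[OF this main] show ?thesis by (simp add: diff_divide_distrib)
  qed
  have shift: "(\<lambda>n. hit_vec p n S $ i / hit_vec p (k + n) S $ i) \<longlonglongrightarrow> 1 / \<rho> ^ k"
  proof -
    have "(\<lambda>n. hit_vec p (k + n) S $ i / hit_vec p n S $ i) \<longlonglongrightarrow> \<rho> ^ k"
    proof (induction k)
      case 0
      have "\<forall>\<^sub>F n in sequentially. 1 = hit_vec p (0 + n) S $ i / hit_vec p n S $ i"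
        using pos by eventually_elim (metis add_0 divide_self less_irrefl)
      from Lim_transform_eventually[OF tendsto_const this] show ?case by simp
    next
      case (Suc k)
      have "(\<lambda>n. hit_vec p (Suc (n + k)) S $ i / hit_vec p (n + k) S $ i) \<longlonglongrightarrow> \<rho>"
        using LIMSEQ_ignore_initial_segment[OF iter(2)[of i], of k] by simp
      from tendsto_mult[OF this Suc]
      have "(\<lambda>n. hit_vec p (Suc (n + k)) S $ i / hit_vec p (n + k) S $ i * (hit_vec p (k + n) S $ i / hit_vec p n S $ i))
          \<longlonglongrightarrow> \<rho> ^ Suc k" by simp
      moreover have "\<forall>\<^sub>F n in sequentially. 0 < hit_vec p (n + k) S $ i"
        using eventually_sequentially_seg[THEN iffD2, OF pos, of k] by (rule eventually_mono) auto
      then have "\<forall>\<^sub>F n in sequentially. hit_vec p (Suc (n + k)) S $ i / hit_vec p (n + k) S $ i * (hit_vec p (k + n) S $ i / hit_vec p n S $ i)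
          = hit_vec p (Suc k + n) S $ i / hit_vec p n S $ i"
        by eventually_elim (simp add: add.commute)
      ultimately show ?case by (rule Lim_transform_eventually)
    qed
    then have "(\<lambda>n. inverse (hit_vec p (k + n) S $ i / hit_vec p n S $ i)) \<longlonglongrightarrow> inverse (\<rho> ^ k)"
      using \<rho> by (intro tendsto_inverse) auto
    then show ?thesis by (simp add: inverse_eq_divide)
  qed
  have xu: "0 < real_vec x \<bullet> u"
  proof -
    obtain j where "x $ j \<noteq> 0" using x by (auto simp: vec_eq_iff)
    then have "0 < real (x $ j) * u $ j" using u by simp
    also have "\<dots> \<le> real_vec x \<bullet> u"
      unfolding real_vec_inner by (rule member_le_sum) (simp_all add: less_imp_le u)
    finally show ?thesis .
  qed
  have den: "(\<lambda>n. gw_prob p (k + n) x S / hit_vec p (k + n) S $ i) \<longlonglongrightarrow> (real_vec x \<bullet> u) / u $ i"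
    using LIMSEQ_ignore_initial_segment[OF one[of x], of k] by (simp add: add.commute)
  have lim: "(\<lambda>n. (gw_prob p n y S / hit_vec p n S $ i) * (hit_vec p n S $ i / hit_vec p (k + n) S $ i)
      / (gw_prob p (k + n) x S / hit_vec p (k + n) S $ i))
      \<longlonglongrightarrow> ((real_vec y \<bullet> u) / u $ i) * (1 / \<rho> ^ k) / ((real_vec x \<bullet> u) / u $ i)"
    using xu u[of i] by (intro tendsto_divide[OF tendsto_mult[OF one shift] den]) simp
  have eq: "((real_vec y \<bullet> u) / u $ i) * (1 / \<rho> ^ k) / ((real_vec x \<bullet> u) / u $ i)
      = 1 / \<rho> ^ k * ((real_vec y \<bullet> u) / (real_vec x \<bullet> u))"
    using u[of i] by simp
  have "\<forall>\<^sub>F n in sequentially. 0 < hit_vec p (n + k) S $ i"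
    using eventually_sequentially_seg[THEN iffD2, OF pos, of k] by (rule eventually_mono) auto
  with pos have "\<forall>\<^sub>F n in sequentially.
      (gw_prob p n y S / hit_vec p n S $ i) * (hit_vec p n S $ i / hit_vec p (k + n) S $ i)
      / (gw_prob p (k + n) x S / hit_vec p (k + n) S $ i) = gw_prob p n y S / gw_prob p (k + n) x S"
    by eventually_elim (auto simp: add.commute less_imp_neq[THEN not_sym] dest!: spec[of _ i])
  from Lim_transform_eventually[OF lim this] show ?thesis
    unfolding u_def[symmetric] \<rho>_def[symmetric] eq .
qed

end

section \<open>Comparability of \<open>S\<close> with a hereditary set in the three cases\<close>

lemma half_pow_mass: "monomial (\<chi> i. 1 / 2) z = (1 / 2) ^ mass z"
  by (simp add: monomial_def mass_def power_sum)

context extinct_gw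
begin

lemma survival_pos:
  obtains N where "\<And>n i. n \<ge> N \<Longrightarrow> 0 < gw_prob p n (axis i 1) (- {0})"
proof -
  obtain N where "N \<ge> 1" and N: "\<And>n i j. n \<ge> N \<Longrightarrow> 0 < matrix_pow (offspring_mean p) n $ i $ j"
    using primitive_matrix_pow_pos[OF prim] by blast
  have "0 < gw_prob p n (axis i 1) (- {0})" if n: "n \<ge> N" for n i
  proof -
    have "0 < gw_prob p n (axis i 1) {z. 0 < z $ i}"
      using n by (intro matrix_pow_pos_imp_reach N)
    also have "\<dots> \<le> gw_prob p n (axis i 1) (- {0})"
      by (intro measure_pmf.finite_measure_mono) auto
    finally show ?thesis .
  qed
  then show ?thesis using that by blast
qed

text \<open>Markov's inequality for \<open>2 ^ - mass X\<close>, whose expectation decays geometrically in the mass of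
  the initial state.\<close>

lemma small_mass_unlikely:
  assumes surv: "\<And>i. 0 < gw_prob p n (axis i 1) (- {0})" and \<epsilon>: "0 < \<epsilon>"
  shows "\<exists>R'. \<forall>x. mass x \<ge> R' \<longrightarrow> gw_prob p n x {z. mass z \<le> R} \<le> \<epsilon>"
proof -
  define h :: "real ^ 'd" where "h = (\<chi> i. 1 / 2)"
  define \<phi> where "\<phi> i = (\<integral>z. monomial h z \<partial>gw_iter p n (axis i 1))" for i
  \<comment> \<open>A nonempty population contributes at most 1/2, so a positive survival
    probability pushes \<phi> strictly below 1.\<close>
  have mono_le: "monomial h z \<le> 1 - indicator (- {0}) z / 2" for z
  proof (cases "z = 0")
    case False
    then have "mass z \<ge> 1" using mass_eq_0_iff[of z] by (cases "mass z") auto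
    then have "(1 / 2 :: real) ^ mass z \<le> (1 / 2) ^ 1" by (intro power_decreasing) auto
    then show ?thesis using False by (simp add: h_def half_pow_mass)
  qed simp
  have h0: "0 \<le> monomial h z" "\<bar>monomial h z\<bar> \<le> 1" for z
    using monomial_le_1[of h z] monomial_nonneg[of h z] by (auto simp: h_def)
  have \<phi>: "0 \<le> \<phi> i" "\<phi> i < 1" for i
  proof -
    show "0 \<le> \<phi> i" unfolding \<phi>_def by (rule Bochner_Integration.integral_nonneg) (simp add: h0)
    have "\<phi> i \<le> (\<integral>z. 1 - indicator (- {0}) z / 2 \<partial>gw_iter p n (axis i 1))"
      unfolding \<phi>_def
      by (intro integral_mono integrable_pmf_bounded[where c=1] mono_le h0) (auto simp: indicator_def)
    also have "\<dots> = 1 - gw_prob p n (axis i 1) (- {0}) / 2"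
      by (subst Bochner_Integration.integral_diff) (auto intro!: integrable_pmf_bounded[where c=1] split: split_indicator)
    finally show "\<phi> i < 1" using surv[of i] by simp
  qed
  define \<theta> where "\<theta> = Max (range \<phi>)"
  have "\<theta> \<in> range \<phi>" unfolding \<theta>_def by (rule Max_in) auto
  then have \<theta>: "0 \<le> \<theta>" "\<theta> < 1" using \<phi> by auto
  have \<phi>\<theta>: "\<phi> i \<le> \<theta>" for i unfolding \<theta>_def by (rule Max_ge) auto
  have bound: "gw_prob p n x {z. mass z \<le> R} \<le> 2 ^ R * \<theta> ^ mass x" for x
  proof -
    have "gw_prob p n x {z. mass z \<le> R} = (\<integral>z. indicator {z. mass z \<le> R} z \<partial>gw_iter p n x)" by simp
    also have "\<dots> \<le> (\<integral>z. 2 ^ R * monomial h z \<partial>gw_iter p n x)"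
    proof (rule integral_mono)
      show "integrable (gw_iter p n x) (\<lambda>z. 2 ^ R * monomial h z)"
        by (intro integrable_mult_right integrable_pmf_bounded[where c=1] h0)
      fix z
      show "indicator {z. mass z \<le> R} z \<le> 2 ^ R * monomial h z"
      proof (cases "mass z \<le> R")
        case True
        then have "(1 / 2 :: real) ^ R \<le> (1 / 2) ^ mass z" by (intro power_decreasing) auto
        then show ?thesis using True by (simp add: h_def half_pow_mass power_divide field_simps)
      qed (use h0 in auto)
    qed (auto intro!: integrable_pmf_bounded[where c=1] split: split_indicator)
    also have "\<dots> = 2 ^ R * monomial (\<chi> j. \<phi> j) x"
      unfolding \<phi>_def by (subst expectation_monomial_gw_iter[symmetric]) (simp_all add: h_def)
    also have "monomial (\<chi> j. \<phi> j) x \<le> \<theta> ^ mass x"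
      unfolding monomial_def mass_def power_sum
      by (intro prod_mono) (auto intro!: power_mono zero_le_power \<phi>\<theta> \<phi>)
    finally show ?thesis by simp
  qed
  have "(\<lambda>m. 2 ^ R * \<theta> ^ m) \<longlonglongrightarrow> 0"
    using \<theta> by (intro tendsto_mult_right_zero LIMSEQ_power_zero) simp
  then have "\<forall>\<^sub>F m in sequentially. 2 ^ R * \<theta> ^ m < \<epsilon>" using \<epsilon> by (rule order_tendstoD)
  then obtain R' where "\<And>m. m \<ge> R' \<Longrightarrow> 2 ^ R * \<theta> ^ m < \<epsilon>" by (auto simp: eventually_sequentially)
  then show ?thesis using bound by (intro exI[of _ R']) (meson less_imp_le order_trans)
qed

text \<open>Conditioning on the generation at time \<open>n\<close> reduces the tightness hypothesis
  of \<open>ratio_limit_of_tight\<close> to a lower bound uniform over states of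
  \<open>F\<close>.\<close>

lemma tight_of_uniform:
  assumes "\<And>x. x \<in> F \<Longrightarrow> c \<le> gw_prob p L x S"
  shows "c * hit_vec p n F $ i \<le> hit_vec p (n + L) S $ i"
proof -
  have "c * hit_vec p n F $ i = (\<integral>z. c * indicator F z \<partial>gw_iter p n (axis i 1))"
    by (simp add: hit_vec_def)
  also have "\<dots> \<le> (\<integral>z. gw_prob p L z S \<partial>gw_iter p n (axis i 1))"
    by (intro integral_mono integrable_pmf_bounded[where c=1] integrable_mult_right)
      (use assms in \<open>auto simp: indicator_def\<close>)
  finally show ?thesis by (simp add: hit_vec_def gw_prob_plus)
qed

lemma finite_uniform_hit:
  assumes pos: "\<And>x. x \<noteq> 0 \<Longrightarrow> 0 < gw_prob p L x S" and F: "finite F" "0 \<notin> F"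
  obtains c where "0 < c" "\<And>x. x \<in> F \<Longrightarrow> c \<le> gw_prob p L x S"
proof -
  \<comment> \<open>The inserted 1 keeps the minimum meaningful when \<open>F\<close> is
    empty.\<close>
  define c where "c = Min (insert 1 ((\<lambda>x. gw_prob p L x S) ` F))"
  have "c \<in> insert 1 ((\<lambda>x. gw_prob p L x S) ` F)" unfolding c_def using F by (intro Min_in) auto
  moreover have "0 < gw_prob p L x S" if "x \<in> F" for x using that F by (intro pos) auto
  ultimately have "0 < c" by auto
  moreover have "c \<le> gw_prob p L x S" if "x \<in> F" for x
    unfolding c_def using F that by (intro Min_le) auto
  ultimately show ?thesis using that by blast
qed

definition ratio_limit :: "(nat ^ 'd) set \<Rightarrow> bool" where
  "ratio_limit S \<longleftrightarrow> (\<forall>x y k. x \<noteq> 0 \<longrightarrow> (\<lambda>n. gw_prob p n y S / gw_prob p (k + n) x S) \<longlonglongrightarrow>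
    1 / perron_root (offspring_mean p) ^ k *
      ((real_vec y \<bullet> perron_right (offspring_mean p)) / (real_vec x \<bullet> perron_right (offspring_mean p))))"

lemma ratio_limit_finite:
  assumes S: "finite S" "0 \<notin> S" and acc: "\<And>x. x \<noteq> 0 \<Longrightarrow> \<exists>n. 0 < gw_prob p n x S"
  shows "ratio_limit S"
proof -
  define F where "F = {a. a \<noteq> 0 \<and> (\<exists>b. a + b \<in> S)}"
  have F: "hereditary F"
    unfolding hereditary_def F_def by (auto simp: add.assoc)
  have SF: "S \<subseteq> F" using S(2) by (auto simp: F_def intro!: exI[of _ 0])
  have "F \<subseteq> {a. mass a \<le> Max (mass ` S)}"
  proof
    fix a assume "a \<in> F"
    then obtain b where "a + b \<in> S" by (auto simp: F_def)
    then have "mass (a + b) \<le> Max (mass ` S)" using S(1) by (intro Max_ge) auto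
    then show "a \<in> {a. mass a \<le> Max (mass ` S)}" by (simp add: mass_add)
  qed
  then have finF: "finite F" using finite_mass_le finite_subset by blast
  obtain L where L: "\<And>n x. n \<ge> L \<Longrightarrow> x \<noteq> 0 \<Longrightarrow> 0 < gw_prob p n x S"
    using eventually_hit_pos[OF acc] by blast
  have "0 \<notin> F" by (simp add: F_def)
  then obtain c where c: "0 < c" "\<And>x. x \<in> F \<Longrightarrow> c \<le> gw_prob p L x S"
    using finite_uniform_hit[OF L[OF order_refl] finF] by blast
  show ?thesis unfolding ratio_limit_def
    using ratio_limit_of_tight[OF F SF c(1) tight_of_uniform[OF c(2)] acc] by blast
qed

lemma ratio_limit_cofinite:
  assumes S: "finite (- ({0} \<union> S))" "0 \<notin> S" and acc: "\<And>x. x \<noteq> 0 \<Longrightarrow> \<exists>n. 0 < gw_prob p n x S"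
  shows "ratio_limit S"
proof -
  obtain N1 where N1: "\<And>n i. n \<ge> N1 \<Longrightarrow> 0 < gw_prob p n (axis i 1) (- {0})"
    using survival_pos by blast
  obtain N2 where N2: "\<And>n x. n \<ge> N2 \<Longrightarrow> x \<noteq> 0 \<Longrightarrow> 0 < gw_prob p n x S"
    using eventually_hit_pos[OF acc] by blast
  define L where "L = N1 + N2"
  define R where "R = Max (mass ` (- S))"
  have "- S \<subseteq> insert 0 (- ({0} \<union> S))" by auto
  then have finS: "finite (- S)" using S(1) by (meson finite_insert finite_subset)
  have R: "mass z \<le> R" if "z \<notin> S" for z
    unfolding R_def using that finS by (intro Max_ge) auto
  have "\<exists>R'. \<forall>x. mass x \<ge> R' \<longrightarrow> gw_prob p L x {z. mass z \<le> R} \<le> 1 / 2"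
    by (rule small_mass_unlikely) (auto simp: N1 L_def)
  then obtain R' where R': "\<And>x. mass x \<ge> R' \<Longrightarrow> gw_prob p L x {z. mass z \<le> R} \<le> 1 / 2" by blast
  \<comment> \<open>Large states leave \<open>S\<close> with probability at most 1/2 at time
    \<open>L\<close>; only finitely many nonzero states remain, and each of them hits
    \<open>S\<close> at that time.\<close>
  have "finite ({x. mass x \<le> R'} - {0})" using finite_mass_le by blast
  then obtain c where c: "0 < c" "\<And>x. x \<in> {x. mass x \<le> R'} - {0} \<Longrightarrow> c \<le> gw_prob p L x S"
    using finite_uniform_hit[of L S "{x. mass x \<le> R'} - {0}"] N2[of L] by (auto simp: L_def)
  have "min c (1 / 2) \<le> gw_prob p L x S" if "x \<in> - {0}" for x
  proof (cases "mass x \<le> R'")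
    case True
    then have "c \<le> gw_prob p L x S" using that by (intro c) auto
    then show ?thesis by simp
  next
    case False
    have "gw_prob p L x (- S) \<le> gw_prob p L x {z. mass z \<le> R}"
      using R by (intro measure_pmf.finite_measure_mono) auto
    also have "\<dots> \<le> 1 / 2" using False by (intro R') simp
    finally show ?thesis by (simp add: gw_prob_compl)
  qed
  note unif = this
  have SF: "S \<subseteq> - {0}" and cpos: "0 < min c (1 / 2)" using S(2) c(1) by auto
  show ?thesis unfolding ratio_limit_def
    using ratio_limit_of_tight[OF hereditary_nonzero SF cpos tight_of_uniform[OF unif] acc] by blast
qed

lemma survival_antimono: "gw_prob p (m + n) x (- {0}) \<le> gw_prob p m x (- {0})"
  using gw_prob_absorbed_mono[of p m x n] by (simp add: gw_prob_compl)

text \<open>Survival probabilities do not increase in time, while their successive quotients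
  converge to \<open>1 / \<rho>\<close> by the ratio limit for \<open>S = - {0}\<close>, the
  cofinite case with empty complement.\<close>

lemma perron_root_le_1: "perron_root (offspring_mean p) \<le> 1"
proof -
  obtain N where N: "\<And>n i. n \<ge> N \<Longrightarrow> 0 < gw_prob p n (axis i 1) (- {0})"
    using survival_pos by blast
  define i :: 'd where "i = undefined"
  let ?\<rho> = "perron_root (offspring_mean p)"
  have \<rho>: "0 < ?\<rho>" and u: "0 < perron_right (offspring_mean p) $ i"
    using perron_frobenius(1,3)[OF prim] by auto
  have acc: "\<exists>n. 0 < gw_prob p n x (- {0})" if "x \<noteq> 0" for x
    using that by (intro exI[of _ 0]) (simp add: indicator_def)
  have "ratio_limit (- {0})" by (rule ratio_limit_cofinite[OF _ _ acc]) auto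
  then have "(\<lambda>n. gw_prob p n (axis i 1) (- {0}) / gw_prob p (1 + n) (axis i 1) (- {0})) \<longlonglongrightarrow> 1 / ?\<rho>"
    using u unfolding ratio_limit_def
    by (elim allE[of _ "axis i 1"] allE[of _ "1::nat"])
      (simp add: axis_eq_0_iff inner_axis' less_imp_neq[THEN not_sym] del: gw_iter.simps)
  moreover have "\<forall>\<^sub>F n in sequentially. 1 \<le> gw_prob p n (axis i 1) (- {0}) / gw_prob p (1 + n) (axis i 1) (- {0})"
  proof (rule eventually_sequentiallyI[of N])
    fix n assume "N \<le> n"
    then have "0 < gw_prob p (1 + n) (axis i 1) (- {0})" by (intro N) simp
    then show "1 \<le> gw_prob p n (axis i 1) (- {0}) / gw_prob p (1 + n) (axis i 1) (- {0})"
      using survival_antimono[of n 1 "axis i 1"] by (simp add: add.commute field_simps del: gw_iter.simps)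
  qed
  ultimately have "1 \<le> 1 / ?\<rho>" by (rule tendsto_lowerbound) simp
  then show ?thesis using \<rho> by (simp add: field_simps)
qed

text \<open>In the subcritical case the population conditioned on survival is tight: a large population at
  time \<open>n\<close> would survive \<open>m\<close> further generations with probability at least \<open>1/2\<close>, whereas survival
  decays like \<open>\<rho> ^ m\<close>.\<close>

lemma ratio_limit_subcritical:
  assumes \<rho>1: "perron_root (offspring_mean p) < 1"
    and S: "0 \<notin> S" and acc: "\<And>x. x \<noteq> 0 \<Longrightarrow> \<exists>n. 0 < gw_prob p n x S"
  shows "ratio_limit S"
proof -
  define u \<rho> where "u = perron_right (offspring_mean p)" and "\<rho> = perron_root (offspring_mean p)"
  have \<rho>: "0 < \<rho>" and u: "\<And>i. 0 < u $ i" and eig: "offspring_mean p *v u = \<rho> *s u"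
    using perron_frobenius[OF prim] by (simp_all add: u_def \<rho>_def)
  have \<rho>1: "\<rho> < 1" using \<rho>1 by (simp add: \<rho>_def)
  let ?A = "\<lambda>n. hit_vec p n (- {0})" and ?s = "\<lambda>n. hit_sum p n (- {0})"
  \<comment> \<open>Here \<open>S = F\<close> and \<open>L = 0\<close>, so the comparison is only
    between different types.\<close>
  obtain C where C: "0 < C" "\<forall>\<^sub>F n in sequentially. \<forall>j. ?s n \<le> C * ?A n $ j"
    using hit_comparable[OF hereditary_nonzero zero_less_one, of 0 0 "- {0}"] by auto
  then obtain n0 where n0: "\<And>n j. n \<ge> n0 \<Longrightarrow> ?s n \<le> C * ?A n $ j"
    by (auto simp: eventually_sequentially)
  \<comment> \<open>The first factor bounds the constant vector 1 by a multiple of \<open>u\<close>,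
    the second bounds the components of \<open>u\<close> from above.\<close>
  define K where "K = (\<Sum>i\<in>UNIV. 1 / u $ i) * (\<Sum>i\<in>UNIV. u $ i)"
  have K: "0 < K" unfolding K_def using u by (intro mult_pos_pos sum_pos) auto
  have decay: "?A (m + n) $ i \<le> C * K * \<rho> ^ m * ?A n $ i" if n: "n \<ge> n0" for n m i
  proof -
    have "?A n $ j \<le> (\<Sum>i\<in>UNIV. 1 / u $ i) * ?s n * u $ j" for j
    proof -
      have "1 / u $ j \<le> (\<Sum>i\<in>UNIV. 1 / u $ i)" by (rule member_le_sum) (auto simp: less_imp_le u)
      then have "1 \<le> (\<Sum>i\<in>UNIV. 1 / u $ i) * u $ j" using u[of j] by (simp add: field_simps)
      then have "1 * ?s n \<le> (\<Sum>i\<in>UNIV. 1 / u $ i) * u $ j * ?s n" by (intro mult_right_mono hit_sum_nonneg)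
      then show ?thesis using hit_vec_le_sum[of p n "- {0}" j] by (simp add: mult_ac)
    qed
    then have "?A (m + n) $ i \<le> (\<Sum>i\<in>UNIV. 1 / u $ i) * ?s n * \<rho> ^ m * u $ i"
      by (rule hit_vec_le_eigen[OF fin hereditary_nonzero eig])
    also have "\<dots> \<le> (\<Sum>i\<in>UNIV. 1 / u $ i) * ?s n * \<rho> ^ m * (\<Sum>i\<in>UNIV. u $ i)"
      using \<rho> u by (intro mult_left_mono member_le_sum)
        (auto simp: less_imp_le intro!: mult_nonneg_nonneg sum_nonneg hit_sum_nonneg)
    also have "\<dots> = K * \<rho> ^ m * ?s n" by (simp add: K_def mult_ac)
    also have "\<dots> \<le> K * \<rho> ^ m * (C * ?A n $ i)" using \<rho> K by (intro mult_left_mono n0[OF n]) auto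
    finally show ?thesis by (simp add: mult_ac)
  qed
  obtain N1 where N1: "\<And>n i. n \<ge> N1 \<Longrightarrow> 0 < gw_prob p n (axis i 1) (- {0})"
    using survival_pos by blast
  have "(\<lambda>m. C * K * \<rho> ^ m) \<longlonglongrightarrow> 0"
    using \<rho> \<rho>1 by (intro tendsto_mult_right_zero LIMSEQ_power_zero) simp
  then have "\<forall>\<^sub>F m in sequentially. C * K * \<rho> ^ m < 1 / 4" by (rule order_tendstoD) simp
  then have "\<forall>\<^sub>F m in sequentially. m \<ge> N1 \<and> C * K * \<rho> ^ m < 1 / 4"
    using eventually_ge_at_top[of N1] by eventually_elim simp
  \<comment> \<open>Large populations at time \<open>n\<close> survive to \<open>n + m\<close> with
    probability at least 1/2, so their share among survivors is at most twice the decay factor; 1/4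
    makes this share at most 1/2.\<close>
  then obtain m where m: "m \<ge> N1" "C * K * \<rho> ^ m < 1 / 4"
    by (auto simp: eventually_sequentially)
  \<comment> \<open>The bound \<open>mass z \<le> 0\<close> expresses extinction.\<close>
  have "\<exists>R. \<forall>x. mass x \<ge> R \<longrightarrow> gw_prob p m x {z. mass z \<le> 0} \<le> 1 / 2"
    using m(1) by (intro small_mass_unlikely N1) auto
  then obtain R where R: "\<And>x. mass x \<ge> R \<Longrightarrow> gw_prob p m x {0} \<le> 1 / 2" by (auto simp: mass_eq_0_iff)
  have tightR: "1 / 2 * ?A n $ i \<le> hit_vec p n ({x. mass x \<le> R} - {0}) $ i" if n: "n \<ge> n0" for n i
  proof -
    have "1 / 2 * hit_vec p n {x. mass x > R} $ i \<le> ?A (n + m) $ i"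
      by (rule tight_of_uniform) (use R in \<open>auto simp: gw_prob_compl less_imp_le\<close>)
    also have "\<dots> \<le> C * K * \<rho> ^ m * ?A n $ i" using decay[OF n, of m i] by (simp add: add.commute)
    also have "\<dots> \<le> 1 / 4 * ?A n $ i" using m(2) by (intro mult_right_mono) auto
    finally have "hit_vec p n {x. mass x > R} $ i \<le> 1 / 2 * ?A n $ i" by simp
    moreover have "?A n $ i = hit_vec p n ({x. mass x > R} \<union> ({x. mass x \<le> R} - {0})) $ i"
      by (auto intro!: arg_cong[where f="\<lambda>B. hit_vec p n B $ i"])
    then have "?A n $ i \<le> hit_vec p n {x. mass x > R} $ i + hit_vec p n ({x. mass x \<le> R} - {0}) $ i"
      by (simp add: hit_vec_def measure_Un_le)
    ultimately show ?thesis by simp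
  qed
  obtain L where L: "\<And>n x. n \<ge> L \<Longrightarrow> x \<noteq> 0 \<Longrightarrow> 0 < gw_prob p n x S"
    using eventually_hit_pos[OF acc] by blast
  have "finite ({x. mass x \<le> R} - {0})" using finite_mass_le by blast
  then obtain c where c: "0 < c" "\<And>x. x \<in> {x. mass x \<le> R} - {0} \<Longrightarrow> c \<le> gw_prob p L x S"
    using finite_uniform_hit[OF L[OF order_refl], of "{x. mass x \<le> R} - {0}"] by auto
  have "c / 2 * ?A n $ i \<le> hit_vec p (n + L) S $ i" if n: "n \<ge> n0" for n i
  proof -
    have "c * (1 / 2 * ?A n $ i) \<le> c * hit_vec p n ({x. mass x \<le> R} - {0}) $ i"
      using c(1) by (intro mult_left_mono tightR n) auto
    also have "\<dots> \<le> hit_vec p (n + L) S $ i" by (rule tight_of_uniform[OF c(2)])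
    finally show ?thesis by simp
  qed
  note tight = this
  have SF: "S \<subseteq> - {0}" and cpos: "0 < c / 2" using S c(1) by auto
  show ?thesis unfolding ratio_limit_def
    using ratio_limit_of_tight[OF hereditary_nonzero SF cpos tight acc] by blast
qed

end

section \<open>The associated process\<close>

text \<open>Finiteness of the mean matters, because the Bochner integral of a non-integrable
  function is 0.\<close>

lemma offspring_imp_mean_pos:
  assumes "finite_offspring_mean p" "0 < pmf (p i) z" "0 < z $ j"
  shows "0 < offspring_mean p $ i $ j"
proof -
  have "0 < pmf (p i) z * real (z $ j)" using assms by simp
  also have "\<dots> = (\<integral>y. indicator {z} y * real (z $ j) \<partial>p i)" by (simp add: pmf.rep_eq)
  also have "\<dots> \<le> (\<integral>y. real (y $ j) \<partial>p i)"
    using assms(1)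
    by (intro integral_mono integrable_pmf_bounded[where c="real (z $ j)" and f="\<lambda>y. indicator {z} y * real (z $ j)"])
      (auto simp: finite_offspring_mean_def split: split_indicator)
  finally show ?thesis by (simp add: offspring_mean_def)
qed

text \<open>The detour through nonnegative integrals avoids integrability conditions: an infinite
  value turns into 0 on both sides under \<open>enn2real\<close>.\<close>

lemma integral_tilted:
  assumes t: "tilted p q p'" and f: "\<And>z. 0 \<le> f z"
  shows "q $ i * (\<integral>z. f z \<partial>p' i) = (\<integral>z. monomial q z * f z \<partial>p i)"
proof -
  have q: "0 < q $ i" for i using t by (simp add: tilted_def)
  have "(\<integral>z. f z \<partial>p' i) = enn2real (\<integral>\<^sup>+z. f z \<partial>p' i)"
    using f by (intro integral_eq_nn_integral) auto
  then have "q $ i * (\<integral>z. f z \<partial>p' i) = enn2real (ennreal (q $ i) * (\<integral>\<^sup>+z. f z \<partial>p' i))"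
    using q[of i] by (simp add: enn2real_mult)
  also have "\<dots> = enn2real (\<integral>\<^sup>+z. monomial q z * f z \<partial>p i)"
    using f monomial_nonneg[of q, OF less_imp_le[OF q]]
    by (simp add: nn_integral_tilted[OF t] ennreal_mult)
  also have "\<dots> = (\<integral>z. monomial q z * f z \<partial>p i)"
    using f monomial_nonneg[of q, OF less_imp_le[OF q]]
    by (intro integral_eq_nn_integral[symmetric]) auto
  finally show ?thesis .
qed

locale tilted_gw =
  fixes p p' :: "'d::finite \<Rightarrow> (nat ^ 'd) pmf" and q :: "real ^ 'd"
  assumes fin: "finite_offspring_mean p"
    and prim: "primitive_matrix (offspring_mean p)"
    and ext: "\<And>i. (\<lambda>n. gw_prob p n (axis i 1) {0}) \<longlonglongrightarrow> q $ i"
    and tilt: "tilted p q p'"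
begin

lemma q_pos: "0 < q $ i"
  using tilt by (simp add: tilted_def)

lemma q_le_1: "q $ i \<le> 1"
  by (rule LIMSEQ_le_const2[OF ext]) auto

lemma monomial_q: "0 \<le> monomial q z" "\<bar>monomial q z\<bar> \<le> 1"
  using monomial_nonneg[of q z] monomial_le_1[of q z] q_le_1 less_imp_le[OF q_pos] by auto

text \<open>Harmonicity of \<open>monomial q\<close> is the statement that the tilted kernel has
  total mass 1.\<close>

lemma integral_monomial_q: "(\<integral>z. monomial q z \<partial>gw_iter p n x) = monomial q x"
proof -
  have "(\<integral>\<^sup>+z. monomial q z \<partial>gw_iter p n x) = ennreal (monomial q x)"
    using nn_integral_tilted_iter[OF tilt, where x=x and n=n and g="\<lambda>_. 1"] by simp
  then show ?thesis
    by (subst integral_eq_nn_integral) (auto simp: monomial_q)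
qed

lemma integral_monomial_q_offspring: "(\<integral>z. monomial q z \<partial>p i) = q $ i"
  using integral_monomial_q[of 1 "axis i 1"] by (simp only: gw_iter_1_axis monomial_axis)

lemma finite_mean': "finite_offspring_mean p'"
  unfolding finite_offspring_mean_def
proof (intro allI)
  fix i j
  have "ennreal (q $ i) * (\<integral>\<^sup>+z. ennreal (real (z $ j)) \<partial>p' i) =
      (\<integral>\<^sup>+z. ennreal (monomial q z) * ennreal (real (z $ j)) \<partial>p i)"
    by (rule nn_integral_tilted[OF tilt])
  also have "\<dots> \<le> (\<integral>\<^sup>+z. ennreal (real (z $ j)) \<partial>p i)"
    using monomial_q by (intro nn_integral_mono)
      (auto simp: ennreal_mult[symmetric] intro!: ennreal_leI mult_left_le_one_le)
  also have "\<dots> < \<infinity>"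
    using fin by (simp add: finite_offspring_mean_def integrable_iff_bounded)
  finally have "(\<integral>\<^sup>+z. ennreal (real (z $ j)) \<partial>p' i) < \<infinity>"
    using q_pos[of i] by (auto simp: ennreal_mult_less_top)
  then show "integrable (p' i) (\<lambda>z. real (z $ j))"
    by (intro integrableI_bounded) auto
qed

text \<open>The weights are positive, so tilting preserves the supports of the offspring laws and
  with them the positive entries of the mean matrix.\<close>

lemma primitive': "primitive_matrix (offspring_mean p')"
proof -
  have step: "0 < offspring_mean p' $ i $ j" if pos: "0 < offspring_mean p $ i $ j" for i j
  proof -
    obtain z where z: "0 < pmf (p i) z" "0 < z $ j" using mean_pos_imp_offspring[OF pos] by blast
    have "0 < q $ i * pmf (p' i) z"
      using tilt z(1) monomial_pos[of q z] q_pos by (simp add: tilted_def)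
    then have "0 < pmf (p' i) z" using q_pos[of i] by (simp add: zero_less_mult_iff)
    then show ?thesis using z(2) by (rule offspring_imp_mean_pos[OF finite_mean'])
  qed
  have "0 < matrix_pow (offspring_mean p') n $ i $ j" if "0 < matrix_pow (offspring_mean p) n $ i $ j" for n i j
    using that
  proof (induction n arbitrary: i)
    case (Suc n)
    have "\<exists>k. 0 < offspring_mean p $ i $ k * matrix_pow (offspring_mean p) n $ k $ j"
    proof (rule ccontr)
      assume "\<nexists>k. 0 < offspring_mean p $ i $ k * matrix_pow (offspring_mean p) n $ k $ j"
      then have "matrix_pow (offspring_mean p) (Suc n) $ i $ j \<le> 0"
        by (auto simp: matrix_matrix_mult_def not_less intro!: sum_nonpos)
      with Suc.prems show False by simp
    qed
    then obtain k where k: "0 < offspring_mean p $ i $ k" "0 < matrix_pow (offspring_mean p) n $ k $ j"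
      using offspring_mean_nonneg[of p i] by (auto simp: zero_less_mult_iff not_less dest: leD)
    have "0 < offspring_mean p' $ i $ k * matrix_pow (offspring_mean p') n $ k $ j"
      using step[OF k(1)] Suc.IH[OF k(2)] by simp
    also have "\<dots> \<le> (\<Sum>k\<in>UNIV. offspring_mean p' $ i $ k * matrix_pow (offspring_mean p') n $ k $ j)"
      by (rule member_le_sum) (auto intro!: mult_nonneg_nonneg offspring_mean_nonneg matrix_pow_nonneg)
    finally show ?case by (simp add: matrix_matrix_mult_def)
  qed simp
  then show ?thesis using prim unfolding primitive_matrix_def by (meson offspring_mean_nonneg)
qed

sublocale assoc: extinct_gw p'
proof
  show "finite_offspring_mean p'" "primitive_matrix (offspring_mean p')"
    by (fact finite_mean' primitive')+
  show "(\<lambda>n. gw_prob p' n (axis i 1) {0}) \<longlonglongrightarrow> 1" for i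
  proof -
    have "(\<lambda>n. gw_prob p n (axis i 1) {0} / q $ i) \<longlonglongrightarrow> q $ i / q $ i"
      using q_pos[of i] by (intro tendsto_divide ext tendsto_const) auto
    moreover have "gw_prob p n (axis i 1) {0} / q $ i = gw_prob p' n (axis i 1) {0}" for n
      using gw_prob_tilted_0[OF tilt, of "axis i 1" n] q_pos[of i] by (simp add: field_simps)
    ultimately show ?thesis using q_pos[of i] by simp
  qed
qed

lemma offspring_eq_if_extinct:
  assumes "\<And>i. q $ i = 1"
  shows "p' = p"
proof -
  have "q = 1" using assms by (simp add: vec_eq_iff)
  then show ?thesis using tilt by (auto simp: tilted_def fun_eq_iff intro!: pmf_eqI)
qed

text \<open>Survival is bounded by a multiple of \<open>\<rho> ^ n\<close>, so extinction is certain
  and tilting by \<open>q = 1\<close> changes nothing.\<close>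

lemma subcritical':
  assumes "perron_root (offspring_mean p) < 1"
  shows "perron_root (offspring_mean p') < 1"
proof -
  define u \<rho> where "u = perron_right (offspring_mean p)" and "\<rho> = perron_root (offspring_mean p)"
  have \<rho>: "0 < \<rho>" "\<rho> < 1" and u: "\<And>i. 0 < u $ i" and eig: "offspring_mean p *v u = \<rho> *s u"
    using perron_frobenius[OF prim] by (simp_all add: u_def \<rho>_def assms)
  define c where "c = (\<Sum>i\<in>UNIV. 1 / u $ i)"
  have "hit_vec p 0 (- {0}) $ i \<le> c * u $ i" for i
  proof -
    have "1 / u $ i \<le> c" unfolding c_def by (rule member_le_sum) (auto simp: less_imp_le u)
    then show ?thesis using u[of i] by (simp add: hit_vec_def axis_eq_0_iff field_simps)
  qed
  then have le: "hit_vec p n (- {0}) $ i \<le> c * \<rho> ^ n * u $ i" for n i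
    using hit_vec_le_eigen[OF fin hereditary_nonzero eig, of 0 c n] by simp
  have "q $ i = 1" for i
  proof -
    have "(\<lambda>n. c * \<rho> ^ n * u $ i) \<longlonglongrightarrow> c * 0 * u $ i"
      using \<rho> by (intro tendsto_intros LIMSEQ_power_zero) auto
    then have lim0: "(\<lambda>n. c * \<rho> ^ n * u $ i) \<longlonglongrightarrow> 0" by simp
    have "(\<lambda>n. hit_vec p n (- {0}) $ i) \<longlonglongrightarrow> 0"
      by (rule Lim_null_comparison[OF _ lim0]) (simp add: le)
    then have "(\<lambda>n. 1 - gw_prob p n (axis i 1) {0}) \<longlonglongrightarrow> 0"
      by (simp add: hit_vec_def gw_prob_compl)
    moreover have "(\<lambda>n. 1 - gw_prob p n (axis i 1) {0}) \<longlonglongrightarrow> 1 - q $ i"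
      by (intro tendsto_intros ext)
    ultimately have "0 = 1 - q $ i" by (rule LIMSEQ_unique)
    then show ?thesis by simp
  qed
  then show ?thesis using offspring_eq_if_extinct assms by simp
qed

text \<open>If all \<open>q $ j\<close> were 1, then \<open>p' = p\<close> would be an extinct
  process with root above 1. One type with \<open>q $ j < 1\<close> suffices for all: by harmonicity
  \<open>1 - q $ i\<close> is the mean of \<open>1 - monomial q z\<close>, which is at least
  \<open>1 - q $ j\<close> once type \<open>j\<close> is present.\<close>

lemma q_less_1:
  assumes "1 < perron_root (offspring_mean p)"
  shows "q $ i < 1"
proof -
  have "\<exists>j. q $ j < 1"
  proof (rule ccontr)
    assume "\<nexists>j. q $ j < 1"
    then have "p' = p" using q_le_1 by (intro offspring_eq_if_extinct) (meson less_eq_real_def)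
    then show False using assoc.perron_root_le_1 assms by simp
  qed
  then obtain j where j: "q $ j < 1" by blast
  obtain N where "N \<ge> 1" and N: "\<And>n i j. n \<ge> N \<Longrightarrow> 0 < matrix_pow (offspring_mean p) n $ i $ j"
    using primitive_matrix_pow_pos[OF prim] by blast
  have "0 < (1 - q $ j) * gw_prob p N (axis i 1) {z. 0 < z $ j}"
    using j matrix_pow_pos_imp_reach[OF N[OF order_refl, of i j]] by simp
  also have "\<dots> = (\<integral>z. (1 - q $ j) * indicator {z. 0 < z $ j} z \<partial>gw_iter p N (axis i 1))" by simp
  also have "\<dots> \<le> (\<integral>z. 1 - monomial q z \<partial>gw_iter p N (axis i 1))"
  proof (rule integral_mono)
    show "integrable (gw_iter p N (axis i 1)) (\<lambda>z. (1 - q $ j) * indicator {z. 0 < z $ j} z)"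
      by (intro integrable_mult_right integrable_pmf_bounded[where c=1]) (auto split: split_indicator)
    show "integrable (gw_iter p N (axis i 1)) (\<lambda>z. 1 - monomial q z)"
      by (intro integrable_pmf_bounded[where c=1]) (use monomial_q in \<open>auto simp: abs_le_iff\<close>)
    fix z
    show "(1 - q $ j) * indicator {z. 0 < z $ j} z \<le> 1 - monomial q z"
    proof (cases "0 < z $ j")
      case True
      then obtain y where "z = axis j 1 + y" by (rule nat_vec_eq_axis_add)
      then have "monomial q z \<le> q $ j"
        using monomial_q(2)[of y] q_pos[of j] by (simp add: monomial_add abs_le_iff)
      then show ?thesis using True by simp
    qed (use monomial_q in \<open>auto simp: abs_le_iff\<close>)
  qed
  also have "\<dots> = 1 - q $ i"
    by (subst Bochner_Integration.integral_diff)
      (auto simp: integral_monomial_q intro!: integrable_pmf_bounded[where c=1] monomial_q)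
  finally show ?thesis by simp
qed

text \<open>By convexity of the generating function, \<open>w = (1 - q) / q\<close> satisfies \<open>M' w \<le> w\<close>; equality would
  force every individual to have at most one child, contradicting supercriticality.\<close>

lemma supercritical':
  assumes super: "1 < perron_root (offspring_mean p)"
  shows "perron_root (offspring_mean p') < 1"
proof -
  define w where "w = (\<chi> j. (1 - q $ j) / q $ j)"
  have w: "0 < w $ j" for j using q_pos[of j] q_less_1[OF super, of j] by (simp add: w_def)
  have qw: "q $ j * (1 + w $ j) = 1" for j using q_pos[of j] by (simp add: w_def field_simps)
  have zw: "0 \<le> real_vec z \<bullet> w" for z
    by (auto simp: real_vec_inner intro!: sum_nonneg mult_nonneg_nonneg less_imp_le[OF w])
  have zw_pos: "0 < real_vec z \<bullet> w" if z: "z \<noteq> 0" for z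
  proof -
    obtain j where "z $ j \<noteq> 0" using z by (auto simp: vec_eq_iff)
    then have "0 < real (z $ j) * w $ j" using w by simp
    also have "\<dots> \<le> real_vec z \<bullet> w"
      unfolding real_vec_inner by (rule member_le_sum) (simp_all add: less_imp_le w)
    finally show ?thesis .
  qed
  have step: "monomial q (axis i 1 + z) * (1 + real_vec (axis i 1 + z) \<bullet> w) =
      monomial q z * (1 + real_vec z \<bullet> w) - q $ i * monomial q z * (w $ i * (real_vec z \<bullet> w))" for i z
  proof -
    have "monomial q (axis i 1 + z) * (1 + real_vec (axis i 1 + z) \<bullet> w) =
        q $ i * monomial q z * (1 + w $ i + real_vec z \<bullet> w)"
      by (simp add: monomial_add real_vec_add inner_add_left inner_axis')
    also have "\<dots> = (q $ i * (1 + w $ i)) * monomial q z * (1 + real_vec z \<bullet> w)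
        - q $ i * monomial q z * (w $ i * (real_vec z \<bullet> w))" by (simp add: algebra_simps)
    finally show ?thesis by (simp add: qw)
  qed
  \<comment> \<open>Since \<open>q = 1 / (1 + w)\<close> componentwise, this is Bernoulli's
    inequality for the product of the \<open>(1 + w $ j) ^ (z $ j)\<close>; the cross term in
    \<open>step\<close> is what makes it strict for two or more individuals.\<close>
  have bern: "monomial q z * (1 + real_vec z \<bullet> w) \<le> 1" for z
  proof (induction z rule: nat_vec_induct)
    case (add i z)
    have "0 \<le> q $ i * monomial q z * (w $ i * (real_vec z \<bullet> w))"
      using zw[of z] w[of i] q_pos[of i] monomial_q(1)[of z] by simp
    then show ?case using add step[of i z] by linarith
  qed simp
  have bern_strict: "mass z \<le> 1" if "monomial q z * (1 + real_vec z \<bullet> w) = 1" for z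
  proof (rule ccontr)
    assume *: "\<not> mass z \<le> 1"
    then have "z \<noteq> 0" by auto
    then obtain i where "0 < z $ i" by (auto simp: vec_eq_iff)
    then obtain y where y: "z = axis i 1 + y" by (rule nat_vec_eq_axis_add)
    have "y \<noteq> 0" using * y by (auto simp: mass_add)
    then have "0 < q $ i * monomial q y * (w $ i * (real_vec y \<bullet> w))"
      using zw_pos[of y] w[of i] q_pos[of i] monomial_pos[of q y] q_pos by simp
    then show False using bern[of y] step[of i y] that[unfolded y] by linarith
  qed
  have int: "integrable (p i) (\<lambda>z. monomial q z * (1 + real_vec z \<bullet> w))" for i
    using bern zw monomial_q(1) by (intro integrable_pmf_bounded[where c=1]) (simp add: abs_le_iff add_nonneg_nonneg)
  have intw: "integrable (p i) (\<lambda>z. monomial q z * (real_vec z \<bullet> w))" for i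
  proof (rule integrable_pmf_bounded[where c=1])
    fix z
    have "0 \<le> monomial q z * (real_vec z \<bullet> w)" using zw monomial_q by simp
    moreover have "monomial q z * (real_vec z \<bullet> w) \<le> 1"
      using bern[of z] monomial_q(1)[of z] by (simp add: distrib_left)
    ultimately show "\<bar>monomial q z * (real_vec z \<bullet> w)\<bar> \<le> 1" by simp
  qed
  \<comment> \<open>Uses \<open>q $ i * w $ i = 1 - q $ i\<close> and that \<open>monomial q\<close>
    has mean \<open>q $ i\<close> under \<open>p i\<close>; the defect of subinvariance is the mean
    defect in Bernoulli's inequality.\<close>
  have defect: "q $ i * (w $ i - (offspring_mean p' *v w) $ i) =
      (\<integral>z. 1 - monomial q z * (1 + real_vec z \<bullet> w) \<partial>p i)" for i
  proof -
    have "q $ i * (offspring_mean p' *v w) $ i = (\<integral>z. monomial q z * (real_vec z \<bullet> w) \<partial>p i)"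
      unfolding integral_inner_offspring(2)[OF finite_mean', symmetric]
      by (rule integral_tilted[OF tilt zw])
    moreover have "(\<integral>z. 1 - monomial q z * (1 + real_vec z \<bullet> w) \<partial>p i) =
        1 - (q $ i + (\<integral>z. monomial q z * (real_vec z \<bullet> w) \<partial>p i))"
    proof -
      have "(\<integral>z. monomial q z * (1 + real_vec z \<bullet> w) \<partial>p i) = (\<integral>z. monomial q z + monomial q z * (real_vec z \<bullet> w) \<partial>p i)"
        by (simp add: distrib_left)
      also have "\<dots> = q $ i + (\<integral>z. monomial q z * (real_vec z \<bullet> w) \<partial>p i)"
        by (subst Bochner_Integration.integral_add)
          (auto simp: integral_monomial_q_offspring intro!: intw integrable_pmf_bounded[where c=1] monomial_q)
      finally show ?thesis using int[of i] by simp
    qed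
    ultimately show ?thesis using qw[of i] by (simp add: algebra_simps)
  qed
  have le: "(offspring_mean p' *v w) $ i \<le> w $ i" for i
  proof -
    have "0 \<le> q $ i * (w $ i - (offspring_mean p' *v w) $ i)"
      unfolding defect using bern by (intro Bochner_Integration.integral_nonneg) simp
    then show ?thesis using q_pos[of i] by (simp add: zero_le_mult_iff)
  qed
  have "offspring_mean p' *v w \<noteq> w"
  proof
    assume eq: "offspring_mean p' *v w = w"
    have mass1: "mass z \<le> 1" if z: "z \<in> set_pmf (p i)" for i z
    proof -
      have "(\<integral>z. 1 - monomial q z * (1 + real_vec z \<bullet> w) \<partial>p i) = 0"
        using defect[of i] by (simp add: eq)
      then have "AE z in p i. 1 - monomial q z * (1 + real_vec z \<bullet> w) = 0"
        using int[of i] bern by (subst (asm) integral_nonneg_eq_0_iff_AE) auto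
      then have "1 - monomial q z * (1 + real_vec z \<bullet> w) = 0"
        using z by (auto simp: AE_measure_pmf_iff)
      then show ?thesis by (intro bern_strict) simp
    qed
    have "(offspring_mean p *v 1) $ i \<le> (1 :: real ^ 'd) $ i" for i
    proof -
      have "(offspring_mean p *v 1) $ i = (\<integral>z. real_vec z \<bullet> 1 \<partial>p i)"
        by (simp add: integral_inner_offspring(2)[OF fin])
      also have "\<dots> \<le> (\<integral>z. 1 \<partial>p i)"
      proof (rule integral_mono_AE)
        show "AE z in p i. real_vec z \<bullet> 1 \<le> 1"
        proof (rule AE_pmfI)
          fix z assume "z \<in> set_pmf (p i)"
          then have "real (mass z) \<le> 1" using mass1[of z i] by simp
          then show "real_vec z \<bullet> 1 \<le> 1" by (simp add: real_vec_inner mass_def)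
        qed
      qed (auto intro!: integral_inner_offspring fin)
      finally show ?thesis by simp
    qed
    then have "perron_root (offspring_mean p) \<le> 1"
      by (intro perron_root_le_1_of_subinvariant[OF prim, of 1]) auto
    then show False using super by simp
  qed
  then show ?thesis by (intro perron_root_less_1_of_subinvariant[OF primitive' w le])
qed

end

section \<open>Multivariate generating functions\<close>

text \<open>Once the earlier coefficients vanish, dividing by \<open>t ^ m\<close> leaves a power
  series with value \<open>c m\<close> at 0. The hypothesis covers positive \<open>t\<close> only,
  so a right-hand limit is taken.\<close>

lemma powser_coeffs_0:
  fixes c :: "nat \<Rightarrow> real"
  assumes bdd: "\<And>n. \<bar>c n\<bar> \<le> K" and 0: "\<And>t. 0 < t \<Longrightarrow> t < 1 \<Longrightarrow> (\<lambda>n. c n * t ^ n) sums 0"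
  shows "c m = 0"
proof (induction m rule: less_induct)
  case (less m)
  define f where "f t = (\<Sum>n. c (n + m) * t ^ n)" for t
  have sm: "(\<lambda>n. c (n + m) * t ^ n) sums f t" if t: "norm t < 1" for t
    unfolding f_def
  proof (rule summable_sums, rule summable_comparison_test')
    show "summable (\<lambda>n. K * \<bar>t\<bar> ^ n)" using t by (intro summable_mult summable_geometric) simp
    show "norm (c (n + m) * t ^ n) \<le> K * \<bar>t\<bar> ^ n" for n
      using bdd[of "n + m"] by (simp add: abs_mult power_abs mult_right_mono)
  qed
  have f0: "f t = 0" if t: "0 < t" "t < 1" for t
  proof -
    have "(\<Sum>n<m. c n * t ^ n) = 0" using less by simp
    then have "(\<lambda>n. c (n + m) * t ^ (n + m)) sums 0"
      using sums_split_initial_segment[OF 0[OF t], of m] by simp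
    then have "(\<lambda>n. c (n + m) * t ^ (n + m) / t ^ m) sums (0 / t ^ m)" by (rule sums_divide)
    then have "(\<lambda>n. c (n + m) * t ^ n) sums 0" using t by (simp add: power_add)
    then show ?thesis using sm[of t] t sums_unique2 by fastforce
  qed
  have "(f \<longlongrightarrow> c (0 + m)) (at 0)"
    using sm by (intro powser_limit_0[of 1 "\<lambda>n. c (n + m)"]) auto
  then have "(f \<longlongrightarrow> c m) (at_right 0)" by (simp add: filterlim_at_split)
  moreover have "\<forall>\<^sub>F t in at_right 0. f t = 0"
    using eventually_at_right_real[of 0 1] by (auto elim: eventually_mono simp: f0)
  ultimately have "((\<lambda>_. 0) \<longlongrightarrow> c m) (at_right (0 :: real))"
    by (rule Lim_transform_eventually)
  then show ?case by (simp add: tendsto_const_iff)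
qed

lemma integral_power_sums:
  fixes \<phi> :: "'a \<Rightarrow> real" and \<kappa> :: "'a \<Rightarrow> nat"
  assumes \<phi>: "\<And>k. \<bar>\<phi> k\<bar> \<le> 1" and t: "0 < t" "t < 1"
  shows "(\<lambda>m. (\<integral>k. \<phi> k * of_bool (\<kappa> k = m) \<partial>measure_pmf A) * t ^ m) sums (\<integral>k. \<phi> k * t ^ \<kappa> k \<partial>measure_pmf A)"
proof -
  have single: "(\<lambda>m. g m * of_bool (\<kappa> k = m)) sums g (\<kappa> k)" for g :: "nat \<Rightarrow> real" and k
  proof -
    have "(\<lambda>m. g m * of_bool (\<kappa> k = m)) = (\<lambda>m. if m = \<kappa> k then g m else 0)" by auto
    then show ?thesis using sums_single[of "\<kappa> k" g] by simp
  qed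
  have "(\<lambda>m. \<integral>k. \<phi> k * of_bool (\<kappa> k = m) * t ^ m \<partial>measure_pmf A) sums
      (\<integral>k. (\<Sum>m. \<phi> k * of_bool (\<kappa> k = m) * t ^ m) \<partial>measure_pmf A)"
  proof (rule sums_integral)
    show "integrable (measure_pmf A) (\<lambda>k. \<phi> k * of_bool (\<kappa> k = m) * t ^ m)" for m
      using \<phi> by (intro integrable_mult_left integrable_pmf_bounded[where c=1]) (auto simp: of_bool_def)
    show "AE k in measure_pmf A. summable (\<lambda>m. norm (\<phi> k * of_bool (\<kappa> k = m) * t ^ m))"
    proof (intro AE_I2)
      fix k
      show "summable (\<lambda>m. norm (\<phi> k * of_bool (\<kappa> k = m) * t ^ m))"
        by (rule summable_finite[of "{\<kappa> k}"]) auto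
    qed
    show "summable (\<lambda>m. \<integral>k. norm (\<phi> k * of_bool (\<kappa> k = m) * t ^ m) \<partial>measure_pmf A)"
    proof (rule summable_comparison_test')
      show "summable (\<lambda>m. t ^ m)" using t by (intro summable_geometric) simp
      fix m
      have "(\<integral>k. norm (\<phi> k * of_bool (\<kappa> k = m) * t ^ m) \<partial>measure_pmf A) \<le> (\<integral>k. t ^ m \<partial>measure_pmf A)"
      proof (rule integral_mono)
        have *: "norm (\<phi> k * of_bool (\<kappa> k = m) * t ^ m) \<le> t ^ m" for k
          using \<phi>[of k] t by (simp add: abs_mult of_bool_def mult_left_le_one_le)
        then show "norm (\<phi> k * of_bool (\<kappa> k = m) * t ^ m) \<le> t ^ m" for k .
        show "integrable (measure_pmf A) (\<lambda>k. norm (\<phi> k * of_bool (\<kappa> k = m) * t ^ m))"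
          using * by (intro integrable_pmf_bounded[where c="t ^ m"]) auto
      qed simp
      then show "norm (\<integral>k. norm (\<phi> k * of_bool (\<kappa> k = m) * t ^ m) \<partial>measure_pmf A) \<le> t ^ m" by simp
    qed
  qed
  moreover have "(\<Sum>m. \<phi> k * of_bool (\<kappa> k = m) * t ^ m) = \<phi> k * t ^ \<kappa> k" for k
    using single[of "\<lambda>m. \<phi> k * t ^ m" k] by (simp add: sums_iff mult_ac)
  ultimately show ?thesis by simp
qed

text \<open>The coordinates are extracted one at a time, by uniqueness of power series in one variable.\<close>

lemma weighted_gf_unique:
  fixes A B :: "(nat ^ 'd) pmf" and f g :: "nat ^ 'd \<Rightarrow> real"
  assumes f: "\<And>k. \<bar>f k\<bar> \<le> 1" and g: "\<And>k. \<bar>g k\<bar> \<le> 1"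
    and eq: "\<And>r. (\<And>j. r $ j \<in> {0..1}) \<Longrightarrow>
      (\<integral>k. f k * monomial r k \<partial>measure_pmf A) = (\<integral>k. g k * monomial r k \<partial>measure_pmf B)"
  shows "f z * pmf A z = g z * pmf B z"
proof -
  \<comment> \<open>Interpolates between \<open>monomial r\<close> for empty \<open>J\<close> and
    the indicator of \<open>z\<close> for \<open>J = UNIV\<close>, where \<open>r\<close> no longer
    enters.\<close>
  define \<psi> where "\<psi> J r k = (\<Prod>j\<in>J. of_bool (k $ j = z $ j)) * (\<Prod>j\<in>-J. r $ j ^ (k $ j))"
    for J and r :: "real ^ 'd" and k :: "nat ^ 'd"
  have "(\<integral>k. f k * \<psi> J r k \<partial>measure_pmf A) = (\<integral>k. g k * \<psi> J r k \<partial>measure_pmf B)"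
    if "finite J" "\<And>j. r $ j \<in> {0..1}" for J r
    using that
  proof (induction J arbitrary: r rule: finite_induct)
    case empty
    have "\<psi> {} r k = monomial r k" for k by (simp add: \<psi>_def monomial_def)
    then show ?case using eq[OF empty] by simp
  next
    case (insert j0 J)
    define w where "w k = (\<Prod>j\<in>J. of_bool (k $ j = z $ j)) * (\<Prod>j\<in>-insert j0 J. r $ j ^ (k $ j))"
      for k :: "nat ^ 'd"
    have comp: "- J = insert j0 (- insert j0 J)" using insert by auto
    have w1: "\<bar>w k\<bar> \<le> 1" for k
    proof -
      have "0 \<le> (\<Prod>j\<in>J. of_bool (k $ j = z $ j) :: real)" "(\<Prod>j\<in>J. of_bool (k $ j = z $ j) :: real) \<le> 1"
        by (auto intro!: prod_nonneg prod_le_1)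
      moreover have "0 \<le> (\<Prod>j\<in>-insert j0 J. r $ j ^ (k $ j))" "(\<Prod>j\<in>-insert j0 J. r $ j ^ (k $ j)) \<le> 1"
        using insert(4) by (auto intro!: prod_nonneg prod_le_1 power_le_one)
      ultimately show ?thesis by (simp add: w_def abs_mult mult_le_one)
    qed
    have \<psi>_t: "\<psi> J (\<chi> j. if j = j0 then t else r $ j) k = w k * t ^ (k $ j0)" for t k
    proof -
      have "(\<Prod>j\<in>-insert j0 J. (if j = j0 then t else r $ j) ^ (k $ j)) = (\<Prod>j\<in>-insert j0 J. r $ j ^ (k $ j))"
        by (rule prod.cong) auto
      then show ?thesis unfolding \<psi>_def w_def by (simp add: comp mult_ac)
    qed
    have \<psi>_ins: "\<psi> (insert j0 J) r k = w k * of_bool (k $ j0 = z $ j0)" for k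
      using insert(1,2) by (simp add: \<psi>_def w_def mult_ac)
    define a where "a m = (\<integral>k. f k * w k * of_bool (k $ j0 = m) \<partial>measure_pmf A)" for m
    define b where "b m = (\<integral>k. g k * w k * of_bool (k $ j0 = m) \<partial>measure_pmf B)" for m
    have fw: "\<bar>f k * w k\<bar> \<le> 1" and gw: "\<bar>g k * w k\<bar> \<le> 1" for k
      using f[of k] g[of k] w1[of k] by (auto simp: abs_mult intro: mult_le_one)
    have bound: "\<bar>\<integral>k. h k * of_bool (k $ j0 = m) \<partial>measure_pmf D\<bar> \<le> 1"
      if h: "\<And>k. \<bar>h k\<bar> \<le> (1 :: real)" for h m and D :: "(nat ^ 'd) pmf"
    proof -
      have le: "\<bar>h k * of_bool (k $ j0 = m)\<bar> \<le> 1" for k using h[of k] by (simp add: of_bool_def)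
      have "norm (\<integral>k. h k * of_bool (k $ j0 = m) \<partial>measure_pmf D)
          \<le> (\<integral>k. \<bar>h k * of_bool (k $ j0 = m)\<bar> \<partial>measure_pmf D)"
        using integral_norm_bound[of "measure_pmf D" "\<lambda>k. h k * of_bool (k $ j0 = m)"] by simp
      also have "\<dots> \<le> (\<integral>k. 1 \<partial>measure_pmf D)"
        by (intro integral_mono integrable_pmf_bounded[where c=1] le) (simp_all add: le)
      finally have "norm (\<integral>k. h k * of_bool (k $ j0 = m) \<partial>measure_pmf D) \<le> (\<integral>k. 1 \<partial>measure_pmf D)" .
      then show ?thesis by simp
    qed
    \<comment> \<open>The induction hypothesis, with the \<open>j0\<close> component of
      \<open>r\<close> replaced by a free \<open>t\<close>, equates two power series in
      \<open>t\<close>; the coefficient of order \<open>z $ j0\<close> is extracted.\<close>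
    have "a (z $ j0) - b (z $ j0) = 0"
    proof (rule powser_coeffs_0[where c="\<lambda>m. a m - b m" and K=2])
      show "\<bar>a m - b m\<bar> \<le> 2" for m
        using bound[where h="\<lambda>k. f k * w k" and D=A and m=m, OF fw]
          bound[where h="\<lambda>k. g k * w k" and D=B and m=m, OF gw] by (simp add: a_def b_def abs_le_iff)
      fix t :: real assume t: "0 < t" "t < 1"
      have "(\<lambda>m. a m * t ^ m - b m * t ^ m) sums
          ((\<integral>k. f k * w k * t ^ (k $ j0) \<partial>measure_pmf A) - (\<integral>k. g k * w k * t ^ (k $ j0) \<partial>measure_pmf B))"
        unfolding a_def b_def by (intro sums_diff integral_power_sums fw gw t)
      moreover have "(\<integral>k. f k * \<psi> J (\<chi> j. if j = j0 then t else r $ j) k \<partial>measure_pmf A) =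
          (\<integral>k. g k * \<psi> J (\<chi> j. if j = j0 then t else r $ j) k \<partial>measure_pmf B)"
        using insert(4) t by (intro insert.IH) auto
      ultimately show "(\<lambda>m. (a m - b m) * t ^ m) sums 0"
        by (simp add: \<psi>_t left_diff_distrib mult.assoc)
    qed
    then show ?case by (simp add: \<psi>_ins a_def b_def mult.assoc)
  qed
  note this[of UNIV 1]
  moreover have "\<psi> UNIV 1 k = indicator {z} k" for k
    by (auto simp: \<psi>_def indicator_def vec_eq_iff)
  ultimately have "(\<integral>k. f k * indicator {z} k \<partial>measure_pmf A) = (\<integral>k. g k * indicator {z} k \<partial>measure_pmf B)"
    by simp
  moreover have "(\<integral>k. h k * indicator {z} k \<partial>measure_pmf D) = h z * pmf D z"
    for h :: "nat ^ 'd \<Rightarrow> real" and D :: "(nat ^ 'd) pmf"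
    by (subst integral_measure_pmf[of "{z}"]) (auto split: split_indicator_asm)
  ultimately show ?thesis by simp
qed

lemma offspring_gf_eq_integral:
  assumes r: "\<And>j. r $ j \<in> {0..1}"
  shows "offspring_gf p i r = (\<integral>z. monomial r z \<partial>p i)"
proof -
  have r1: "0 \<le> monomial r z" "monomial r z \<le> 1" for z
    using r by (auto intro!: monomial_nonneg monomial_le_1)
  have "Infinite_Set_Sum.abs_summable_on (\<lambda>z. pmf (p i) z * monomial r z) UNIV"
    by (rule Infinite_Set_Sum.abs_summable_on_comparison_test'[OF pmf_abs_summable[of "p i" UNIV]])
      (use r1 in \<open>auto simp: abs_mult intro!: mult_left_le\<close>)
  from infsetsum_infsum[OF this] show ?thesis
    by (simp add: offspring_gf_def pmf_expectation_eq_infsetsum monomial_def)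
qed

text \<open>As \<open>q\<close> is a fixed point of the offspring generating function, the
  normalising denominator is \<open>q $ i\<close>; comparing coefficients gives the tilt.\<close>

lemma tilted_of_associated:
  assumes assoc: "associated_offspring p q p'"
    and q: "\<And>i. 0 < q $ i" "\<And>i. q $ i \<le> 1"
    and fixpoint: "\<And>i. (\<integral>z. monomial q z \<partial>p i) = q $ i"
  shows "tilted p q p'"
  unfolding tilted_def
proof (intro conjI allI)
  fix i z
  show "q $ i * pmf (p' i) z = monomial q z * pmf (p i) z"
  proof (rule weighted_gf_unique)
    show "\<bar>q $ i\<bar> \<le> 1" using q[of i] by simp
    show "\<bar>monomial q k\<bar> \<le> 1" for k
      using monomial_nonneg[of q k, OF less_imp_le[OF q(1)]]
        monomial_le_1[of q k, OF less_imp_le[OF q(1)] q(2)] by simp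
    fix r :: "real ^ 'a" assume r: "\<And>j. r $ j \<in> {0..1}"
    have qr: "(q * r) $ j \<in> {0..1}" for j
      using q[of j] r[of j] by (auto intro: mult_le_one)
    have q01: "q $ j \<in> {0..1}" for j using q[of j] by auto
    have "offspring_gf p' i r = offspring_gf p i (q * r) / offspring_gf p i q"
      using assoc r by (simp add: associated_offspring_def)
    then have "(\<integral>k. monomial r k \<partial>p' i) = (\<integral>k. monomial q k * monomial r k \<partial>p i) / q $ i"
      by (simp add: offspring_gf_eq_integral[OF r] offspring_gf_eq_integral[OF qr]
          offspring_gf_eq_integral[OF q01] monomial_mult_left fixpoint)
    then show "(\<integral>k. q $ i * monomial r k \<partial>p' i) = (\<integral>k. monomial q k * monomial r k \<partial>p i)"
      using q(1)[of i] by simp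
  qed
qed (rule q)

section \<open>The process and its transition probabilities\<close>

lemma extinction_time_finite_iff: "extinction_time X \<omega> < \<infinity> \<longleftrightarrow> (\<exists>k. X k \<omega> = 0)"
  unfolding extinction_time_def INF_less_iff by auto

text \<open>The finite-dimensional events of the theorem leave intermediate generations free, so
  single paths do not suffice. Prescribing the state \<open>v\<close> at time \<open>m\<close> makes
  the Markov property a plain product.\<close>

definition past_event :: "nat \<Rightarrow> nat ^ 'd \<Rightarrow> ((nat \<Rightarrow> nat ^ 'd) \<Rightarrow> bool) \<Rightarrow> bool" where
  "past_event m v E \<longleftrightarrow>
     (\<forall>y y'. (\<forall>k\<le>m. y k = y' k) \<longrightarrow> E y = E y') \<and> (\<forall>y. E y \<longrightarrow> y m = v)"

locale gw_chain =
  fixes p :: "'d::finite \<Rightarrow> (nat ^ 'd) pmf" and P :: "nat ^ 'd \<Rightarrow> 'w measure"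
    and X :: "nat \<Rightarrow> 'w \<Rightarrow> nat ^ 'd"
  assumes process: "gw_process p P X"
begin

sublocale prob_space "P x" for x
  using process by (simp add: gw_process_def)

lemma X_measurable [measurable]: "X k \<in> measurable (P x) (count_space UNIV)"
  using process by (simp add: gw_process_def)

lemma path_prob:
  "\<P>(\<omega> in P x. \<forall>k\<le>n. X k \<omega> = y k) =
     (if y 0 = x then \<Prod>k<n. pmf (gw_step p (y k)) (y (Suc k)) else 0)"
  using process by (simp add: gw_process_def)

lemma path_prob_Suc:
  "\<P>(\<omega> in P x. \<forall>k\<le>Suc m. X k \<omega> = (y(Suc m := w)) k) =
     \<P>(\<omega> in P x. \<forall>k\<le>m. X k \<omega> = y k) * pmf (gw_step p (y m)) w"
  unfolding path_prob by simp

text \<open>The state at time \<open>Suc m\<close> is summed out and appended to the path; hence the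
  induction over \<open>n\<close> keeps \<open>m\<close> and \<open>y\<close> free.\<close>

lemma markov_path:
  "\<P>(\<omega> in P x. (\<forall>k\<le>m. X k \<omega> = y k) \<and> X (m + n) \<omega> = z) =
     \<P>(\<omega> in P x. \<forall>k\<le>m. X k \<omega> = y k) * pmf (gw_iter p n (y m)) z"
proof (induction n arbitrary: m y)
  case 0
  show ?case
  proof (cases "y m = z")
    case True
    then have "(\<forall>k\<le>m. X k \<omega> = y k) \<and> X (m + 0) \<omega> = z \<longleftrightarrow> (\<forall>k\<le>m. X k \<omega> = y k)" for \<omega> by auto
    then show ?thesis using True by simp
  next
    case False
    then have "{\<omega>\<in>space (P x). (\<forall>k\<le>m. X k \<omega> = y k) \<and> X (m + 0) \<omega> = z} = {}" by auto
    then show ?thesis using False by (simp only: measure_empty) simp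
  qed
next
  case (Suc n)
  define D where "D w = {\<omega>\<in>space (P x). (\<forall>k\<le>Suc m. X k \<omega> = (y(Suc m := w)) k) \<and> X (Suc m + n) \<omega> = z}" for w
  have [measurable]: "D w \<in> sets (P x)" for w unfolding D_def by measurable
  have "{\<omega>\<in>space (P x). (\<forall>k\<le>m. X k \<omega> = y k) \<and> X (m + Suc n) \<omega> = z} = (\<Union>w. D w)"
    by (auto simp: D_def le_Suc_eq)
  then have "emeasure (P x) {\<omega>\<in>space (P x). (\<forall>k\<le>m. X k \<omega> = y k) \<and> X (m + Suc n) \<omega> = z} =
      (\<integral>\<^sup>+w. emeasure (P x) (D w) \<partial>count_space UNIV)"
    by (simp only:) (rule emeasure_UN_countable, auto simp: disjoint_family_on_def D_def dest: spec[of _ "Suc m"])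
  also have "\<dots> = (\<integral>\<^sup>+w. ennreal \<P>(\<omega> in P x. \<forall>k\<le>m. X k \<omega> = y k) *
      (ennreal (pmf (gw_step p (y m)) w) * ennreal (pmf (gw_iter p n w) z)) \<partial>count_space UNIV)"
  proof (rule nn_integral_cong)
    fix w
    have "emeasure (P x) (D w) = ennreal (\<P>(\<omega> in P x. \<forall>k\<le>m. X k \<omega> = y k) * pmf (gw_step p (y m)) w * pmf (gw_iter p n w) z)"
      unfolding emeasure_eq_measure D_def Suc path_prob_Suc by simp
    then show "emeasure (P x) (D w) = ennreal \<P>(\<omega> in P x. \<forall>k\<le>m. X k \<omega> = y k) *
      (ennreal (pmf (gw_step p (y m)) w) * ennreal (pmf (gw_iter p n w) z))"
      by (simp add: ennreal_mult mult.assoc)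
  qed
  also have "\<dots> = ennreal \<P>(\<omega> in P x. \<forall>k\<le>m. X k \<omega> = y k) * ennreal (pmf (gw_iter p (Suc n) (y m)) z)"
    by (simp add: nn_integral_cmult ennreal_pmf_bind nn_integral_measure_pmf)
  finally show ?case unfolding emeasure_eq_measure
    by (simp add: ennreal_mult[symmetric] del: gw_iter.simps)
qed

text \<open>The event splits into countably many paths. Taking them from the extensional function
  space over \<open>{..m}\<close> lists each path once, which gives disjointness. \<open>R\<close>
  stands for a condition on the future.\<close>

lemma emeasure_past_event:
  assumes E: "past_event m v E" and R [measurable]: "{\<omega>\<in>space (P x). R \<omega>} \<in> sets (P x)"
  shows "emeasure (P x) {\<omega>\<in>space (P x). E (\<lambda>k. X k \<omega>) \<and> R \<omega>} =
    (\<integral>\<^sup>+y. emeasure (P x) {\<omega>\<in>space (P x). (\<forall>k\<le>m. X k \<omega> = y k) \<and> R \<omega>}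
      \<partial>count_space {y \<in> {..m} \<rightarrow>\<^sub>E UNIV. E y})"
    (is "_ = (\<integral>\<^sup>+y. emeasure _ (?D y) \<partial>count_space ?I)")
    and "{\<omega>\<in>space (P x). E (\<lambda>k. X k \<omega>)} \<in> sets (P x)"
proof -
  have dep: "E y = E y'" if "\<And>k. k \<le> m \<Longrightarrow> y k = y' k" for y y'
    using E that by (auto simp: past_event_def)
  have count: "countable ?I"
    by (rule countable_subset[OF _ countable_PiE[of "{..m}" "\<lambda>_. UNIV"]]) auto
  have UN: "{\<omega>\<in>space (P x). E (\<lambda>k. X k \<omega>) \<and> R \<omega>} = (\<Union>y\<in>?I. {\<omega>\<in>space (P x). (\<forall>k\<le>m. X k \<omega> = y k) \<and> R \<omega>})" for R
  proof (intro set_eqI iffI)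
    fix \<omega> assume \<omega>: "\<omega> \<in> {\<omega>\<in>space (P x). E (\<lambda>k. X k \<omega>) \<and> R \<omega>}"
    define y where "y = restrict (\<lambda>k. X k \<omega>) {..m}"
    have "E y = E (\<lambda>k. X k \<omega>)" by (rule dep) (simp add: y_def)
    then have "y \<in> ?I" using \<omega> by (simp add: y_def)
    moreover have "\<omega> \<in> {\<omega>\<in>space (P x). (\<forall>k\<le>m. X k \<omega> = y k) \<and> R \<omega>}" using \<omega> by (simp add: y_def)
    ultimately show "\<omega> \<in> (\<Union>y\<in>?I. {\<omega>\<in>space (P x). (\<forall>k\<le>m. X k \<omega> = y k) \<and> R \<omega>})" by blast
  next
    fix \<omega> assume "\<omega> \<in> (\<Union>y\<in>?I. {\<omega>\<in>space (P x). (\<forall>k\<le>m. X k \<omega> = y k) \<and> R \<omega>})"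
    then obtain y where y: "E y" "\<omega> \<in> space (P x)" "\<And>k. k \<le> m \<Longrightarrow> X k \<omega> = y k" "R \<omega>" by auto
    then have "E (\<lambda>k. X k \<omega>)" using dep[of "\<lambda>k. X k \<omega>" y] by simp
    then show "\<omega> \<in> {\<omega>\<in>space (P x). E (\<lambda>k. X k \<omega>) \<and> R \<omega>}" using y by simp
  qed
  show "emeasure (P x) {\<omega>\<in>space (P x). E (\<lambda>k. X k \<omega>) \<and> R \<omega>} = (\<integral>\<^sup>+y. emeasure (P x) (?D y) \<partial>count_space ?I)"
    unfolding UN
  proof (rule emeasure_UN_countable[OF _ count])
    show "disjoint_family_on ?D ?I"
      unfolding disjoint_family_on_def
    proof (intro ballI impI)
      fix y y' assume y: "y \<in> ?I" "y' \<in> ?I" "y \<noteq> y'"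
      then have "y \<in> extensional {..m}" "y' \<in> extensional {..m}" by (auto simp: PiE_def)
      then obtain k where "k \<le> m" "y k \<noteq> y' k" using y(3) extensionalityI[of y "{..m}" y'] by auto
      then show "?D y \<inter> ?D y' = {}" by auto
    qed
  qed measurable
  have "{\<omega>\<in>space (P x). E (\<lambda>k. X k \<omega>) \<and> True} \<in> sets (P x)"
    unfolding UN by (intro sets.countable_UN'' count) measurable
  then show "{\<omega>\<in>space (P x). E (\<lambda>k. X k \<omega>)} \<in> sets (P x)" by simp
qed

lemma markov:
  assumes E: "past_event m v E"
  shows "\<P>(\<omega> in P x. E (\<lambda>k. X k \<omega>) \<and> X (m + n) \<omega> = z) =
    \<P>(\<omega> in P x. E (\<lambda>k. X k \<omega>)) * pmf (gw_iter p n v) z"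
proof -
  let ?I = "{y \<in> {..m} \<rightarrow>\<^sub>E UNIV. E y}"
  have "emeasure (P x) {\<omega>\<in>space (P x). E (\<lambda>k. X k \<omega>) \<and> X (m + n) \<omega> = z} =
    (\<integral>\<^sup>+y. emeasure (P x) {\<omega>\<in>space (P x). (\<forall>k\<le>m. X k \<omega> = y k) \<and> X (m + n) \<omega> = z} \<partial>count_space ?I)"
    by (rule emeasure_past_event[OF E]) measurable
  also have "\<dots> = (\<integral>\<^sup>+y. emeasure (P x) {\<omega>\<in>space (P x). (\<forall>k\<le>m. X k \<omega> = y k) \<and> True} *
      ennreal (pmf (gw_iter p n v) z) \<partial>count_space ?I)"
  proof (rule nn_integral_cong)
    fix y assume "y \<in> space (count_space ?I)"
    then have "y m = v" using E by (auto simp: past_event_def)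
    then show "emeasure (P x) {\<omega>\<in>space (P x). (\<forall>k\<le>m. X k \<omega> = y k) \<and> X (m + n) \<omega> = z} =
      emeasure (P x) {\<omega>\<in>space (P x). (\<forall>k\<le>m. X k \<omega> = y k) \<and> True} * ennreal (pmf (gw_iter p n v) z)"
      using markov_path[of x m y n z] by (simp add: emeasure_eq_measure ennreal_mult)
  qed
  also have "\<dots> = emeasure (P x) {\<omega>\<in>space (P x). E (\<lambda>k. X k \<omega>) \<and> True} * ennreal (pmf (gw_iter p n v) z)"
    by (subst emeasure_past_event[OF E]) (simp_all add: nn_integral_multc)
  finally show ?thesis by (simp add: emeasure_eq_measure ennreal_mult[symmetric])
qed

lemma start_prob: "\<P>(\<omega> in P x. X 0 \<omega> = x) = 1"
  using path_prob[of x 0 "\<lambda>_. x"] by simp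

lemma AE_start: "AE \<omega> in P x. X 0 \<omega> = x"
  using start_prob[of x] by (subst (asm) prob_Collect_eq_1) auto

lemma past_event_start: "past_event 0 x (\<lambda>y. y 0 = x)"
  by (simp add: past_event_def)

text \<open>An abstract process may leave 0 on a null set of outcomes, so absorption holds only
  almost surely.\<close>

lemma AE_absorbed: "AE \<omega> in P x. \<forall>k. X k \<omega> = 0 \<longrightarrow> X (Suc k) \<omega> = 0"
proof -
  have "AE \<omega> in P x. \<not> (X k \<omega> = 0 \<and> X (Suc k) \<omega> = z)" if z: "z \<noteq> 0" for k and z :: "nat ^ 'd"
  proof -
    have "past_event k 0 (\<lambda>y. y k = 0)" by (simp add: past_event_def)
    from markov[OF this, of x 1 z] have "\<P>(\<omega> in P x. X k \<omega> = 0 \<and> X (Suc k) \<omega> = z) = 0"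
      using z unfolding Suc_eq_plus1 by (simp del: gw_iter.simps)
    then show ?thesis by (subst (asm) prob_Collect_eq_0) auto
  qed
  then have "AE \<omega> in P x. \<forall>k z. z \<noteq> 0 \<longrightarrow> \<not> (X k \<omega> = 0 \<and> X (Suc k) \<omega> = z)"
    unfolding AE_all_countable by auto
  then show ?thesis by eventually_elim auto
qed

lemma AE_absorbed': "AE \<omega> in P x. \<forall>k l. X k \<omega> = 0 \<longrightarrow> k \<le> l \<longrightarrow> X l \<omega> = 0"
  using AE_absorbed
proof eventually_elim
  case (elim \<omega>)
  have "X k \<omega> = 0 \<Longrightarrow> X (k + n) \<omega> = 0" for k n
    using elim by (induction n) auto
  then show ?case by (metis le_iff_add)
qed

lemma absorption_limit:
  assumes E: "past_event m v E"
  shows "(\<lambda>n. \<P>(\<omega> in P x. E (\<lambda>k. X k \<omega>)) * gw_prob p n v {0}) \<longlonglongrightarrow>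
    \<P>(\<omega> in P x. E (\<lambda>k. X k \<omega>) \<and> extinction_time X \<omega> < \<infinity>)"
proof -
  have [measurable]: "{\<omega>\<in>space (P x). E (\<lambda>k. X k \<omega>)} \<in> sets (P x)"
    by (rule emeasure_past_event(2)[OF E, of _ "\<lambda>_. True"]) simp
  \<comment> \<open>Asking for some visit to 0 up to \<open>n\<close> makes these events increase
    for every outcome; they agree with \<open>X (m + n) \<omega> = 0\<close> only almost
    surely.\<close>
  define D where "D n = {\<omega>\<in>space (P x). E (\<lambda>k. X k \<omega>) \<and> (\<exists>l\<le>n. X (m + l) \<omega> = 0)}" for n
  have [measurable]: "D n \<in> sets (P x)" for n unfolding D_def by measurable
  have "(\<lambda>n. measure (P x) (D n)) \<longlonglongrightarrow> measure (P x) (\<Union>n. D n)"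
  proof (rule finite_Lim_measure_incseq)
    show "incseq D" by (rule monoI) (auto simp: D_def intro: order_trans)
  qed auto
  moreover have "measure (P x) (\<Union>n. D n) = \<P>(\<omega> in P x. E (\<lambda>k. X k \<omega>) \<and> extinction_time X \<omega> < \<infinity>)"
  proof (rule finite_measure_eq_AE)
    show "AE \<omega> in P x. (\<omega> \<in> (\<Union>n. D n)) = (\<omega> \<in> {\<omega>\<in>space (P x). E (\<lambda>k. X k \<omega>) \<and> extinction_time X \<omega> < \<infinity>})"
      using AE_absorbed' 
    proof eventually_elim
      case (elim \<omega>)
      have "(\<exists>k. X k \<omega> = 0) \<longleftrightarrow> (\<exists>l. X (m + l) \<omega> = 0)" using elim by (metis le_add1 add.commute)
      then show ?case unfolding D_def extinction_time_finite_iff by auto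
    qed
  qed (unfold extinction_time_finite_iff, measurable)
  moreover have "measure (P x) (D n) = \<P>(\<omega> in P x. E (\<lambda>k. X k \<omega>)) * gw_prob p n v {0}" for n
  proof -
    have "measure (P x) (D n) = \<P>(\<omega> in P x. E (\<lambda>k. X k \<omega>) \<and> X (m + n) \<omega> = 0)"
    proof (rule finite_measure_eq_AE)
      show "AE \<omega> in P x. (\<omega> \<in> D n) = (\<omega> \<in> {\<omega>\<in>space (P x). E (\<lambda>k. X k \<omega>) \<and> X (m + n) \<omega> = 0})"
        using AE_absorbed' by eventually_elim (auto simp: D_def)
    qed measurable
    then show ?thesis by (simp add: markov[OF E] pmf.rep_eq)
  qed
  ultimately show ?thesis by simp
qed

lemma distr_X: "distr (P x) (count_space UNIV) (X n) = measure_pmf (gw_iter p n x)"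
proof (rule measure_eqI_countable[of _ UNIV])
  fix z :: "nat ^ 'd"
  have "emeasure (distr (P x) (count_space UNIV) (X n)) {z} = emeasure (P x) {\<omega>\<in>space (P x). X n \<omega> = z}"
    by (subst emeasure_distr) (auto intro!: arg_cong[where f="emeasure (P x)"])
  \<comment> \<open>Adding the almost sure event \<open>X 0 \<omega> = x\<close> supplies a past of
    length 0 to which \<open>markov\<close> applies.\<close>
  also have "\<dots> = emeasure (P x) {\<omega>\<in>space (P x). X 0 \<omega> = x \<and> X (0 + n) \<omega> = z}"
    using AE_start[of x] by (intro emeasure_eq_AE) auto
  also have "\<dots> = emeasure (gw_iter p n x) {z}"
    unfolding emeasure_eq_measure markov[OF past_event_start, of x x n z] start_prob
    by (simp add: emeasure_pmf_single)
  finally show "emeasure (distr (P x) (count_space UNIV) (X n)) {z} = emeasure (measure_pmf (gw_iter p n x)) {z}" .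
qed auto

lemma prob_X: "\<P>(\<omega> in P x. X n \<omega> \<in> B) = gw_prob p n x B"
  unfolding distr_X[symmetric] by (subst measure_distr) (auto intro!: arg_cong[where f="measure (P x)"])

lemma mean_matrix_eq: "mean_matrix P X = offspring_mean p"
proof -
  have "(\<integral>\<omega>. real (X 1 \<omega> $ j) \<partial>P (axis i 1)) = (\<integral>z. real (z $ j) \<partial>p i)" for i j
    using integral_distr[of "X 1" "P (axis i 1)" "count_space UNIV" "\<lambda>z. real (z $ j)"]
    unfolding distr_X gw_iter_1_axis by simp
  then show ?thesis by (simp add: mean_matrix_def offspring_mean_def)
qed

lemma finite_means_iff: "finite_means P X \<longleftrightarrow> finite_offspring_mean p"
proof -
  have "integrable (P (axis i 1)) (\<lambda>\<omega>. real (X 1 \<omega> $ j)) \<longleftrightarrow> integrable (p i) (\<lambda>z. real (z $ j))" for i j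
    using integrable_distr_eq[of "X 1" "P (axis i 1)" "count_space UNIV" "\<lambda>z. real (z $ j)"]
    unfolding distr_X gw_iter_1_axis by simp
  then show ?thesis by (simp add: finite_means_def finite_offspring_mean_def)
qed

lemma extinction_prob_limit: "(\<lambda>n. gw_prob p n (axis i 1) {0}) \<longlonglongrightarrow> extinction_prob P X $ i"
proof -
  have "\<P>(\<omega> in P x. X 0 \<omega> = x \<and> extinction_time X \<omega> < \<infinity>) = \<P>(\<omega> in P x. extinction_time X \<omega> < \<infinity>)" for x
    unfolding extinction_time_finite_iff
    by (rule finite_measure_eq_AE) (use AE_start[of x] in \<open>eventually_elim, auto\<close>, measurable)
  then show ?thesis
    using absorption_limit[OF past_event_start, of "axis i 1" "axis i 1"]
    by (simp add: start_prob extinction_prob_def)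
qed

text \<open>The first-generation decomposition of extinction by time \<open>Suc n\<close>, with
  \<open>n\<close> sent to infinity under the integral.\<close>

lemma extinction_prob_fixpoint:
  "(\<integral>z. monomial (extinction_prob P X) z \<partial>p i) = extinction_prob P X $ i"
proof -
  have lim: "(\<lambda>n. gw_prob p n z {0}) \<longlonglongrightarrow> monomial (extinction_prob P X) z" for z
    unfolding gw_prob_0_eq[of p _ z] unfolding monomial_def
    by (simp, intro tendsto_intros extinction_prob_limit)
  have "(\<lambda>n. \<integral>z. gw_prob p n z {0} \<partial>p i) \<longlonglongrightarrow> (\<integral>z. monomial (extinction_prob P X) z \<partial>p i)"
    by (rule integral_dominated_convergence[where w="\<lambda>_. 1"]) (auto simp: lim)
  then have "(\<lambda>n. gw_prob p (Suc n) (axis i 1) {0}) \<longlonglongrightarrow> (\<integral>z. monomial (extinction_prob P X) z \<partial>p i)"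
    by (simp only: gw_prob_Suc)
  then show ?thesis
    using LIMSEQ_Suc[OF extinction_prob_limit[of i]] LIMSEQ_unique by blast
qed

lemma prob_past_extinct:
  assumes E: "past_event m v E"
  shows "\<P>(\<omega> in P x. E (\<lambda>k. X k \<omega>) \<and> extinction_time X \<omega> < \<infinity>) =
    \<P>(\<omega> in P x. E (\<lambda>k. X k \<omega>)) * monomial (extinction_prob P X) v"
proof -
  have "(\<lambda>n. gw_prob p n v {0}) \<longlonglongrightarrow> monomial (extinction_prob P X) v"
    unfolding gw_prob_0_eq[of p _ v] unfolding monomial_def
    by (simp, intro tendsto_intros extinction_prob_limit)
  then have "(\<lambda>n. \<P>(\<omega> in P x. E (\<lambda>k. X k \<omega>)) * gw_prob p n v {0}) \<longlonglongrightarrow>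
      \<P>(\<omega> in P x. E (\<lambda>k. X k \<omega>)) * monomial (extinction_prob P X) v"
    by (intro tendsto_intros)
  with absorption_limit[OF E] show ?thesis by (rule LIMSEQ_unique)
qed

lemma prob_past_future_extinct:
  assumes E: "past_event m v E" and tilt: "tilted p (extinction_prob P X) p'"
  shows "\<P>(\<omega> in P x. E (\<lambda>k. X k \<omega>) \<and> X (m + n) \<omega> \<in> S \<and> extinction_time X \<omega> < \<infinity>) =
    \<P>(\<omega> in P x. E (\<lambda>k. X k \<omega>)) * monomial (extinction_prob P X) v * gw_prob p' n v S"
proof -
  let ?q = "extinction_prob P X"
  have q: "0 < ?q $ i" for i using tilt by (simp add: tilted_def)
  note [simp] = monomial_nonneg[OF less_imp_le[OF q]]
  have [measurable]: "{\<omega>\<in>space (P x). E (\<lambda>k. X k \<omega>)} \<in> sets (P x)"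
    by (rule emeasure_past_event(2)[OF E, of _ "\<lambda>_. True"]) simp
  define D where "D z = {\<omega>\<in>space (P x). (E (\<lambda>k. X k \<omega>) \<and> X (m + n) \<omega> = z) \<and> extinction_time X \<omega> < \<infinity>}" for z
  have [measurable]: "D z \<in> sets (P x)" for z unfolding D_def extinction_time_finite_iff by measurable
  have D: "measure (P x) (D z) = \<P>(\<omega> in P x. E (\<lambda>k. X k \<omega>)) * pmf (gw_iter p n v) z * monomial ?q z" for z
  proof -
    \<comment> \<open>Fixing the state \<open>z\<close> reached at \<open>m + n\<close> yields a
      past event again, after which extinction has probability \<open>monomial q z\<close>. Summed
      over \<open>S\<close>, these weights turn the kernel of \<open>p\<close> into that of
      \<open>p'\<close>.\<close>
    have "past_event (m + n) z (\<lambda>y. E y \<and> y (m + n) = z)"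
      using E unfolding past_event_def by (metis le_add1 order_trans order_refl)
    from prob_past_extinct[OF this, of x] show ?thesis by (simp add: D_def markov[OF E])
  qed
  have "{\<omega>\<in>space (P x). E (\<lambda>k. X k \<omega>) \<and> X (m + n) \<omega> \<in> S \<and> extinction_time X \<omega> < \<infinity>} = (\<Union>z\<in>S. D z)"
    by (auto simp: D_def)
  then have "emeasure (P x) {\<omega>\<in>space (P x). E (\<lambda>k. X k \<omega>) \<and> X (m + n) \<omega> \<in> S \<and> extinction_time X \<omega> < \<infinity>} =
      (\<integral>\<^sup>+z. emeasure (P x) (D z) \<partial>count_space S)"
    by (simp only:) (rule emeasure_UN_countable, simp_all, auto simp: disjoint_family_on_def D_def)
  also have "\<dots> = (\<integral>\<^sup>+z. ennreal \<P>(\<omega> in P x. E (\<lambda>k. X k \<omega>)) *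
      (ennreal (pmf (gw_iter p n v) z) * (ennreal (monomial ?q z) * indicator S z)) \<partial>count_space UNIV)"
    unfolding emeasure_eq_measure D
    by (subst nn_integral_count_space_indicator) (auto intro!: nn_integral_cong simp: ennreal_mult mult_ac split: split_indicator)
  also have "\<dots> = ennreal \<P>(\<omega> in P x. E (\<lambda>k. X k \<omega>)) * (\<integral>\<^sup>+z. ennreal (monomial ?q z) * indicator S z \<partial>gw_iter p n v)"
    by (simp add: nn_integral_cmult nn_integral_measure_pmf)
  also have "(\<integral>\<^sup>+z. ennreal (monomial ?q z) * indicator S z \<partial>gw_iter p n v) = ennreal (monomial ?q v) * ennreal (gw_prob p' n v S)"
    unfolding nn_integral_tilted_iter[OF tilt, symmetric] by (simp add: measure_pmf.emeasure_eq_measure)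
  finally show ?thesis
    unfolding emeasure_eq_measure by (simp add: ennreal_mult[symmetric] mult.assoc)
qed

end

lemma prob_past_tilted:
  assumes chain: "gw_chain p P X" "gw_chain p' P' X'" and tilt: "tilted p q p'" and E: "past_event m v E"
  shows "\<P>(\<omega> in P x. E (\<lambda>k. X k \<omega>)) * monomial q v = monomial q x * \<P>(\<omega> in P' x. E (\<lambda>k. X' k \<omega>))"
proof -
  interpret A: gw_chain p P X by fact
  interpret B: gw_chain p' P' X' by fact
  have q: "0 < q $ i" for i using tilt by (simp add: tilted_def)
  note [simp] = monomial_nonneg[OF less_imp_le[OF q]]
  \<comment> \<open>The weights telescope along the path, leaving only those of its two
    endpoints.\<close>
  have prod: "(\<Prod>k<n. pmf (gw_step p (y k)) (y (Suc k))) * monomial q (y n) =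
      monomial q (y 0) * (\<Prod>k<n. pmf (gw_step p' (y k)) (y (Suc k)))" for n and y :: "nat \<Rightarrow> nat ^ 'a"
  proof (induction n)
    case (Suc n)
    have "(\<Prod>k<Suc n. pmf (gw_step p (y k)) (y (Suc k))) * monomial q (y (Suc n)) =
        (\<Prod>k<n. pmf (gw_step p (y k)) (y (Suc k))) * (monomial q (y n) * pmf (gw_step p' (y n)) (y (Suc n)))"
      by (simp add: pmf_tilted_step[OF tilt] mult_ac)
    also have "\<dots> = monomial q (y 0) * (\<Prod>k<Suc n. pmf (gw_step p' (y k)) (y (Suc k)))"
      unfolding mult.assoc[symmetric] Suc by simp
    finally show ?case .
  qed simp
  have "emeasure (P x) {\<omega>\<in>space (P x). E (\<lambda>k. X k \<omega>) \<and> True} * ennreal (monomial q v) =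
      (\<integral>\<^sup>+y. emeasure (P x) {\<omega>\<in>space (P x). (\<forall>k\<le>m. X k \<omega> = y k) \<and> True} * ennreal (monomial q v)
      \<partial>count_space {y \<in> {..m} \<rightarrow>\<^sub>E UNIV. E y})"
    by (subst A.emeasure_past_event[OF E]) (simp_all add: nn_integral_multc)
  also have "\<dots> = (\<integral>\<^sup>+y. ennreal (monomial q x) * emeasure (P' x) {\<omega>\<in>space (P' x). (\<forall>k\<le>m. X' k \<omega> = y k) \<and> True}
      \<partial>count_space {y \<in> {..m} \<rightarrow>\<^sub>E UNIV. E y})"
  proof (rule nn_integral_cong)
    fix y assume "y \<in> space (count_space {y \<in> {..m} \<rightarrow>\<^sub>E UNIV. E y})"
    then have "y m = v" using E by (auto simp: past_event_def)
    then show "emeasure (P x) {\<omega>\<in>space (P x). (\<forall>k\<le>m. X k \<omega> = y k) \<and> True} * ennreal (monomial q v) =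
        ennreal (monomial q x) * emeasure (P' x) {\<omega>\<in>space (P' x). (\<forall>k\<le>m. X' k \<omega> = y k) \<and> True}"
      using prod[of y m] A.path_prob[of x m y] B.path_prob[of x m y]
      by (simp add: A.emeasure_eq_measure B.emeasure_eq_measure ennreal_mult[symmetric] prod_nonneg)
  qed
  also have "\<dots> = ennreal (monomial q x) * emeasure (P' x) {\<omega>\<in>space (P' x). E (\<lambda>k. X' k \<omega>) \<and> True}"
    by (subst B.emeasure_past_event[OF E]) (simp_all add: nn_integral_cmult)
  finally show ?thesis
    by (simp add: A.emeasure_eq_measure B.emeasure_eq_measure ennreal_mult[symmetric])
qed

section \<open>From the conditional law to the ratio limit\<close>

theorem theorem1:
  fixes p p' :: "'d::finite \<Rightarrow> (nat ^ 'd) pmf"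
    and P :: "nat ^ 'd \<Rightarrow> 'w measure" and X :: "nat \<Rightarrow> 'w \<Rightarrow> nat ^ 'd"
    and P' :: "nat ^ 'd \<Rightarrow> 'v measure" and X' :: "nat \<Rightarrow> 'v \<Rightarrow> nat ^ 'd"
    and S :: "(nat ^ 'd) set"
    and x0 :: "nat ^ 'd" and j :: nat and k :: "nat \<Rightarrow> nat" and x :: "nat \<Rightarrow> nat ^ 'd"
  defines "\<rho> \<equiv> perron_root (mean_matrix P X)"
    and "\<rho>' \<equiv> perron_root (mean_matrix P' X')"
    and "u' \<equiv> perron_right (mean_matrix P' X')"
  assumes process: "gw_process p P X"
    and A1: "assumption_A1 p P X"
    and associated: "associated_offspring p (extinction_prob P X) p'" "gw_process p' P' X'"
    and S: "S \<subseteq> - {0}"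
    and conditioning_defined: "accessible P X S"
    and cases: "\<rho> \<le> 1 \<Longrightarrow>
        (finite S \<and> accessible P X S) \<or>
        finite (- ({0} \<union> S)) \<or>
        (\<rho> < 1 \<and> finite_X_ln_X P X)"
    and x0: "x0 \<noteq> 0"
    and j: "j \<ge> 1"
    and k_pos: "\<And>i. i \<in> {1..j} \<Longrightarrow> k i > 0"
    and k_mono: "\<And>i. i \<in> {1..<j} \<Longrightarrow> k i \<le> k (Suc i)"
  shows "(\<lambda>n. \<P>(\<omega> in P x0. (\<forall>i\<in>{1..j}. X (k i) \<omega> = x i)
              \<bar> X (k j + n) \<omega> \<in> S \<and> extinction_time X \<omega> < \<infinity>))
         \<longlonglongrightarrow> 1 / \<rho>' ^ k j * ((real_vec (x j) \<bullet> u') / (real_vec x0 \<bullet> u'))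
              * \<P>(\<omega> in P' x0. \<forall>i\<in>{1..j}. X' (k i) \<omega> = x i)"
proof -
  interpret A: gw_chain p P X using process by unfold_locales
  interpret B: gw_chain p' P' X' using associated(2) by unfold_locales
  define q where "q = extinction_prob P X"
  have q: "0 < q $ i" for i using A1 by (simp add: assumption_A1_def q_def)
  have q1: "q $ i \<le> 1" for i
    by (rule LIMSEQ_le_const2[OF A.extinction_prob_limit[of i, folded q_def]]) auto
  have tilt: "tilted p q p'"
    using associated(1) q q1 A.extinction_prob_fixpoint unfolding q_def by (rule tilted_of_associated)
  interpret T: tilted_gw p p' q
  proof
    show "finite_offspring_mean p" using A1 by (simp add: assumption_A1_def A.finite_means_iff)
    show "primitive_matrix (offspring_mean p)"
      using A1 by (simp add: assumption_A1_def positive_regular_def A.mean_matrix_eq primitive_matrix_def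
          offspring_mean_nonneg)
    show "(\<lambda>n. gw_prob p n (axis i 1) {0}) \<longlonglongrightarrow> q $ i" for i
      unfolding q_def by (rule A.extinction_prob_limit)
  qed (rule tilt)
  \<comment> \<open>Positive weights transfer accessibility of \<open>S\<close> to the associated
    process.\<close>
  have acc: "\<exists>n. 0 < gw_prob p' n y S" if y: "y \<noteq> 0" for y
  proof -
    obtain n where n: "0 < gw_prob p n y S"
      using conditioning_defined y by (auto simp: accessible_def A.prob_X)
    then obtain z where z: "z \<in> set_pmf (gw_iter p n y)" "z \<in> S"
      by (metis disjoint_iff less_irrefl measure_pmf_zero_iff)
    have "gw_prob p' n y S \<noteq> 0"
    proof
      assume "gw_prob p' n y S = 0"
      then have "(\<integral>\<^sup>+z. ennreal (monomial q z) * indicator S z \<partial>gw_iter p n y) = 0"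
        unfolding nn_integral_tilted_iter[OF tilt, symmetric] by (simp add: measure_pmf.emeasure_eq_measure)
      then have "ennreal (monomial q z) * indicator S z = 0"
        using z(1) by (subst (asm) nn_integral_0_iff_AE) (auto simp: AE_measure_pmf_iff)
      then show False using z(2) monomial_pos[of q z] q by (simp add: ennreal_eq_0_iff not_le)
    qed
    then show ?thesis by (auto simp: less_le intro!: exI[of _ n])
  qed
  have S0: "0 \<notin> S" using S by auto
  have "T.assoc.ratio_limit S"
  proof (cases "\<rho> \<le> 1")
    case True
    from cases[OF True] show ?thesis
    proof (elim disjE conjE)
      assume "finite S"
      then show ?thesis using S0 acc by (rule T.assoc.ratio_limit_finite)
    next
      assume "finite (- ({0} \<union> S))"
      then show ?thesis using S0 acc by (rule T.assoc.ratio_limit_cofinite)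
    next
      assume "\<rho> < 1"
      then have "perron_root (offspring_mean p') < 1"
        by (intro T.subcritical') (simp add: \<rho>_def A.mean_matrix_eq)
      then show ?thesis using S0 acc by (rule T.assoc.ratio_limit_subcritical)
    qed
  next
    case False
    then have "perron_root (offspring_mean p') < 1"
      by (intro T.supercritical') (simp add: \<rho>_def A.mean_matrix_eq)
    then show ?thesis using S0 acc by (rule T.assoc.ratio_limit_subcritical)
  qed
  then have lim: "(\<lambda>n. gw_prob p' n (x j) S / gw_prob p' (k j + n) x0 S) \<longlonglongrightarrow>
      1 / \<rho>' ^ k j * ((real_vec (x j) \<bullet> u') / (real_vec x0 \<bullet> u'))"
    using x0 by (simp add: T.assoc.ratio_limit_def \<rho>'_def u'_def B.mean_matrix_eq)
  define E where "E y \<longleftrightarrow> (\<forall>i\<in>{1..j}. y (k i) = x i)" for y :: "nat \<Rightarrow> nat ^ 'd"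
  have k_le: "k i \<le> k j" if "i \<in> {1..j}" for i
  proof -
    have "i \<le> j" "1 \<le> i" using that by auto
    then show ?thesis
    proof (induction rule: inc_induct)
      case (step n)
      then show ?case using k_mono[of n] by simp
    qed simp
  qed
  \<comment> \<open>\<open>j \<ge> 1\<close> puts the constraint at time \<open>k j\<close> into
    \<open>E\<close>, and monotonicity makes \<open>k j\<close> the last time involved.\<close>
  have E: "past_event (k j) (x j) E"
    unfolding past_event_def E_def using k_le j by auto
  let ?ext = "\<lambda>\<omega>. extinction_time X \<omega> < \<infinity>"
  \<comment> \<open>The weight \<open>monomial q (x j)\<close> created by extinction after the past
    is exchanged for \<open>monomial q x0\<close> when the path is rewritten in terms of the
    associated process; the denominator carries the same factor, and it cancels.\<close>
  have num: "\<P>(\<omega> in P x0. E (\<lambda>k. X k \<omega>) \<and> X (k j + n) \<omega> \<in> S \<and> ?ext \<omega>) =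
      monomial q x0 * (\<P>(\<omega> in P' x0. E (\<lambda>k. X' k \<omega>)) * gw_prob p' n (x j) S)" for n
    using A.prob_past_future_extinct[OF E tilt[unfolded q_def], of x0 n S]
      prob_past_tilted[OF A.gw_chain_axioms B.gw_chain_axioms tilt E, of x0]
    by (simp add: q_def mult.assoc)
  have den: "\<P>(\<omega> in P x0. X (k j + n) \<omega> \<in> S \<and> ?ext \<omega>) = monomial q x0 * gw_prob p' (k j + n) x0 S" for n
  proof -
    have "\<P>(\<omega> in P x0. X (k j + n) \<omega> \<in> S \<and> ?ext \<omega>) =
        \<P>(\<omega> in P x0. X 0 \<omega> = x0 \<and> X (0 + (k j + n)) \<omega> \<in> S \<and> ?ext \<omega>)"
    proof (rule A.finite_measure_eq_AE)
      show "AE \<omega> in P x0. (\<omega> \<in> {\<omega>\<in>space (P x0). X (k j + n) \<omega> \<in> S \<and> ?ext \<omega>}) =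
          (\<omega> \<in> {\<omega>\<in>space (P x0). X 0 \<omega> = x0 \<and> X (0 + (k j + n)) \<omega> \<in> S \<and> ?ext \<omega>})"
        using A.AE_start[of x0] by eventually_elim auto
    qed (unfold extinction_time_finite_iff, measurable)
    also have "\<dots> = monomial q x0 * gw_prob p' (k j + n) x0 S"
      using A.prob_past_future_extinct[OF A.past_event_start tilt[unfolded q_def], of x0 x0 "k j + n" S]
      by (simp add: A.start_prob q_def)
    finally show ?thesis .
  qed
  have "0 < monomial q x0" by (rule monomial_pos) (rule q)
  then have eq: "\<P>(\<omega> in P x0. E (\<lambda>k. X k \<omega>) \<bar> X (k j + n) \<omega> \<in> S \<and> ?ext \<omega>) =
      gw_prob p' n (x j) S / gw_prob p' (k j + n) x0 S * \<P>(\<omega> in P' x0. E (\<lambda>k. X' k \<omega>))" for n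
    unfolding cond_prob_def num den by simp
  have "(\<lambda>n. \<P>(\<omega> in P x0. E (\<lambda>k. X k \<omega>) \<bar> X (k j + n) \<omega> \<in> S \<and> ?ext \<omega>)) \<longlonglongrightarrow>
      1 / \<rho>' ^ k j * ((real_vec (x j) \<bullet> u') / (real_vec x0 \<bullet> u')) * \<P>(\<omega> in P' x0. E (\<lambda>k. X' k \<omega>))"
    unfolding eq by (intro tendsto_mult lim tendsto_const)
  then show ?thesis unfolding E_def .
qed

end
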